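(* Let $m\ge1$ and, for $i=1,\ldots,m$, let $\psi_i:\mathbb{N}\to(0,\infty)$ be decreasing, put \[ \lambda_i:=\liminf_{q\to\infty}\frac{-\log\psi_i(q)}{\log q}\in[0,\infty], \] and assume that $\lambda_i>2$ for each $i$ (the value $\lambda_i=\infty$ is allowed). Then \[ \dim_H\bigl(E(\psi_1)\times\cdots\times E(\psi_m)\bigr)=m-1+\min_{1\le i\le m}\frac{2}{\lambda_i}, \qquad \dim_P\bigl(E(\psi_1)\times\cdots\times E(\psi_m)\bigr)=m, \] where $2/\infty=0$. In particular, the formula holds for $\psi_i(q)=q^{-\lambda_i}$ with $\lambda_i>2$.
   Context: $\mathbb{N}=\{1,2,\ldots\}$. For a function $\psi:\mathbb{N}\to(0,\infty)$ let \[ W(\psi)=\left\{x\in[0,1):\left|x-\frac pq\right|<\psi(q)\text{ for infinitely many }(p,q)\in\mathbb{Z}\times\mathbb{N}\right\}, \qquad E(\psi)=W(\psi)\setminus\bigcup_{0<c<1}W(c\psi), \] where $c\psi$ denotes the function $q\mapsto c\,\psi(q)$. $\dim_H$ and $\dim_P$ denote Hausdorff and packing dimension; the product set is a subset of $\mathbb{R}^m$ with its usual metric. *)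

theory Defs
  imports "HOL-Analysis.Analysis"
begin

section \<open>Exact approximation order\<close>

text \<open>Functions on the positive integers are represented by functions on \<^typ>\<open>nat\<close>
  whose value at \<open>0\<close> is never used. The pairs \<open>(p, q)\<close> are not required to be coprime.\<close>

definition approx_set :: "(nat \<Rightarrow> real) \<Rightarrow> real set" where
  "approx_set \<psi> = {x \<in> {0..<1}.
     infinite {(p :: int, q :: nat). q \<ge> 1 \<and> \<bar>x - of_int p / of_nat q\<bar> < \<psi> q}}"

definition exact_set :: "(nat \<Rightarrow> real) \<Rightarrow> real set" where
  "exact_set \<psi> = approx_set \<psi> - (\<Union>c\<in>{0<..<1}. approx_set (\<lambda>q. c * \<psi> q))"

definition exact_prod :: "('m::finite \<Rightarrow> nat \<Rightarrow> real) \<Rightarrow> (real ^ 'm) set" where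
  "exact_prod \<psi> = {x. \<forall>i. x $ i \<in> exact_set (\<psi> i)}"

definition lower_order :: "(nat \<Rightarrow> real) \<Rightarrow> ereal" where
  "lower_order \<psi> = liminf (\<lambda>q. ereal (- ln (\<psi> q) / ln (real q)))"

section \<open>Hausdorff dimension\<close>

text \<open>The cases implement the usual conventions at diameter zero: the empty set contributes
  \<open>0\<close>, and a nonempty set contributes \<open>1\<close> if \<open>s = 0\<close>
  (whereas \<open>0 powr 0 = 0\<close>).\<close>

definition diam_pow :: "real \<Rightarrow> 'a::metric_space set \<Rightarrow> ennreal" where
  "diam_pow s U = (if U = {} then 0 else if s = 0 then 1 else ennreal (diameter U powr s))"

text \<open>Boundedness is required because \<^const>\<open>diameter\<close> is only meaningful
  for bounded sets.\<close>

definition delta_covers :: "real \<Rightarrow> 'a::metric_space set \<Rightarrow> (nat \<Rightarrow> 'a set) set" where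
  "delta_covers \<delta> A =
     {U. A \<subseteq> (\<Union>n. U n) \<and> (\<forall>n. bounded (U n) \<and> diameter (U n) \<le> \<delta>)}"

definition hausdorff_measure :: "real \<Rightarrow> 'a::metric_space set \<Rightarrow> ennreal" where
  "hausdorff_measure s A =
     (SUP \<delta>\<in>{0<..}. INF U\<in>delta_covers \<delta> A. (\<Sum>n. diam_pow s (U n)))"

definition hausdorff_dim :: "'a::metric_space set \<Rightarrow> ereal" where
  "hausdorff_dim A = Inf {ereal s | s. 0 \<le> s \<and> hausdorff_measure s A = 0}"

section \<open>Packing dimension\<close>

text \<open>A packing is a set of pairs (centre, radius). Uncountable packings need not be excluded:
  the sums below are suprema over finite subfamilies.\<close>

definition delta_packings :: "real \<Rightarrow> 'a::metric_space set \<Rightarrow> ('a \<times> real) set set" where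
  "delta_packings \<delta> A =
     {F. F \<subseteq> A \<times> {0<..\<delta>} \<and> disjoint_family_on (\<lambda>(x, r). cball x r) F}"

text \<open>The diameter of a ball is taken to be twice its radius, which is exact in nonzero
  Euclidean spaces.\<close>

definition packing_premeasure :: "real \<Rightarrow> 'a::metric_space set \<Rightarrow> ennreal" where
  "packing_premeasure s A =
     (INF \<delta>\<in>{0<..}. SUP F\<in>delta_packings \<delta> A.
        (\<Sum>\<^sub>\<infinity>(x, r)\<in>F. ennreal ((2 * r) powr s)))"

definition packing_measure :: "real \<Rightarrow> 'a::metric_space set \<Rightarrow> ennreal" where
  "packing_measure s A =
     (INF B\<in>{B :: nat \<Rightarrow> 'a set. A \<subseteq> (\<Union>n. B n)}. (\<Sum>n. packing_premeasure s (B n)))"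

definition packing_dim :: "'a::metric_space set \<Rightarrow> ereal" where
  "packing_dim A = Inf {ereal s | s. 0 \<le> s \<and> packing_measure s A = 0}"

end

theory Submission
  imports Defs "HOL-Real_Asymp.Real_Asymp"
begin

text \<open>For the lower bounds we build, for each coordinate, nested finite families of intervals. An
  interval is refined by choosing a large \<open>Q\<close> and about \<open>Q\<^sup>2\<close> fractions \<open>p / q\<close> in it, with \<open>q\<close> comparable
  to \<open>Q\<close> and \<open>p / q\<close> far from the relevant fractions of smaller denominator, and passing to points \<open>x\<close> with
  \<open>(1 - \<eta>) * \<psi> q \<le> x - p / q < \<psi> q\<close>. Since \<open>\<Sum>q. q * \<psi> q\<close> converges with room to spare, Dirichlet's
  theorem provides a positive proportion of such fractions. The uniform distribution on the intervals
  is one-dimensional except between the scale \<open>1 / Q\<^sup>2\<close> and some much smaller scale, where its exponent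
  drops to about \<open>2 / \<lambda>\<close>. The coordinates are refined in turn, each time with \<open>Q\<close> so large that these exceptional
  ranges are disjoint for different coordinates. Hence at each scale at most one coordinate is
  exceptional, which gives the exponent \<open>m - 1 + 2 / \<lambda>\<close>, and at suitable scales none is, which gives
  packing dimension \<open>m\<close>. Compactness replaces the limit measure by the counting measure of a late stage.
  The upper bound for the Hausdorff dimension comes from the cover of \<open>m - 1\<close> coordinates by cubes of
  side \<open>\<psi> q\<close> and of one coordinate by the neighbourhoods of the \<open>p / q\<close>.\<close>

section \<open>Fractions and their neighbourhoods\<close>

text \<open>Exactness constrains every fraction: besides the chosen ones, which give the
  approximations, all others must stay at distance \<open>(1 - \<eta>) * \<psi> q'\<close>. Near a
  chosen fraction of denominator \<open>q\<close> three mechanisms share the denominators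
  \<open>q'\<close>: below \<open>q\<close> the choice of the fraction itself, from \<open>q\<close>
  up to \<open>1 / (2 * q * \<psi> q)\<close> the repulsion \<open>1 / (q * q')\<close> of distinct
  fractions, and beyond that the next refinement. The loss \<open>\<eta>\<close> tends to 0 along
  the construction, which excludes every \<open>c * \<psi>\<close> with \<open>c < 1\<close>.

  About \<open>\<psi>\<close> only a liminf is known: decay with some exponent above 2 holds for all
  large \<open>q\<close>, but a lower bound \<open>q powr - a\<close> just for infinitely many.
  Hence \<open>Q\<close> is taken from that infinite set, and monotonicity carries the bound to all
  \<open>q \<le> Q\<close>. With \<open>t = 0\<close> nothing is asked of \<open>\<psi> Q\<close>;
  this covers infinite order and the packing dimension.\<close>

lemma card_separated_le:
  fixes V :: "real set"
  assumes "V \<subseteq> {u..v}" "u \<le> v" "s > 0"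
    and sep: "\<And>x y. x \<in> V \<Longrightarrow> y \<in> V \<Longrightarrow> x \<noteq> y \<Longrightarrow> s \<le> \<bar>x - y\<bar>"
  shows "finite V" "real (card V) \<le> 1 + (v - u) / s"
proof -
  define f where "f x = nat \<lfloor>(x - u) / s\<rfloor>" for x
  have nn: "0 \<le> (x - u) / s" "(x - u) / s \<le> (v - u) / s" if "x \<in> V" for x
    using that assms(1,3) by (auto intro!: divide_right_mono)
  have inj: "inj_on f V"
  proof (rule inj_onI, rule ccontr)
    fix x y assume xy: "x \<in> V" "y \<in> V" "f x = f y" "x \<noteq> y"
    then have "\<lfloor>(x - u) / s\<rfloor> = \<lfloor>(y - u) / s\<rfloor>"
      using nn unfolding f_def by (metis eq_nat_nat_iff zero_le_floor)
    then have "\<bar>(x - u) / s - (y - u) / s\<bar> < 1" by linarith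
    then have "\<bar>x - y\<bar> < s" using \<open>s > 0\<close> by (simp add: diff_divide_distrib[symmetric] abs_divide)
    then show False using sep[of x y] xy by simp
  qed
  have sub: "f ` V \<subseteq> {..nat \<lfloor>(v - u) / s\<rfloor>}"
    using nn(2) by (auto simp: f_def intro!: nat_mono floor_mono)
  show "finite V" using inj finite_subset[OF sub] finite_imageD by blast
  have "card V \<le> nat \<lfloor>(v - u) / s\<rfloor> + 1"
    using card_mono[OF _ sub] card_image[OF inj] by simp
  moreover have "0 \<le> (v - u) / s" using assms by simp
  then have "real (nat \<lfloor>(v - u) / s\<rfloor>) \<le> (v - u) / s" by linarith
  ultimately show "real (card V) \<le> 1 + (v - u) / s" by linarith
qed

lemma distinct_fractions_apart:
  fixes p p' :: int and q q' :: nat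
  assumes "q \<ge> 1" "q' \<ge> 1" "real_of_int p / q \<noteq> p' / q'"
  shows "1 / (real q * real q') \<le> \<bar>p / q - p' / q'\<bar>"
proof -
  have "p / q - p' / q' = real_of_int (p * int q' - p' * int q) / (real q * real q')"
    using assms by (simp add: field_simps)
  moreover have "p * int q' - p' * int q \<noteq> 0"
    using assms by (simp add: field_simps) (metis of_int_eq_iff of_int_mult of_int_of_nat_eq)
  then have "1 \<le> \<bar>real_of_int (p * int q' - p' * int q)\<bar>" by linarith
  ultimately show ?thesis by (simp add: abs_divide abs_mult divide_right_mono)
qed

text \<open>Values are counted rather than pairs \<open>(p, q)\<close>, so non-reduced fractions do
  no harm. Distinct values with denominators at most \<open>M\<close> are
  \<open>1 / M\<^sup>2\<close> apart.\<close>

lemma card_fractions_le: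
  fixes M :: real
  assumes "u \<le> v" "0 < M"
  defines "V \<equiv> {x. \<exists>(p::int) (q::nat). x = p / q \<and> 1 \<le> q \<and> real q \<le> M \<and> x \<in> {u..v}}"
  shows "finite V" "real (card V) \<le> 1 + M\<^sup>2 * (v - u)"
proof -
  have sep: "1 / M\<^sup>2 \<le> \<bar>x - y\<bar>" if xy: "x \<in> V" "y \<in> V" "x \<noteq> y" for x y
  proof -
    obtain p q p' q' where *: "x = real_of_int p / real q" "1 \<le> q" "q \<le> M"
      "y = real_of_int p' / real q'" "1 \<le> q'" "q' \<le> M" using xy unfolding V_def by blast
    have "real q * real q' \<le> M\<^sup>2"
      unfolding power2_eq_square using * by (intro mult_mono) auto
    then have "1 / M\<^sup>2 \<le> 1 / (real q * real q')" using * by (intro divide_left_mono) auto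
    then show ?thesis using distinct_fractions_apart[of q q' p p'] * xy by auto
  qed
  have "V \<subseteq> {u..v}" by (auto simp: V_def)
  from card_separated_le[OF this \<open>u \<le> v\<close> _ sep] show "finite V" "real (card V) \<le> 1 + M\<^sup>2 * (v - u)"
    using \<open>M > 0\<close> by (auto simp: mult.commute)
qed

lemma emeasure_UN_intervals_le:
  fixes V :: "real set"
  assumes "finite V" "r \<ge> 0" "A \<subseteq> (\<Union>v\<in>V. {v - r..v + r})" "A \<in> sets borel"
  shows "emeasure lborel A \<le> ennreal (real (card V) * (2 * r))"
proof -
  have "emeasure lborel A \<le> emeasure lborel (\<Union>v\<in>V. {v - r..v + r})"
    using assms by (intro emeasure_mono) auto
  also have "\<dots> \<le> (\<Sum>v\<in>V. emeasure lborel {v - r..v + r})"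
    using assms by (intro emeasure_subadditive_finite) auto
  also have "\<dots> = ennreal (real (card V) * (2 * r))"
    using assms by (simp add: ennreal_mult ennreal_of_nat_eq_real_of_nat)
  finally show ?thesis .
qed

section \<open>Measure of neighbourhoods of fractions\<close>

definition frac_nbhds :: "(nat \<Rightarrow> real) \<Rightarrow> nat set \<Rightarrow> real set" where
  "frac_nbhds f D = (\<Union>q\<in>D. \<Union>p::int. ball (p / q) (f q))"

lemma frac_nbhds_borel [measurable]: "frac_nbhds f D \<in> sets borel"
  unfolding frac_nbhds_def by (intro borel_open open_UN ballI open_ball)

lemma frac_nbhds_UN: "frac_nbhds f (\<Union>i\<in>I. D i) = (\<Union>i\<in>I. frac_nbhds f (D i))"
  unfolding frac_nbhds_def by blast

lemma frac_nbhds_mono: "D \<subseteq> D' \<Longrightarrow> frac_nbhds f D \<subseteq> frac_nbhds f D'"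
  unfolding frac_nbhds_def by blast

text \<open>Here \<open>\<beta>\<close> is any number strictly between 2 and the lower order, so
  finite and infinite orders are treated alike.\<close>

locale approx_fun =
  fixes \<psi> :: "nat \<Rightarrow> real" and \<beta> :: real
  assumes pos: "\<And>q. 1 \<le> q \<Longrightarrow> 0 < \<psi> q"
    and anti: "\<And>q q'. 1 \<le> q \<Longrightarrow> q \<le> q' \<Longrightarrow> \<psi> q' \<le> \<psi> q"
    and beta: "2 < \<beta>"
    and decay: "\<forall>\<^sub>F q in sequentially. \<psi> q \<le> real q powr - \<beta>"
begin

text \<open>All neighbourhoods of the block have radius at most \<open>3 * N powr - \<beta>\<close>,
  and of the order of \<open>N\<^sup>2 * L\<close> centres are involved. The factor 3 is the one
  that the Dirichlet argument produces.\<close>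

lemma dyadic_block_measure:
  fixes N L u :: real
  assumes N: "1 \<le> N" and NL: "1 \<le> N\<^sup>2 * L"
    and dec: "\<And>q::nat. N \<le> q \<Longrightarrow> \<psi> q \<le> real q powr - \<beta>"
  shows "emeasure lborel ({u..u+L} \<inter> frac_nbhds (\<lambda>q. 3 * \<psi> q) {q. N \<le> real q \<and> real q < 2 * N})
     \<le> ennreal (174 * L * N powr (2 - \<beta>))"
proof -
  have L: "L > 0" using NL N by (smt (verit) mult_nonneg_nonpos zero_le_power2)
  define c where "c = N powr - \<beta>"
  have c: "0 < c" using N by (simp add: c_def)
  have Nc: "N\<^sup>2 * c = N powr (2 - \<beta>)"
    using N unfolding c_def by (simp add: powr_diff powr_minus field_simps)
  have Nc1: "N powr (2 - \<beta>) \<le> 1"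
    using N beta powr_mono[of "2 - \<beta>" 0 N] by simp
  \<comment> \<open>The interval is widened by \<open>3 * c\<close> on both sides because a
    neighbourhood may meet it although its centre lies outside.\<close>
  define V where "V = {x. \<exists>(p::int) (q::nat). x = p / q \<and> 1 \<le> q \<and> real q \<le> 2 * N \<and> x \<in> {u - 3*c..u+L+3*c}}"
  have V: "finite V" "real (card V) \<le> 1 + (2*N)\<^sup>2 * ((u+L+3*c) - (u-3*c))"
    using card_fractions_le[of "u - 3*c" "u+L+3*c" "2*N"] L c N unfolding V_def by auto
  have "real (card V) \<le> 1 + 4 * (N\<^sup>2 * L) + 24 * (N\<^sup>2 * c)"
    using V(2) by (simp add: algebra_simps power2_eq_square)
  \<comment> \<open>\<open>29 = 1 + 4 + 24\<close>, since
    \<open>N\<^sup>2 * c \<le> 1 \<le> N\<^sup>2 * L\<close>; below,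
    \<open>174 = 6 * 29\<close>.\<close>
  also have "\<dots> \<le> 29 * (N\<^sup>2 * L)" using NL Nc Nc1 by linarith
  finally have cV: "real (card V) \<le> 29 * (N\<^sup>2 * L)" .
  have sub: "{u..u+L} \<inter> frac_nbhds (\<lambda>q. 3 * \<psi> q) {q. N \<le> real q \<and> real q < 2 * N}
      \<subseteq> (\<Union>v\<in>V. {v - 3*c..v + 3*c})"
  proof
    fix x assume "x \<in> {u..u+L} \<inter> frac_nbhds (\<lambda>q. 3 * \<psi> q) {q. N \<le> real q \<and> real q < 2 * N}"
    then obtain p :: int and q :: nat where x: "x \<in> {u..u+L}" and q: "N \<le> q" "q < 2 * N"
      and d: "dist (p / q) x < 3 * \<psi> q" by (auto simp: frac_nbhds_def)
    have "\<psi> q \<le> real q powr - \<beta>" using dec q by simp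
    also have "\<dots> \<le> c" unfolding c_def using q N beta by (intro powr_mono2') auto
    finally have "\<bar>x - p / q\<bar> < 3 * c" using d by (simp add: dist_real_def)
    then have "p / q \<in> V" "x \<in> {p / q - 3*c..p / q + 3*c}"
      unfolding V_def using x q N by (auto intro!: exI[of _ p] exI[of _ q])
    then show "x \<in> (\<Union>v\<in>V. {v - 3*c..v + 3*c})" by blast
  qed
  have "emeasure lborel ({u..u+L} \<inter> frac_nbhds (\<lambda>q. 3 * \<psi> q) {q. N \<le> real q \<and> real q < 2 * N})
     \<le> ennreal (real (card V) * (2 * (3 * c)))"
    using c by (intro emeasure_UN_intervals_le[OF V(1) _ sub]) auto
  also have "\<dots> \<le> ennreal (29 * (N\<^sup>2 * L) * (2 * (3 * c)))"
    using cV c by (intro ennreal_leI mult_right_mono) auto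
  also have "29 * (N\<^sup>2 * L) * (2 * (3 * c)) = 174 * L * N powr (2 - \<beta>)"
    using Nc by (simp add: algebra_simps)
  finally show ?thesis .
qed

text \<open>Counting all fractions of a dyadic block of denominators at once matters: an interval of
  length \<open>L\<close> contains \<open>O(N\<^sup>2 * L)\<close> of them as soon as \<open>1 \<le> N\<^sup>2 * L\<close>, whereas the boundary terms in a
  count for each single denominator would be too large for \<open>\<beta>\<close> near \<open>2\<close>.\<close>

lemma tail_measure:
  "\<forall>\<^sub>F T in at_top. \<forall>u L. 1 \<le> T\<^sup>2 * L \<longrightarrow>
     emeasure lborel ({u..u+L} \<inter> frac_nbhds (\<lambda>q. 3 * \<psi> q) {q. T \<le> real q}) \<le> ennreal (L / 2)"
proof -
  define x where "x = 2 powr (2 - \<beta>)"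
  have x: "0 < x" "x < 1" unfolding x_def using beta by (auto simp: powr_less_one)
  have "((\<lambda>T. 174 * T powr (2 - \<beta>) / (1 - x)) \<longlongrightarrow> 0) at_top"
    using beta x by real_asymp
  then have "\<forall>\<^sub>F T in at_top. 174 * T powr (2 - \<beta>) / (1 - x) < 1/2"
    by (rule order_tendstoD) simp
  moreover obtain n0 where n0: "\<And>q. q \<ge> n0 \<Longrightarrow> \<psi> q \<le> real q powr - \<beta>"
    using decay unfolding eventually_sequentially by blast
  have "\<forall>\<^sub>F T in at_top. real n0 \<le> T" "\<forall>\<^sub>F T in at_top. (1::real) \<le> T"
    by (auto intro: eventually_ge_at_top)
  ultimately show ?thesis
  proof eventually_elim
    case (elim T)
    show ?case
    proof (intro allI impI)
      fix u L assume TL: "1 \<le> T\<^sup>2 * L"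
      have L: "L > 0" using TL by (smt (verit) mult_nonneg_nonpos zero_le_power2)
      define N where "N j = T * 2 ^ j" for j :: nat
      define B where "B j = {u..u+L} \<inter> frac_nbhds (\<lambda>q. 3 * \<psi> q) {q. N j \<le> real q \<and> real q < 2 * N j}" for j
      have cover: "{q. T \<le> real q} \<subseteq> (\<Union>j. {q. N j \<le> real q \<and> real q < 2 * N j})"
      proof
        fix q assume q: "q \<in> {q. T \<le> real q}"
        then have q1: "real q / T \<ge> 1" using elim by simp
        have ex: "\<exists>j::nat. real q / T < 2 ^ j" using real_arch_pow[of 2 "real q / T"] by simp
        define j where "j = (LEAST j::nat. real q / T < 2 ^ j)"
        have j: "real q / T < 2 ^ j" unfolding j_def using ex by (rule LeastI_ex)
        have "j \<noteq> 0" using j q1 by (cases j) auto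
        then obtain k where k: "j = Suc k" by (cases j) auto
        have "\<not> real q / T < 2 ^ k" using not_less_Least[of k "\<lambda>j. real q / T < 2 ^ j"] k j_def by simp
        then have "N k \<le> real q" "real q < 2 * N k" using j k elim by (auto simp: N_def field_simps)
        then show "q \<in> (\<Union>j. {q. N j \<le> real q \<and> real q < 2 * N j})" by blast
      qed
      have Nj: "T \<le> N j" for j
        unfolding N_def using elim mult_left_mono[of 1 "2^j" T] by simp
      have Bj: "emeasure lborel (B j) \<le> ennreal (174 * L * T powr (2 - \<beta>) * x ^ j)" for j
      proof -
        \<comment> \<open>Each block inherits the hypothesis on \<open>T\<close> because
          \<open>T \<le> N j\<close>; thus one \<open>T\<close> serves every interval with
          \<open>1 \<le> T\<^sup>2 * L\<close>.\<close>
        have "1 \<le> (N j)\<^sup>2 * L"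
          using TL Nj[of j] elim(2,3) L by (smt (verit) mult_right_mono power_mono)
        moreover have "\<psi> q \<le> real q powr - \<beta>" if "N j \<le> real q" for q
          using that n0 Nj[of j] elim by simp
        ultimately have "emeasure lborel (B j) \<le> ennreal (174 * L * N j powr (2 - \<beta>))"
          unfolding B_def using dyadic_block_measure[of "N j" L u] Nj[of j] elim by simp
        also have "N j powr (2 - \<beta>) = T powr (2 - \<beta>) * x ^ j"
          using elim unfolding N_def x_def
          by (simp add: powr_mult powr_powr powr_realpow[symmetric] mult.commute)
        finally show ?thesis by (simp add: mult.assoc)
      qed
      have "{u..u+L} \<inter> frac_nbhds (\<lambda>q. 3 * \<psi> q) {q. T \<le> real q} \<subseteq> (\<Union>j. B j)"
        using frac_nbhds_mono[OF cover] unfolding frac_nbhds_UN B_def by blast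
      then have "emeasure lborel ({u..u+L} \<inter> frac_nbhds (\<lambda>q. 3 * \<psi> q) {q. T \<le> real q})
          \<le> emeasure lborel (\<Union>j. B j)"
        unfolding B_def by (intro emeasure_mono) auto
      also have "\<dots> \<le> (\<Sum>j. emeasure lborel (B j))"
        by (intro emeasure_subadditive_countably) (auto simp: B_def)
      also have "\<dots> \<le> (\<Sum>j. ennreal (174 * L * T powr (2 - \<beta>) * x ^ j))"
        using Bj by (intro suminf_le) auto
      also have "\<dots> = ennreal (174 * L * T powr (2 - \<beta>) * (1 / (1 - x)))"
        using x L by (intro suminf_ennreal_eq sums_mult geometric_sums) auto
      also have "\<dots> = ennreal (L * (174 * T powr (2 - \<beta>) / (1 - x)))"
        by (simp add: mult_ac)
      also have "\<dots> \<le> ennreal (L * (1/2))"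
        using elim L by (intro ennreal_leI mult_left_mono) auto
      finally show "emeasure lborel ({u..u+L} \<inter> frac_nbhds (\<lambda>q. 3 * \<psi> q) {q. T \<le> real q})
         \<le> ennreal (L / 2)" by simp
    qed
  qed
qed

end

lemma harm_le_ln: "n \<ge> 1 \<Longrightarrow> harm n \<le> 1 + ln (real n)"
  using decseqD[OF decseq_harm_diff_ln, of 0 "n - 1"] by (simp add: harm_def)

text \<open>These are the points whose Dirichlet fraction may have denominator at most
  \<open>Q / 16\<close>. A denominator \<open>q\<close> contributes at most
  \<open>(q * L + 3) * 2 / (q * Q)\<close>: the main terms \<open>2 * L / Q\<close> add up to at
  most \<open>L / 8\<close>, and the boundary terms to a harmonic sum divided by \<open>Q\<close>,
  which vanishes as \<open>Q\<close> grows with \<open>L\<close> fixed.\<close>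

lemma small_denominators_measure:
  assumes "L > 0"
  shows "\<forall>\<^sub>F Q in sequentially. \<forall>u. emeasure lborel ({u..u+L} \<inter>
     frac_nbhds (\<lambda>q. 1 / (real q * real Q)) {q. 1 \<le> q \<and> 16 * q \<le> Q}) \<le> ennreal (L / 4)"
proof -
  have "(\<lambda>Q::nat. 6 * (1 + ln (real Q)) / real Q) \<longlonglongrightarrow> 0" by real_asymp
  then have "\<forall>\<^sub>F Q::nat in sequentially. 6 * (1 + ln (real Q)) / real Q < L / 8"
    using assms by (intro order_tendstoD) auto
  moreover have "\<forall>\<^sub>F Q::nat in sequentially. 1 \<le> Q" by (rule eventually_ge_at_top)
  ultimately show ?thesis
  proof eventually_elim
    case (elim Q)
    show ?case
    proof
      fix u
      define B where "B q = {u..u+L} \<inter> frac_nbhds (\<lambda>q. 1 / (real q * real Q)) {q}" for q :: nat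
      have Bq: "emeasure lborel (B q) \<le> ennreal (6 / Q * inverse (real q) + 2 * L / Q)" if q: "1 \<le> q" for q
      proof -
        define r where "r = 1 / (real q * real Q)"
        have r: "r > 0" "real q * r \<le> 1" unfolding r_def using q elim by auto
        define V where "V = {x. \<exists>p::int. x = p / real q \<and> x \<in> {u - r..u + L + r}}"
        have sep: "1 / real q \<le> \<bar>x - y\<bar>" if xy: "x \<in> V" "y \<in> V" "x \<noteq> y" for x y
        proof -
          obtain p p' :: int where p: "x = p / real q" "y = p' / real q" using xy unfolding V_def by blast
          then have "p \<noteq> p'" using xy by auto
          then have "1 \<le> \<bar>real_of_int p - p'\<bar>" by linarith
          then show ?thesis using q unfolding p by (simp add: diff_divide_distrib[symmetric] divide_right_mono)
        qed
        have "V \<subseteq> {u - r..u + L + r}" by (auto simp: V_def)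
        note V = card_separated_le[OF this _ _ sep]
        have V: "finite V" "real (card V) \<le> 1 + ((u+L+r) - (u-r)) / (1 / real q)"
          using V q r assms by auto
        \<comment> \<open>One from the count, and one for each of the two margins \<open>r\<close>,
          as \<open>q * r \<le> 1\<close>.\<close>
        have cV: "real (card V) \<le> 3 + q * L" using V(2) r(2) by (simp add: algebra_simps)
        have sub: "B q \<subseteq> (\<Union>v\<in>V. {v - r..v + r})"
        proof
          fix x assume "x \<in> B q"
          then obtain p :: int where x: "x \<in> {u..u+L}" and "dist (p / q) x < r"
            by (auto simp: B_def frac_nbhds_def r_def)
          then have "\<bar>x - p / q\<bar> < r" by (simp add: dist_real_def)
          then have "p / q \<in> V" "x \<in> {p / q - r..p / q + r}" unfolding V_def using x by auto
          then show "x \<in> (\<Union>v\<in>V. {v - r..v + r})" by blast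
        qed
        have "emeasure lborel (B q) \<le> ennreal (real (card V) * (2 * r))"
          using r by (intro emeasure_UN_intervals_le[OF V(1) _ sub]) (auto simp: B_def)
        also have "\<dots> \<le> ennreal ((3 + q * L) * (2 * r))"
          using cV r by (intro ennreal_leI mult_right_mono) auto
        also have "(3 + q * L) * (2 * r) = 6 / Q * inverse (real q) + 2 * L / Q"
          unfolding r_def using q elim by (simp add: field_simps)
        finally show ?thesis .
      qed
      define D where "D = {1..Q div 16}"
      have "{q. 1 \<le> q \<and> 16 * q \<le> Q} = D" unfolding D_def by auto
      then have "emeasure lborel ({u..u+L} \<inter>
          frac_nbhds (\<lambda>q. 1 / (real q * real Q)) {q. 1 \<le> q \<and> 16 * q \<le> Q}) = emeasure lborel (\<Union>q\<in>D. B q)"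
        unfolding B_def frac_nbhds_def by (intro arg_cong[of _ _ "emeasure lborel"]) blast
      also have "\<dots> \<le> (\<Sum>q\<in>D. emeasure lborel (B q))"
        by (intro emeasure_subadditive_finite) (auto simp: D_def B_def)
      also have "\<dots> \<le> (\<Sum>q\<in>D. ennreal (6 / Q * inverse (real q) + 2 * L / Q))"
        using Bq by (intro sum_mono) (auto simp: D_def)
      also have "\<dots> = ennreal (\<Sum>q\<in>D. 6 / Q * inverse (real q) + 2 * L / Q)"
        using assms by (intro sum_ennreal) auto
      also have "(\<Sum>q\<in>D. 6 / Q * inverse (real q) + 2 * L / Q)
          = 6 / Q * (\<Sum>q\<in>D. inverse (real q)) + real (Q div 16) * (2 * L / Q)"
        by (simp add: sum.distrib sum_distrib_left D_def)
      also have "\<dots> \<le> 6 / Q * harm Q + (Q / 16) * (2 * L / Q)"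
      proof (intro add_mono mult_left_mono mult_right_mono)
        show "(\<Sum>q\<in>D. inverse (real q)) \<le> harm Q"
          unfolding harm_def D_def by (intro sum_mono2) auto
        show "real (Q div 16) \<le> Q / 16" by linarith
      qed (use assms in auto)
      also have "\<dots> \<le> 6 / Q * (1 + ln Q) + L / 8"
        using harm_le_ln[of Q] elim by (intro add_mono mult_left_mono) auto
      also have "6 / Q * (1 + ln Q) = 6 * (1 + ln (real Q)) / Q" by simp
      also have "\<dots> + L / 8 \<le> L / 4" using elim(1) by linarith
      finally show "emeasure lborel ({u..u+L} \<inter>
          frac_nbhds (\<lambda>q. 1 / (real q * real Q)) {q. 1 \<le> q \<and> 16 * q \<le> Q}) \<le> ennreal (L / 4)"
        by (simp add: ennreal_leI)
    qed
  qed
qed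

section \<open>Good fractions from Dirichlet's theorem\<close>

context approx_fun
begin

text \<open>The factor 2 leaves room to move away from \<open>v\<close> by
  \<open>\<psi> q \<le> \<psi> q'\<close> and still be \<open>\<psi> q'\<close> away from
  \<open>p' / q'\<close>. Denominators below \<open>T\<close> are left to earlier
  refinements.\<close>

definition good_fraction :: "real \<Rightarrow> nat \<Rightarrow> real \<Rightarrow> nat \<Rightarrow> bool" where
  "good_fraction T Q v q \<longleftrightarrow> Q < 16 * q \<and> q \<le> Q \<and> (\<exists>p::int. v = p / q) \<and>
     (\<forall>(p'::int) q'::nat. T \<le> real q' \<longrightarrow> q' < q \<longrightarrow> 2 * \<psi> q' \<le> \<bar>v - p' / q'\<bar>)"

lemma quadratic_decay:
  assumes "c > 0"
  shows "\<forall>\<^sub>F q in sequentially. (real q)\<^sup>2 * \<psi> q \<le> c"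
proof -
  have "(\<lambda>q::nat. real q powr (2 - \<beta>)) \<longlonglongrightarrow> 0" using beta by real_asymp
  then have "\<forall>\<^sub>F q::nat in sequentially. real q powr (2 - \<beta>) < c"
    using assms by (intro order_tendstoD) auto
  with decay eventually_gt_at_top[of 0] show ?thesis
  proof eventually_elim
    case (elim q)
    have "(real q)\<^sup>2 * \<psi> q \<le> (real q)\<^sup>2 * real q powr - \<beta>" using elim by (intro mult_left_mono) auto
    also have "\<dots> = real q powr (2 - \<beta>)" using elim by (simp add: powr_diff powr_minus field_simps)
    finally show ?case using elim by simp
  qed
qed

text \<open>If the Dirichlet fraction \<open>h / k\<close> of \<open>x\<close> were within \<open>2 * \<psi> q'\<close> of a fraction \<open>p' / q'\<close>, then
  \<open>1 / (k * q') < 2 * \<psi> q'\<close>, which makes the error \<open>1 / (k * Q)\<close> smaller than \<open>\<psi> q'\<close>; so \<open>x\<close> itself would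
  be within \<open>3 * \<psi> q'\<close> of \<open>p' / q'\<close>.\<close>

lemma dirichlet_good_fraction:
  assumes T: "1 \<le> T" "\<And>q::nat. T \<le> real q \<Longrightarrow> 4 * ((real q)\<^sup>2 * \<psi> q) \<le> 1" and Q: "1 \<le> Q"
    and x1: "x \<notin> frac_nbhds (\<lambda>q. 3 * \<psi> q) {q. T \<le> real q}"
    and x2: "x \<notin> frac_nbhds (\<lambda>q. 1 / (real q * real Q)) {q. 1 \<le> q \<and> 16 * q \<le> Q}"
  obtains v q where "good_fraction T Q v q" "\<bar>x - v\<bar> \<le> 16 / (real Q)\<^sup>2"
proof -
  obtain h k where hk: "coprime h k" "0 < k" "k \<le> int Q" "\<bar>of_int k * x - of_int h\<bar> < 1 / Q"
    using Dirichlet_approx_coprime[of Q x] Q by auto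
  define q where "q = nat k"
  have k: "k = int q" and q: "1 \<le> q" "q \<le> Q" using hk by (auto simp: q_def)
  define v where "v = real_of_int h / q"
  have xv: "\<bar>x - v\<bar> < 1 / (real q * real Q)"
  proof -
    have "real q * \<bar>x - v\<bar> = \<bar>real q * x - h\<bar>"
      using q abs_mult[of "real q" "x - v"] unfolding v_def by (simp add: algebra_simps)
    then have "real q * \<bar>x - v\<bar> < 1 / Q" using hk k by simp
    then show ?thesis using q by (simp add: field_simps)
  qed
  have Qq: "Q < 16 * q"
  proof (rule ccontr)
    assume "\<not> Q < 16 * q"
    moreover have "dist (h / q) x < 1 / (real q * real Q)"
      using xv unfolding v_def dist_real_def by (simp add: abs_minus_commute)
    ultimately show False using x2 q unfolding frac_nbhds_def by auto
  qed
  have good: "2 * \<psi> q' \<le> \<bar>v - p' / q'\<bar>" if q': "T \<le> real q'" "q' < q" for p' :: int and q' :: nat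
  proof (rule ccontr)
    assume "\<not> 2 * \<psi> q' \<le> \<bar>v - p' / q'\<bar>"
    then have lt: "\<bar>v - p' / q'\<bar> < 2 * \<psi> q'" by simp
    have q1: "1 \<le> q'" using q' T by linarith
    \<comment> \<open>Coprimality of \<open>h\<close> and \<open>k\<close> enters here: a reduced
      fraction does not recur with a smaller denominator.\<close>
    have "v \<noteq> p' / q'"
    proof
      assume "v = p' / q'"
      then have "real_of_int (h * int q') = real_of_int (p' * int q)"
        using q q1 unfolding v_def by (simp add: field_simps)
      then have "h * int q' = p' * int q" by (simp only: of_int_eq_iff)
      then have "int q dvd h * int q'" by simp
      then have "int q dvd int q'" using hk(1) k by (simp add: coprime_dvd_mult_right_iff coprime_commute)
      then show False using q' q1 by (auto dest: dvd_imp_le)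
    qed
    then have "1 / (real q * real q') < 2 * \<psi> q'"
      using distinct_fractions_apart[OF q(1) q1, of h p'] lt unfolding v_def by simp
    then have a: "1 / real q < 2 * real q' * \<psi> q'"
      using q q1 by (simp add: field_simps)
    have "1 / (real q * real Q) \<le> (1 / real q)\<^sup>2"
      using q by (simp add: power2_eq_square field_simps)
    also have "\<dots> \<le> (2 * real q' * \<psi> q')\<^sup>2" using a by (intro power_mono) auto
    also have "\<dots> = 4 * ((real q')\<^sup>2 * \<psi> q') * \<psi> q'" by (simp add: power2_eq_square)
    also have "\<dots> \<le> 1 * \<psi> q'" using T(2)[OF q'(1)] pos[OF q1] by (intro mult_right_mono) auto
    finally have "\<bar>x - v\<bar> < \<psi> q'" using xv by simp
    then have "dist (p' / q') x < 3 * \<psi> q'" using lt unfolding dist_real_def by linarith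
    then show False using x1 q' unfolding frac_nbhds_def by auto
  qed
  have "1 / (real q * real Q) \<le> 16 / (real Q)\<^sup>2"
    using q Qq by (simp add: power2_eq_square field_simps)
  then show thesis using that[of v q] good Qq q xv unfolding good_fraction_def v_def by auto
qed

text \<open>In a window of length \<open>L = l / 4\<close> the two excluded sets take at most
  \<open>L / 2\<close> and \<open>L / 4\<close>. The rest has measure at least \<open>l / 16\<close>
  and is covered by intervals of length \<open>32 / Q\<^sup>2\<close> around good fractions, whence
  the count \<open>l * Q\<^sup>2 / 512\<close>.\<close>

lemma many_good_fractions:
  "\<forall>\<^sub>F T in at_top. \<forall>a l. 4 \<le> T\<^sup>2 * l \<longrightarrow> (\<forall>\<^sub>F Q in sequentially.
     \<exists>V \<subseteq> {a..a + 3/4 * l}. finite V \<and> l * (real Q)\<^sup>2 / 512 \<le> card V \<and> (\<forall>v\<in>V. \<exists>q. good_fraction T Q v q))"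
proof -
  obtain n0 where n0: "\<And>q. q \<ge> n0 \<Longrightarrow> (real q)\<^sup>2 * \<psi> q \<le> 1 / 4"
    using quadratic_decay[of "1/4"] unfolding eventually_sequentially by auto
  have "\<forall>\<^sub>F T in at_top. real n0 \<le> T" "\<forall>\<^sub>F T in at_top. (1::real) \<le> T"
    by (auto intro: eventually_ge_at_top)
  with tail_measure show ?thesis
  proof eventually_elim
    case (elim T)
    show ?case
    proof (intro allI impI)
      fix a l :: real assume Tl: "4 \<le> T\<^sup>2 * l"
      \<comment> \<open>The window is the second quarter. Its two neighbours absorb the error
        \<open>16 / Q\<^sup>2 < L\<close> between a point and its fraction; the last quarter stays
        free for the children, which lie to the right of the fractions.\<close>
      define L u where "L = l / 4" and "u = a + l / 4"
      have l: "l > 0" "L > 0" using Tl by (smt (verit) L_def divide_pos_pos mult_nonneg_nonpos zero_le_power2)+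
      have "(\<lambda>Q::nat. 16 / (real Q)\<^sup>2) \<longlonglongrightarrow> 0" by real_asymp
      then have "\<forall>\<^sub>F Q::nat in sequentially. 16 / (real Q)\<^sup>2 < L" using l by (intro order_tendstoD) auto
      with small_denominators_measure[OF \<open>L > 0\<close>] eventually_ge_at_top[of 1]
      show "\<forall>\<^sub>F Q in sequentially. \<exists>V \<subseteq> {a..a + 3/4 * l}. finite V \<and>
         l * (real Q)\<^sup>2 / 512 \<le> card V \<and> (\<forall>v\<in>V. \<exists>q. good_fraction T Q v q)"
      proof eventually_elim
        case (elim Q)
        define B S X where "B = frac_nbhds (\<lambda>q. 3 * \<psi> q) {q. T \<le> real q}"
          and "S = frac_nbhds (\<lambda>q. 1 / (real q * real Q)) {q. 1 \<le> q \<and> 16 * q \<le> Q}"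
          and "X = {u..u+L} - (B \<union> S)"
        define V where "V = {v \<in> {a..a + 3/4 * l}. \<exists>q. good_fraction T Q v q}"
        have "V \<subseteq> {x. \<exists>(p::int) (q::nat). x = p / q \<and> 1 \<le> q \<and> real q \<le> real Q \<and> x \<in> {a..a + 3/4 * l}}"
        proof
          fix v assume "v \<in> V"
          then obtain q and p :: int where "v = p / q" "Q < 16 * q" "q \<le> Q" "v \<in> {a..a + 3/4 * l}"
            unfolding V_def good_fraction_def by blast
          then show "v \<in> {x. \<exists>(p::int) (q::nat). x = p / q \<and> 1 \<le> q \<and> real q \<le> real Q \<and> x \<in> {a..a + 3/4 * l}}"
            by (intro CollectI exI[of _ p] exI[of _ q]) auto
        qed
        then have V: "finite V"
          using card_fractions_le(1)[of a "a + 3/4 * l" "real Q"] elim l by (auto intro: finite_subset)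
        have XV: "X \<subseteq> (\<Union>v\<in>V. {v - 16 / (real Q)\<^sup>2..v + 16 / (real Q)\<^sup>2})"
        proof
          fix x assume x: "x \<in> X"
          obtain v q where v: "good_fraction T Q v q" "\<bar>x - v\<bar> \<le> 16 / (real Q)\<^sup>2"
          proof (rule dirichlet_good_fraction[of T Q x])
            show "4 * ((real q)\<^sup>2 * \<psi> q) \<le> 1" if "T \<le> real q" for q
              using n0[of q] that \<open>real n0 \<le> T\<close> by simp
          qed (use x \<open>1 \<le> T\<close> elim in \<open>auto simp: X_def B_def S_def\<close>)
          then have "v \<in> V" using x elim(3) unfolding V_def X_def L_def u_def by auto
          then show "x \<in> (\<Union>v\<in>V. {v - 16 / (real Q)\<^sup>2..v + 16 / (real Q)\<^sup>2})" using v(2) by force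
        qed
        have [measurable]: "B \<in> sets borel" "S \<in> sets borel" "X \<in> sets borel" by (auto simp: B_def S_def X_def)
        have "ennreal L = emeasure lborel {u..u+L}" using l by simp
        also have "\<dots> \<le> emeasure lborel (({u..u+L} \<inter> B) \<union> (({u..u+L} \<inter> S) \<union> X))"
          by (intro emeasure_mono) (auto simp: X_def)
        also have "\<dots> \<le> emeasure lborel ({u..u+L} \<inter> B) + (emeasure lborel ({u..u+L} \<inter> S) + emeasure lborel X)"
          by (intro order_trans[OF emeasure_subadditive] add_left_mono emeasure_subadditive) auto
        also have "\<dots> \<le> ennreal (L / 2) + (ennreal (L / 4) + ennreal (card V * (2 * (16 / (real Q)\<^sup>2))))"
        proof (intro add_mono)
          have "1 \<le> T\<^sup>2 * L" using Tl by (simp add: L_def)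
          then show "emeasure lborel ({u..u+L} \<inter> B) \<le> ennreal (L / 2)"
            using \<open>\<forall>u L. 1 \<le> T\<^sup>2 * L \<longrightarrow> _\<close> unfolding B_def by blast
          show "emeasure lborel ({u..u+L} \<inter> S) \<le> ennreal (L / 4)" using elim(1) unfolding S_def by blast
          show "emeasure lborel X \<le> ennreal (card V * (2 * (16 / (real Q)\<^sup>2)))"
            by (rule emeasure_UN_intervals_le[OF V _ XV]) auto
        qed
        also have "\<dots> = ennreal (L / 2 + (L / 4 + card V * (2 * (16 / (real Q)\<^sup>2))))"
          using l by (simp flip: ennreal_plus)
        finally have "L \<le> L / 2 + (L / 4 + card V * (2 * (16 / (real Q)\<^sup>2)))"
          using l by (subst (asm) ennreal_le_iff) auto
        then have "l * (real Q)\<^sup>2 / 512 \<le> card V" using elim(2) unfolding L_def by (simp add: field_simps)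
        then show ?case using V by (intro exI[of _ V]) (auto simp: V_def)
      qed
    qed
  qed
qed

end

section \<open>Cells and refinement\<close>

text \<open>Denominators below \<open>thr\<close> have been dealt with inside the cell; later refinements are
  responsible for those from \<open>thr\<close> on.\<close>

datatype cell = Cell (left: real) (len: real) (thr: real)

definition interval :: "cell \<Rightarrow> real set" where
  "interval w = {left w..left w + len w}"

definition config :: "cell set \<Rightarrow> bool" where
  "config S \<longleftrightarrow> finite S \<and> S \<noteq> {} \<and> (\<forall>w\<in>S. 0 < len w) \<and>
     (\<forall>w\<in>S. \<forall>w'\<in>S. interval w \<inter> interval w' \<noteq> {} \<longrightarrow> w = w')"

text \<open>With equally many children in each cell the uniform distribution on \<open>S'\<close>
  projects to the one on \<open>S\<close>, as for the stages of a limit measure.\<close>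

definition refines :: "cell set \<Rightarrow> cell set \<Rightarrow> bool" where
  "refines S' S \<longleftrightarrow> (\<exists>N\<ge>1. (\<forall>w'\<in>S'. \<exists>w\<in>S. interval w' \<subseteq> interval w) \<and>
     (\<forall>w\<in>S. card {w' \<in> S'. interval w' \<subseteq> interval w} = N))"

definition hits :: "cell set \<Rightarrow> real set \<Rightarrow> cell set" where
  "hits S X = {w \<in> S. interval w \<inter> X \<noteq> {}}"

text \<open>The mass of \<open>X\<close> under the uniform distribution on cells, where a cell that
  meets \<open>X\<close> counts in full. This over-counting makes the ratio decrease under
  refinement.\<close>

definition hit_ratio :: "cell set \<Rightarrow> real set \<Rightarrow> real" where
  "hit_ratio S X = card (hits S X) / card S"

definition min_len :: "cell set \<Rightarrow> real" where
  "min_len S = Min (len ` S)"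

text \<open>After the next refinement, intervals of radius \<open>r\<close> that are not too short meet at most the
  proportion \<open>r / kappa S\<close> of all cells; the constant is \<open>7 * 512\<close>, with \<open>512\<close> from the count of good
  fractions.\<close>

definition kappa :: "cell set \<Rightarrow> real" where
  "kappa S = min_len S * card S / 3584"

lemma left_in_interval: "config S \<Longrightarrow> w \<in> S \<Longrightarrow> left w \<in> interval w"
  unfolding config_def interval_def by (auto intro: less_imp_le)

lemma min_len_pos: "config S \<Longrightarrow> 0 < min_len S"
  unfolding config_def min_len_def by auto

lemma min_len_le: "config S \<Longrightarrow> w \<in> S \<Longrightarrow> min_len S \<le> len w"
  unfolding config_def min_len_def by auto

lemma min_len_attained: "config S \<Longrightarrow> \<exists>w\<in>S. min_len S = len w"
  unfolding config_def min_len_def using Min_in[of "len ` S"] by (auto simp: image_iff)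

lemma card_config_pos: "config S \<Longrightarrow> 0 < card S"
  unfolding config_def by (simp add: card_gt_0_iff)

lemma kappa_pos: "config S \<Longrightarrow> 0 < kappa S"
  unfolding kappa_def by (simp add: min_len_pos card_config_pos)

lemma refines_refl:
  assumes "config S" shows "refines S S"
proof -
  have "{w' \<in> S. interval w' \<subseteq> interval w} = {w}" if "w \<in> S" for w
    using assms that left_in_interval[OF assms] unfolding config_def by blast
  then show ?thesis unfolding refines_def by (intro exI[of _ 1]) auto
qed

lemma hit_ratio_nonneg: "0 \<le> hit_ratio S X"
  unfolding hit_ratio_def by simp

lemma hit_ratio_mono:
  assumes "config S" "X \<subseteq> Y" shows "hit_ratio S X \<le> hit_ratio S Y"
proof -
  have "card (hits S X) \<le> card (hits S Y)"
    using assms unfolding config_def hits_def by (intro card_mono) auto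
  then show ?thesis unfolding hit_ratio_def by (simp add: divide_right_mono)
qed

text \<open>A child that meets \<open>X\<close> has a parent that meets \<open>X\<close>, and every
  parent has \<open>N\<close> children. Bounds obtained at one stage therefore persist at all later
  stages.\<close>

lemma hit_ratio_refines:
  assumes S: "config S" and S': "config S'" and r: "refines S' S"
  shows "hit_ratio S' X \<le> hit_ratio S X"
proof -
  obtain N where N: "N \<ge> 1" "\<And>w'. w' \<in> S' \<Longrightarrow> \<exists>w\<in>S. interval w' \<subseteq> interval w"
    "\<And>w. w \<in> S \<Longrightarrow> card {w' \<in> S'. interval w' \<subseteq> interval w} = N"
    using r unfolding refines_def by blast
  define C where "C w = {w' \<in> S'. interval w' \<subseteq> interval w}" for w
  have fin: "finite S" "finite S'" using S S' by (auto simp: config_def)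
  have "hits S' X \<subseteq> (\<Union>w\<in>hits S X. C w)" using N(2) unfolding hits_def C_def by blast
  then have "card (hits S' X) \<le> card (\<Union>w\<in>hits S X. C w)"
    using fin by (intro card_mono) (auto simp: hits_def C_def)
  also have "\<dots> \<le> (\<Sum>w\<in>hits S X. card (C w))" using fin by (intro card_UN_le) (auto simp: hits_def)
  also have "\<dots> = card (hits S X) * N" using N(3) unfolding C_def hits_def by simp
  finally have 1: "card (hits S' X) \<le> card (hits S X) * N" .
  have "C w \<inter> C w' = {}" if "w \<in> S" "w' \<in> S" "w \<noteq> w'" for w w'
    using that S left_in_interval[OF S'] unfolding C_def config_def by blast
  then have "card (\<Union>w\<in>S. C w) = (\<Sum>w\<in>S. card (C w))"
    using fin by (intro card_UN_disjoint) (auto simp: C_def)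
  also have "\<dots> = card S * N" using N(3) unfolding C_def by simp
  also have "(\<Union>w\<in>S. C w) = S'" using N(2) unfolding C_def by blast
  finally have 2: "card S' = card S * N" .
  have "real (card (hits S' X)) \<le> real (card (hits S X)) * real N" using 1 by (simp flip: of_nat_mult)
  then show ?thesis unfolding hit_ratio_def 2 using N(1) card_config_pos[OF S]
    by (simp add: field_simps)
qed

text \<open>The inequality is the one under which a cell with threshold \<open>thr w\<close>
  contains many good fractions, so the next refinement can start in every cell.\<close>

definition admissible :: "real \<Rightarrow> cell set \<Rightarrow> bool" where
  "admissible T0 S \<longleftrightarrow> config S \<and> (\<forall>w\<in>S. T0 \<le> thr w \<and> 4 \<le> (thr w)\<^sup>2 * len w)"

section \<open>One refinement step\<close>

context approx_fun
begin

definition safe :: "real \<Rightarrow> bool" where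
  "safe T \<longleftrightarrow> 1 \<le> T \<and> (\<forall>q. T \<le> real q \<longrightarrow> 2 * ((real q)\<^sup>2 * \<psi> q) \<le> 1) \<and>
    (\<forall>a l. 4 \<le> T\<^sup>2 * l \<longrightarrow> (\<forall>\<^sub>F Q in sequentially.
       \<exists>V \<subseteq> {a..a + 3/4 * l}. finite V \<and> l * (real Q)\<^sup>2 / 512 \<le> card V \<and> (\<forall>v\<in>V. \<exists>q. good_fraction T Q v q)))"

lemma eventually_safe: "\<forall>\<^sub>F T in at_top. safe T"
proof -
  obtain n0 where n0: "\<And>q. q \<ge> n0 \<Longrightarrow> (real q)\<^sup>2 * \<psi> q \<le> 1 / 2"
    using quadratic_decay[of "1/2"] unfolding eventually_sequentially by auto
  have "\<forall>\<^sub>F T in at_top. real n0 \<le> T" "\<forall>\<^sub>F T in at_top. (1::real) \<le> T"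
    by (auto intro: eventually_ge_at_top)
  with many_good_fractions show ?thesis
  proof eventually_elim
    case (elim T)
    have "2 * ((real q)\<^sup>2 * \<psi> q) \<le> 1" if "T \<le> real q" for q
      using n0[of q] that elim by simp
    then show ?case using elim unfolding safe_def by blast
  qed
qed

text \<open>\<open>\<sigma>\<close> is the scale down to which \<open>S'\<close> still looks
  one-dimensional. The two inequalities with \<open>powr t\<close> control the drop below it: the
  first serves radii between \<open>min_len S'\<close> and \<open>\<sigma>\<close>, where the mass
  is at most that of a ball of radius \<open>\<sigma>\<close>; the second serves radii below
  \<open>min_len S'\<close>, where a later refinement gives \<open>r / kappa S'\<close>. The last
  two conjuncts provide the approximations and their exactness.\<close>

definition refinement :: "real \<Rightarrow> real \<Rightarrow> real \<Rightarrow> cell set \<Rightarrow> cell set \<Rightarrow> real \<Rightarrow> bool" where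
  "refinement \<eta> \<delta> t S S' \<sigma> \<longleftrightarrow> refines S' S \<and> 0 < \<sigma> \<and> \<sigma> < \<delta> \<and>
     (\<forall>w\<in>S'. len w \<le> \<sigma>) \<and> (\<forall>x r. \<sigma> \<le> r \<longrightarrow> hit_ratio S' (cball x r) \<le> r / kappa S) \<and>
     \<sigma> / kappa S \<le> min_len S' powr t \<and> min_len S' \<le> kappa S' * min_len S' powr t \<and>
     (\<forall>w'\<in>S'. 1 / \<delta> \<le> thr w' \<and> (\<forall>x\<in>interval w'. \<exists>(p::int) (q::nat). 1 / \<delta> < q \<and> \<bar>x - p / q\<bar> < \<psi> q)) \<and>
     (\<forall>w\<in>S. \<forall>w'\<in>S'. interval w' \<subseteq> interval w \<longrightarrow> (\<forall>x\<in>interval w'. \<forall>(p::int) (q::nat).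
        thr w \<le> real q \<longrightarrow> real q < thr w' \<longrightarrow> (1 - \<eta>) * \<psi> q \<le> \<bar>x - p / q\<bar>))"

text \<open>For \<open>q' < q\<close> goodness of \<open>v\<close> leaves
  \<open>2 * \<psi> q' - \<psi> q \<ge> \<psi> q'\<close>. If \<open>p' / q'\<close> is
  \<open>v\<close> itself, possibly unreduced, the distance of \<open>x\<close> from
  \<open>v\<close> is large enough as \<open>\<psi> q' \<le> \<psi> q\<close>. Any other fraction
  with \<open>q' \<ge> q\<close> is \<open>1 / (q * q')\<close> away from \<open>v\<close>; the
  bound on \<open>q'\<close> says that moving to \<open>x\<close> loses at most half of this, and
  the rest is at least \<open>1 / (2 * q'\<^sup>2) \<ge> \<psi> q'\<close>.\<close>

lemma child_avoids:
  assumes good: "good_fraction T Q v q" and T: "safe T" and q: "1 \<le> q"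
    and x: "(1 - \<eta>) * \<psi> q \<le> \<bar>x - v\<bar>" "\<bar>x - v\<bar> \<le> \<psi> q" and eta: "0 \<le> \<eta>" "\<eta> \<le> 1"
    and q': "T \<le> real q'" "real q' < 1 / (2 * q * \<psi> q)"
  shows "(1 - \<eta>) * \<psi> q' \<le> \<bar>x - real_of_int p' / q'\<bar>"
proof -
  obtain p :: int where v: "v = p / q" using good unfolding good_fraction_def by blast
  have q1: "1 \<le> q'" using q' T unfolding safe_def by linarith
  have le: "(1 - \<eta>) * \<psi> q' \<le> \<psi> q'" using eta pos[OF q1] by (simp add: mult_left_le_one_le)
  consider "q' < q" | "q \<le> q'" "v = p' / q'" | "q \<le> q'" "v \<noteq> p' / q'" by linarith
  then show ?thesis
  proof cases
    case 1
    then have "2 * \<psi> q' \<le> \<bar>v - p' / q'\<bar>" using good q' unfolding good_fraction_def by blast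
    moreover have "\<psi> q \<le> \<psi> q'" using anti[OF q1] 1 by simp
    ultimately show ?thesis using x le by linarith
  next
    case 2
    then have "(1 - \<eta>) * \<psi> q' \<le> (1 - \<eta>) * \<psi> q" using anti[OF q] eta by (intro mult_left_mono) auto
    then show ?thesis using x 2 by simp
  next
    case 3
    have "1 / (real q * real q') \<le> \<bar>v - p' / q'\<bar>"
      using distinct_fractions_apart[OF q q1, of p p'] 3 v by simp
    moreover have "\<psi> q \<le> 1 / (2 * (real q * real q'))"
      using q'(2) pos[OF q] q q1 by (simp add: field_simps)
    ultimately have "1 / (2 * (real q * real q')) \<le> \<bar>x - p' / q'\<bar>" using x by (simp add: field_simps)
    moreover have "real q * real q' \<le> (real q')\<^sup>2"
      using 3 unfolding power2_eq_square by (intro mult_right_mono) auto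
    then have "1 / (2 * (real q')\<^sup>2) \<le> 1 / (2 * (real q * real q'))" using q q1 by (intro divide_left_mono) auto
    moreover have "\<psi> q' \<le> 1 / (2 * (real q')\<^sup>2)"
      using T q' q1 unfolding safe_def by (simp add: field_simps)
    ultimately show ?thesis using le by linarith
  qed
qed

text \<open>Denominators are at most \<open>Q\<close>, so by monotonicity every child has length at
  least \<open>\<eta> / 2 * \<psi> Q\<close>. By \<open>freq\<close> there are arbitrarily large
  \<open>Q\<close> for which the \<open>t\<close>-th power of this length exceeds any prescribed
  multiple of \<open>1 / Q\<^sup>2\<close>.\<close>

lemma refinement_step:
  assumes T0: "\<And>T. T0 \<le> T \<Longrightarrow> safe T" and S: "admissible T0 S"
    and eta: "0 < \<eta>" "\<eta> \<le> 1/2" and delta: "0 < \<delta>" and t: "0 \<le> t"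
    and freq: "\<And>B. \<exists>\<^sub>F Q in sequentially. B \<le> (real Q)\<^sup>2 * \<psi> Q powr t"
  shows "\<exists>S' \<sigma>. admissible T0 S' \<and> refinement \<eta> \<delta> t S S' \<sigma>"
proof -
  have cS: "config S" and thrS: "\<And>w. w \<in> S \<Longrightarrow> safe (thr w)" "\<And>w. w \<in> S \<Longrightarrow> 4 \<le> (thr w)\<^sup>2 * len w"
    using S T0 unfolding admissible_def by auto
  have finS: "finite S" using cS by (simp add: config_def)
  define lm where "lm = min_len S"
  have lm: "0 < lm" "\<And>w. w \<in> S \<Longrightarrow> lm \<le> len w"
    unfolding lm_def using min_len_pos min_len_le cS by auto
  \<comment> \<open>\<open>1/1024\<close> gives \<open>\<psi> q \<le> \<sigma> / 4\<close> because
    \<open>Q < 16 * q\<close>; \<open>\<eta> / 32\<close> makes the children admissible;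
    \<open>lm / 4\<close> lets them fit into the free last quarter of the parent.\<close>
  define c where "c = min (1/1024) (min (\<eta> / 32) (lm / 4))"
  have c: "0 < c" "c \<le> 1/1024" "c \<le> \<eta> / 32" "c \<le> lm / 4" unfolding c_def using eta lm by auto
  have "\<forall>\<^sub>F q::nat in sequentially. (real q)\<^sup>2 * \<psi> q \<le> c \<and> max T0 (1 / \<delta>) < real q"
  proof (intro eventually_conj quadratic_decay[OF c(1)])
    show "\<forall>\<^sub>F q::nat in sequentially. max T0 (1 / \<delta>) < real q"
      using filterlim_real_sequentially filterlim_at_top_dense by blast
  qed
  then obtain n0 where n0: "\<And>q. q \<ge> n0 \<Longrightarrow> (real q)\<^sup>2 * \<psi> q \<le> c \<and> max T0 (1 / \<delta>) < real q"
    unfolding eventually_sequentially by blast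
  have ev1: "\<forall>\<^sub>F Q in sequentially. \<forall>w\<in>S. \<exists>V \<subseteq> {left w..left w + 3/4 * len w}. finite V \<and>
       len w * (real Q)\<^sup>2 / 512 \<le> card V \<and> (\<forall>v\<in>V. \<exists>q. good_fraction (thr w) Q v q)"
    using thrS finS unfolding safe_def by (intro eventually_ball_finite) auto
  have "(\<lambda>Q::nat. 1 / (real Q)\<^sup>2) \<longlonglongrightarrow> 0" by real_asymp
  then have ev2: "\<forall>\<^sub>F Q::nat in sequentially. 1 / (real Q)\<^sup>2 < \<delta>" using delta by (intro order_tendstoD) auto
  \<comment> \<open>With this \<open>B\<close>, \<open>512 * \<sigma> / kappa S \<le> (\<eta> / 2 *
    \<psi> Q) powr t\<close>, the base being a lower bound for the length of a child.\<close>
  define B where "B = 512 * (2 / \<eta>) powr t / kappa S"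
  have "\<exists>\<^sub>F Q in sequentially. B \<le> (real Q)\<^sup>2 * \<psi> Q powr t \<and> 1 \<le> Q \<and> 16 * n0 \<le> Q \<and> 1 / (real Q)\<^sup>2 < \<delta> \<and>
    (\<forall>w\<in>S. \<exists>V \<subseteq> {left w..left w + 3/4 * len w}. finite V \<and>
       len w * (real Q)\<^sup>2 / 512 \<le> card V \<and> (\<forall>v\<in>V. \<exists>q. good_fraction (thr w) Q v q))"
    by (intro frequently_eventually_frequently[OF freq] eventually_conj ev1 ev2 eventually_ge_at_top)
  then obtain Q where QB: "B \<le> (real Q)\<^sup>2 * \<psi> Q powr t" and Q: "1 \<le> Q" "16 * n0 \<le> Q" "1 / (real Q)\<^sup>2 < \<delta>"
    and exV: "\<And>w. w \<in> S \<Longrightarrow> \<exists>V \<subseteq> {left w..left w + 3/4 * len w}. finite V \<and>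
       len w * (real Q)\<^sup>2 / 512 \<le> card V \<and> (\<forall>v\<in>V. \<exists>q. good_fraction (thr w) Q v q)"
    unfolding frequently_sequentially by auto
  define \<sigma> where "\<sigma> = 1 / (real Q)\<^sup>2"
  have sig: "0 < \<sigma>" "\<sigma> < \<delta>" using Q unfolding \<sigma>_def by auto
  \<comment> \<open>The number of fractions guaranteed in the shortest cell; longer cells use only
    that many, as \<open>refines\<close> demands equal numbers.\<close>
  define N where "N = nat \<lceil>lm / (512 * \<sigma>)\<rceil>"
  have N: "lm / (512 * \<sigma>) \<le> N" "1 \<le> N"
    unfolding N_def using lm sig real_nat_ceiling_ge by (auto simp: Suc_le_eq)
  have "\<exists>V \<subseteq> {left w..left w + 3/4 * len w}. finite V \<and> card V = N \<and> (\<forall>v\<in>V. \<exists>q. good_fraction (thr w) Q v q)"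
    if w: "w \<in> S" for w
  proof -
    obtain V where V: "V \<subseteq> {left w..left w + 3/4 * len w}" "finite V"
      "len w * (real Q)\<^sup>2 / 512 \<le> card V" "\<forall>v\<in>V. \<exists>q. good_fraction (thr w) Q v q" using exV[OF w] by blast
    have "lm / (512 * \<sigma>) \<le> len w / (512 * \<sigma>)" using lm(2)[OF w] sig by (intro divide_right_mono) auto
    also have "\<dots> = len w * (real Q)\<^sup>2 / 512" unfolding \<sigma>_def by simp
    finally have "N \<le> card V" unfolding N_def using V(3) by (simp add: nat_le_iff ceiling_le_iff)
    then obtain V' where "V' \<subseteq> V" "card V' = N" "finite V'" by (rule obtain_subset_with_card_n)
    then show ?thesis using V by (intro exI[of _ V']) blast
  qed
  then obtain V where V: "\<And>w. w \<in> S \<Longrightarrow> V w \<subseteq> {left w..left w + 3/4 * len w} \<and> finite (V w) \<and> card (V w) = N \<and>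
     (\<forall>v\<in>V w. \<exists>q. good_fraction (thr w) Q v q)" by metis
  then have "\<forall>w\<in>S. \<forall>v\<in>V w. \<exists>q. good_fraction (thr w) Q v q" by blast
  then obtain den where den: "\<And>w v. w \<in> S \<Longrightarrow> v \<in> V w \<Longrightarrow> good_fraction (thr w) Q v (den w v)" by metis
  \<comment> \<open>For \<open>q' < 1 / (2 * q * \<psi> q)\<close> the distance \<open>1 / (q * q')\<close> between different fractions is at least
    twice the distance \<open>\<psi> q\<close> of the child to its centre \<open>v\<close>; this is where its threshold comes from.\<close>
  define child where "child w v = Cell (v + (1 - \<eta>) * \<psi> (den w v)) (\<eta> * \<psi> (den w v) / 2)
     (1 / (2 * den w v * \<psi> (den w v)))" for w v
  define S' where "S' = (\<Union>w\<in>S. child w ` V w)"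
  have denQ: "1 \<le> den w v" "den w v \<le> Q" "n0 \<le> den w v" "\<exists>p::int. v = p / den w v"
      "(real (den w v))\<^sup>2 * \<psi> (den w v) \<le> c" "max T0 (1 / \<delta>) < den w v" "\<psi> Q \<le> \<psi> (den w v)"
      "0 < \<psi> (den w v)" "\<psi> (den w v) \<le> \<sigma> / 4" "\<psi> (den w v) \<le> lm / 4" if wv: "w \<in> S" "v \<in> V w" for w v
  proof -
    have g: "Q < 16 * den w v" "den w v \<le> Q" "\<exists>p::int. v = p / den w v"
      using den[OF wv] unfolding good_fraction_def by auto
    then show "den w v \<le> Q" "\<exists>p::int. v = p / den w v" by auto
    show 1: "1 \<le> den w v" using g Q by linarith
    show 2: "n0 \<le> den w v" using g Q by linarith
    show 3: "(real (den w v))\<^sup>2 * \<psi> (den w v) \<le> c" "max T0 (1 / \<delta>) < den w v" using n0[OF 2] by auto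
    show "\<psi> Q \<le> \<psi> (den w v)" using anti 1 g by blast
    show 4: "0 < \<psi> (den w v)" using pos 1 by blast
    have "real Q \<le> 16 * den w v" using g(1) by linarith
    then have "(real Q)\<^sup>2 \<le> (16 * real (den w v))\<^sup>2" by (intro power_mono) auto
    then have "(real Q)\<^sup>2 * \<psi> (den w v) \<le> 256 * ((real (den w v))\<^sup>2 * \<psi> (den w v))"
      using 4 by (simp add: power_mult_distrib)
    then have "(real Q)\<^sup>2 * \<psi> (den w v) \<le> 1/4" using 3 c by linarith
    then show "\<psi> (den w v) \<le> \<sigma> / 4" unfolding \<sigma>_def using Q by (simp add: field_simps)
    have "1 * \<psi> (den w v) \<le> (real (den w v))\<^sup>2 * \<psi> (den w v)"
      using 1 4 by (intro mult_right_mono) auto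
    then show "\<psi> (den w v) \<le> lm / 4" using 3 c by linarith
  qed
  have sub: "interval (child w v) \<subseteq> interval w" if wv: "w \<in> S" "v \<in> V w" for w v
  proof -
    have "v \<in> {left w..left w + 3/4 * len w}" using V wv by blast
    moreover have "(1 - \<eta>) * \<psi> (den w v) + \<eta> * \<psi> (den w v) / 2 \<le> \<psi> (den w v)"
      using eta denQ(8)[OF wv] by (simp add: algebra_simps)
    moreover have "0 \<le> (1 - \<eta>) * \<psi> (den w v)" using eta denQ(8)[OF wv] by simp
    ultimately show ?thesis using denQ(10)[OF wv] lm(2)[OF wv(1)]
      unfolding interval_def child_def by auto
  qed
  have vw: "v \<in> interval w" if "w \<in> S" "v \<in> V w" for w v
  proof -
    have "0 < len w" using lm that by force
    then show ?thesis using V[OF that(1)] that(2) unfolding interval_def by force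
  qed
  have shrink: "0 \<le> (1 - \<eta>) * \<psi> (den w v)" "(1 - \<eta>) * \<psi> (den w v) \<le> \<sigma> / 4"
    if wv: "w \<in> S" "v \<in> V w" for w v
  proof -
    show "0 \<le> (1 - \<eta>) * \<psi> (den w v)" using eta denQ(8)[OF wv] by simp
    have "(1 - \<eta>) * \<psi> (den w v) \<le> \<psi> (den w v)"
      using eta denQ(8)[OF wv] by (intro mult_left_le_one_le) auto
    then show "(1 - \<eta>) * \<psi> (den w v) \<le> \<sigma> / 4" using denQ(9)[OF wv] by linarith
  qed
  \<comment> \<open>Distinct fractions with denominators at most \<open>Q\<close> are
    \<open>\<sigma>\<close> apart, and the shifts of both children lie between 0 and
    \<open>\<sigma> / 4\<close>.\<close>
  have apart: "3/4 * \<sigma> \<le> \<bar>left (child w v) - left (child w2 v2)\<bar>"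
    if a: "w \<in> S" "v \<in> V w" and b: "w2 \<in> S" "v2 \<in> V w2" and ne: "(w, v) \<noteq> (w2, v2)" for w v w2 v2
  proof -
    have "v \<noteq> v2" using ne a b vw cS unfolding config_def by blast
    moreover obtain p p2 :: int where p: "v = p / den w v" "v2 = p2 / den w2 v2" using denQ(4) a b by blast
    ultimately have "1 / (real (den w v) * real (den w2 v2)) \<le> \<bar>v - v2\<bar>"
      using distinct_fractions_apart[OF denQ(1)[OF a] denQ(1)[OF b], of p p2] by metis
    moreover have "real (den w v) * real (den w2 v2) \<le> real Q * real Q"
      using denQ(2)[OF a] denQ(2)[OF b] by (intro mult_mono) auto
    then have "\<sigma> \<le> 1 / (real (den w v) * real (den w2 v2))"
      unfolding \<sigma>_def power2_eq_square using denQ(1)[OF a] denQ(1)[OF b] Q(1)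
      by (intro divide_left_mono mult_pos_pos) auto
    moreover have "0 \<le> (1 - \<eta>) * \<psi> (den w v)" "(1 - \<eta>) * \<psi> (den w v) \<le> \<sigma> / 4"
      using shrink[OF a] by auto
    moreover have "0 \<le> (1 - \<eta>) * \<psi> (den w2 v2)" "(1 - \<eta>) * \<psi> (den w2 v2) \<le> \<sigma> / 4"
      using shrink[OF b] by auto
    ultimately show ?thesis unfolding child_def cell.sel by linarith
  qed
  have len: "len (child w v) = \<eta> * \<psi> (den w v) / 2" "0 < len (child w v)" "len (child w v) \<le> \<sigma> / 16"
      "\<eta> / 2 * \<psi> Q \<le> len (child w v)" if wv: "w \<in> S" "v \<in> V w" for w v
  proof -
    have "\<eta> * \<psi> (den w v) \<le> 1/2 * (\<sigma> / 4)" using eta denQ(8,9)[OF wv] by (intro mult_mono) auto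
    then show "len (child w v) = \<eta> * \<psi> (den w v) / 2" "0 < len (child w v)" "len (child w v) \<le> \<sigma> / 16"
      "\<eta> / 2 * \<psi> Q \<le> len (child w v)"
      using eta denQ(7,8)[OF wv] unfolding child_def by auto
  qed
  have S'D: "\<exists>w\<in>S. \<exists>v\<in>V w. w' = child w v" if "w' \<in> S'" for w' using that unfolding S'_def by blast
  have apart': "3/4 * \<sigma> \<le> \<bar>left w - left w2\<bar>" if w: "w \<in> S'" "w2 \<in> S'" "w \<noteq> w2" for w w2
  proof -
    obtain u v where u: "u \<in> S" "v \<in> V u" "w = child u v" using S'D[OF w(1)] by blast
    obtain u2 v2 where u2: "u2 \<in> S" "v2 \<in> V u2" "w2 = child u2 v2" using S'D[OF w(2)] by blast
    have "(u, v) \<noteq> (u2, v2)" using w(3) u u2 by auto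
    from apart[OF u(1,2) u2(1,2) this] show ?thesis using u u2 by simp
  qed
  have disj: "interval w \<inter> interval w2 = {}" if w: "w \<in> S'" "w2 \<in> S'" "w \<noteq> w2" for w w2
  proof -
    have "len w \<le> \<sigma> / 16" "len w2 \<le> \<sigma> / 16" using S'D[OF w(1)] S'D[OF w(2)] len by auto
    with apart'[OF w] sig(1) have "left w + len w < left w2 \<or> left w2 + len w2 < left w" by linarith
    then show ?thesis unfolding interval_def by auto
  qed
  have "N > 0" using N by simp
  then have Vne: "V w \<noteq> {}" if "w \<in> S" for w using V[OF that] by auto
  have cS': "config S'" unfolding config_def
  proof (intro conjI ballI impI)
    show "finite S'" unfolding S'_def using V finS by blast
    show "S' \<noteq> {}"
    proof -
      obtain w where "w \<in> S" using cS unfolding config_def by (meson ex_in_conv)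
      then show ?thesis using Vne[of w] unfolding S'_def by blast
    qed
    show "0 < len w" if "w \<in> S'" for w using S'D[OF that] len(2) by blast
    show "w = w'" if "w \<in> S'" "w' \<in> S'" "interval w \<inter> interval w' \<noteq> {}" for w w' using disj that by blast
  qed
  have below: "{w' \<in> S'. interval w' \<subseteq> interval w} = child w ` V w" if w: "w \<in> S" for w
  proof
    show "child w ` V w \<subseteq> {w' \<in> S'. interval w' \<subseteq> interval w}" unfolding S'_def using sub w by blast
    show "{w' \<in> S'. interval w' \<subseteq> interval w} \<subseteq> child w ` V w"
    proof
      fix w' assume w': "w' \<in> {w' \<in> S'. interval w' \<subseteq> interval w}"
      then obtain w2 v where w2: "w2 \<in> S" "v \<in> V w2" "w' = child w2 v" using S'D by blast
      have "left w' \<in> interval w2" "left w' \<in> interval w"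
        using w' left_in_interval[OF cS'] sub[OF w2(1,2)] w2(3) by auto
      then have "w2 = w" using cS w w2(1) unfolding config_def by blast
      then show "w' \<in> child w ` V w" using w2 by blast
    qed
  qed
  have inj: "inj_on (child w) (V w)" if w: "w \<in> S" for w
    using apart[OF w _ w] sig by (intro inj_onI) fastforce
  have cardc: "card (child w ` V w) = N" if "w \<in> S" for w using card_image[OF inj] V that by simp
  have ref: "refines S' S" unfolding refines_def
  proof (intro exI[of _ N] conjI ballI)
    show "\<exists>w\<in>S. interval w' \<subseteq> interval w" if "w' \<in> S'" for w' using S'D[OF that] sub by blast
  qed (use N(2) below cardc in auto)
  have cardS': "card S' = N * card S"
  proof -
    have "card S' = (\<Sum>w\<in>S. card (child w ` V w))" unfolding S'_def
    proof (intro card_UN_disjoint finS ballI impI)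
      show "finite (child w ` V w)" if "w \<in> S" for w using V that by blast
      show "child w ` V w \<inter> child w2 ` V w2 = {}" if w: "w \<in> S" "w2 \<in> S" "w \<noteq> w2" for w w2
      proof (rule ccontr)
        assume "\<not> ?thesis"
        then obtain w' where w': "w' \<in> child w ` V w" "w' \<in> child w2 ` V w2" by blast
        have "w' \<in> S'" using w'(1) w(1) unfolding S'_def by blast
        moreover have "interval w' \<subseteq> interval w" using w'(1) sub[OF w(1)] by (elim imageE) simp
        moreover have "interval w' \<subseteq> interval w2" using w'(2) sub[OF w(2)] by (elim imageE) simp
        ultimately have "left w' \<in> interval w \<inter> interval w2" using left_in_interval[OF cS', of w'] by blast
        then show False using cS w unfolding config_def by (metis empty_iff)
      qed
    qed
    then show ?thesis using cardc by simp
  qed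
  have kS: "kappa S = lm * card S / 3584" unfolding kappa_def lm_def ..
  have kpos: "0 < kappa S" using kappa_pos cS .
  have cardS'_ge: "7 * kappa S / \<sigma> \<le> card S'"
  proof -
    have "7 * kappa S / \<sigma> = lm / (512 * \<sigma>) * card S" unfolding kS by simp
    also have "\<dots> \<le> real N * card S" using N by (intro mult_right_mono) auto
    finally show ?thesis unfolding cardS' by simp
  qed
  \<comment> \<open>Left end points of the cells met are more than \<open>\<sigma> / 2\<close> apart
    and lie in an interval of length \<open>2 * r + \<sigma>\<close>: at most
    \<open>3 + 4 * (r / \<sigma>) \<le> 7 * (r / \<sigma>)\<close> of them. This is the 7 in
    \<open>kappa\<close>.\<close>
  have hit: "hit_ratio S' (cball x r) \<le> r / kappa S" if r: "\<sigma> \<le> r" for x r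
  proof -
    define H where "H = hits S' (cball x r)"
    have HS: "H \<subseteq> S'" unfolding H_def hits_def by blast
    have injH: "inj_on left H" using apart' HS sig by (intro inj_onI) fastforce
    have "left ` H \<subseteq> {x - r - \<sigma>..x + r}"
    proof
      fix y assume "y \<in> left ` H"
      then obtain w z where w: "w \<in> S'" "y = left w" "z \<in> interval w" "z \<in> cball x r"
        unfolding H_def hits_def by blast
      have "len w \<le> \<sigma> / 16" using S'D[OF w(1)] len by auto
      moreover have "\<bar>x - z\<bar> \<le> r" using w(4) by (simp add: dist_real_def)
      ultimately show "y \<in> {x - r - \<sigma>..x + r}" using w sig unfolding interval_def by auto
    qed
    moreover have "\<sigma> / 2 \<le> \<bar>y - z\<bar>" if "y \<in> left ` H" "z \<in> left ` H" "y \<noteq> z" for y z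
      using that apart' HS sig by fastforce
    ultimately have "real (card (left ` H)) \<le> 1 + ((x + r) - (x - r - \<sigma>)) / (\<sigma> / 2)"
      using sig r by (intro card_separated_le(2)) auto
    also have "\<dots> = 3 + 4 * (r / \<sigma>)" using sig by (simp add: field_simps)
    also have "\<dots> \<le> 7 * (r / \<sigma>)"
    proof -
      have "1 \<le> r / \<sigma>" using sig r by simp
      then show ?thesis by linarith
    qed
    finally have "real (card H) \<le> 7 * r / \<sigma>" using card_image[OF injH] by simp
    then have "hit_ratio S' (cball x r) \<le> (7 * r / \<sigma>) / (7 * kappa S / \<sigma>)"
      unfolding hit_ratio_def H_def[symmetric] using cardS'_ge kpos sig by (intro frac_le) auto
    then show ?thesis using sig by simp
  qed
  have ml: "\<eta> / 2 * \<psi> Q \<le> min_len S'"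
    using min_len_attained[OF cS'] S'D len(4) by metis
  have psiQ: "0 < \<psi> Q" using pos Q by blast
  \<comment> \<open>The factor 512 serves \<open>c2\<close>: it cancels against
    \<open>card S' \<ge> 7 * kappa S / \<sigma>\<close> and the denominator
    \<open>3584 = 7 * 512\<close> of \<open>kappa S'\<close>.\<close>
  have mlt: "512 * \<sigma> / kappa S \<le> min_len S' powr t"
  proof -
    have "512 * \<sigma> / kappa S = \<sigma> * B * (\<eta> / 2) powr t"
      unfolding B_def using eta by (simp add: powr_divide)
    also have "\<dots> \<le> \<sigma> * ((real Q)\<^sup>2 * \<psi> Q powr t) * (\<eta> / 2) powr t"
      using QB sig by (intro mult_right_mono mult_left_mono) auto
    also have "\<dots> = (\<eta> / 2 * \<psi> Q) powr t"
      unfolding \<sigma>_def using eta psiQ Q powr_mult[of "\<eta> / 2" "\<psi> Q" t] by simp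
    also have "\<dots> \<le> min_len S' powr t" using ml t eta psiQ by (intro powr_mono2) auto
    finally show ?thesis .
  qed
  have "\<sigma> / kappa S \<le> 512 * \<sigma> / kappa S" using sig kpos by (simp add: divide_right_mono)
  then have c1: "\<sigma> / kappa S \<le> min_len S' powr t" using mlt by linarith
  have c2: "min_len S' \<le> kappa S' * min_len S' powr t"
  proof -
    have "1 = (7 * kappa S / \<sigma>) / 3584 * (512 * \<sigma> / kappa S)" using sig kpos by simp
    also have "\<dots> \<le> card S' / 3584 * min_len S' powr t"
      using cardS'_ge mlt sig kpos by (intro mult_mono divide_right_mono) auto
    finally have "min_len S' * 1 \<le> min_len S' * (card S' / 3584 * min_len S' powr t)"
      using min_len_pos[OF cS'] by (intro mult_left_mono) auto
    then show ?thesis unfolding kappa_def by (simp add: mult_ac)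
  qed
  have thr: "max T0 (1 / \<delta>) \<le> thr (child w v)" "4 \<le> (thr (child w v))\<^sup>2 * len (child w v)" if wv: "w \<in> S" "v \<in> V w" for w v
  proof -
    define q where "q = den w v"
    note d = denQ[OF wv, folded q_def]
    have 1: "2 * ((real q)\<^sup>2 * \<psi> q) \<le> 1" "32 * ((real q)\<^sup>2 * \<psi> q) \<le> \<eta>" using d(5) c by linarith+
    \<comment> \<open>The threshold of a child is at least its denominator \<open>q\<close>, which
      exceeds \<open>T0\<close> and \<open>1 / \<delta>\<close>.\<close>
    have "real q \<le> 1 / (2 * q * \<psi> q)" using 1(1) d(1,8) by (simp add: field_simps power2_eq_square)
    then show "max T0 (1 / \<delta>) \<le> thr (child w v)" using d(6) unfolding child_def q_def by simp
    have "(thr (child w v))\<^sup>2 * len (child w v) = \<eta> / (8 * ((real q)\<^sup>2 * \<psi> q))"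
      unfolding child_def q_def[symmetric] using d(1,8) by (simp add: field_simps power2_eq_square)
    moreover have "4 \<le> \<eta> / (8 * ((real q)\<^sup>2 * \<psi> q))"
      using 1(2) d(1,8) by (simp add: le_divide_eq)
    ultimately show "4 \<le> (thr (child w v))\<^sup>2 * len (child w v)" by simp
  qed
  have adm: "admissible T0 S'" unfolding admissible_def using cS' S'D thr by force
  have close: "(1 - \<eta>) * \<psi> (den w v) \<le> \<bar>x - v\<bar> \<and> \<bar>x - v\<bar> < \<psi> (den w v)"
    if wv: "w \<in> S" "v \<in> V w" and x: "x \<in> interval (child w v)" for w v x
  proof -
    have "v + (1 - \<eta>) * \<psi> (den w v) \<le> x" "x \<le> v + (1 - \<eta>) * \<psi> (den w v) + \<eta> * \<psi> (den w v) / 2"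
      using x unfolding interval_def child_def by auto
    moreover have "0 < \<eta> * \<psi> (den w v)" "0 \<le> (1 - \<eta>) * \<psi> (den w v)" using eta denQ(8)[OF wv] by auto
    moreover have "(1 - \<eta>) * \<psi> (den w v) = \<psi> (den w v) - \<eta> * \<psi> (den w v)" by (simp add: algebra_simps)
    ultimately show ?thesis by linarith
  qed
  have a1: "1 / \<delta> \<le> thr w'" "\<exists>(p::int) (q::nat). 1 / \<delta> < q \<and> \<bar>x - p / q\<bar> < \<psi> q"
    if w': "w' \<in> S'" and x: "x \<in> interval w'" for w' x
  proof -
    obtain w v where wv: "w \<in> S" "v \<in> V w" "w' = child w v" using S'D[OF w'] by blast
    show "1 / \<delta> \<le> thr w'" using thr(1)[OF wv(1,2)] wv(3) by simp
    obtain p :: int where p: "v = p / den w v" using denQ(4)[OF wv(1,2)] by blast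
    have "\<bar>x - p / den w v\<bar> < \<psi> (den w v)" using close[OF wv(1,2)] x wv(3) p by auto
    then show "\<exists>(p::int) (q::nat). 1 / \<delta> < q \<and> \<bar>x - p / q\<bar> < \<psi> q"
      using denQ(6)[OF wv(1,2)] by (intro exI[of _ p] exI[of _ "den w v"]) auto
  qed
  have a2: "(1 - \<eta>) * \<psi> q \<le> \<bar>x - real_of_int p / q\<bar>"
    if w: "w \<in> S" "w' \<in> S'" "interval w' \<subseteq> interval w" "x \<in> interval w'"
      and q: "thr w \<le> real q" "real q < thr w'" for w w' x p q
  proof -
    obtain v where v: "v \<in> V w" "w' = child w v" using below[OF w(1)] w by blast
    have "real q < 1 / (2 * den w v * \<psi> (den w v))" using q v unfolding child_def by simp
    then show ?thesis
      using close[OF w(1) v(1), of x] v w eta q thrS(1)[OF w(1)]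
      by (intro child_avoids[OF den[OF w(1) v(1)] _ denQ(1)[OF w(1) v(1)]]) auto
  qed
  have lenS': "len w \<le> \<sigma>" if "w \<in> S'" for w using S'D[OF that] len(3) sig by fastforce
  have thr': "1 / \<delta> \<le> thr w'" if "w' \<in> S'" for w' using a1(1)[OF that left_in_interval[OF cS' that]] .
  show ?thesis unfolding refinement_def
    by (rule exI[of _ S'], rule exI[of _ \<sigma>], intro conjI ballI allI impI)
      (use adm ref sig lenS' hit c1 c2 thr' a1(2) a2 in auto)
qed

end

section \<open>The product Cantor set\<close>

text \<open>Step \<open>n\<close> refines coordinate \<open>c n\<close> only. At scales in \<open>{\<sigma> n..\<delta> n}\<close> all coordinates look
  one-dimensional, and at scales in \<open>{\<delta> (Suc n)..\<sigma> n}\<close> all but coordinate \<open>c n\<close> do.\<close>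

locale cantor_product =
  fixes \<psi> :: "'m::finite \<Rightarrow> nat \<Rightarrow> real" and \<beta> :: "'m \<Rightarrow> real" and c :: "nat \<Rightarrow> 'm"
    and S :: "nat \<Rightarrow> 'm \<Rightarrow> cell set" and \<sigma> \<delta> :: "nat \<Rightarrow> real" and \<epsilon> t :: real
  assumes approx: "\<And>i. approx_fun (\<psi> i) (\<beta> i)"
    and recur: "\<And>n i. \<exists>k\<ge>n. c k = i"
    and exponents: "0 < \<epsilon>" "0 \<le> t" "t \<le> 1 - \<epsilon>"
    and config: "\<And>n i. config (S n i)"
    and start: "\<And>i w. w \<in> S 0 i \<Longrightarrow> interval w \<subseteq> {0..<1}"
    and unchanged: "\<And>n i. i \<noteq> c n \<Longrightarrow> S (Suc n) i = S n i"
    and step: "\<And>n. approx_fun.refinement (\<psi> (c n)) (1 / (real n + 2)) (\<delta> n) t (S n (c n)) (S (Suc n) (c n)) (\<sigma> n)"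
    and delta: "\<And>n. 0 < \<delta> n" "\<And>n. \<delta> n \<le> 1 / (real n + 1)" "\<And>n i. \<delta> n \<le> min_len (S n i)"
      "\<And>n i. \<delta> n powr \<epsilon> \<le> kappa (S n i)"
begin

lemmas step' = step[unfolded approx_fun.refinement_def[OF approx]]

definition region :: "nat \<Rightarrow> 'm \<Rightarrow> real set" where
  "region n i = (\<Union>w\<in>S n i. interval w)"

lemma refines_Suc: "refines (S (Suc n) i) (S n i)"
  using step'[of n] unchanged[of i n] refines_refl[OF config] by (cases "i = c n") auto

lemma refine_interval: "w' \<in> S (Suc n) i \<Longrightarrow> \<exists>w\<in>S n i. interval w' \<subseteq> interval w"
  using refines_Suc unfolding refines_def by blast

lemma hit_ratio_antimono: "m \<le> n \<Longrightarrow> hit_ratio (S n i) X \<le> hit_ratio (S m i) X"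
  by (rule lift_Suc_antimono_le[of "\<lambda>n. hit_ratio (S n i) X"])
     (auto intro: hit_ratio_refines config refines_Suc)

lemma region_antimono: "m \<le> n \<Longrightarrow> region n i \<subseteq> region m i"
  by (rule lift_Suc_antimono_le[of "\<lambda>n. region n i"])
     (use refine_interval in \<open>fastforce simp: region_def\<close>)

lemma sigma_less: "0 < \<sigma> n" "\<sigma> n < \<delta> n"
  using step'[of n] by auto

lemma delta_Suc_le: "\<delta> (Suc n) \<le> \<sigma> n"
proof -
  obtain w where "w \<in> S (Suc n) (c n)" "min_len (S (Suc n) (c n)) = len w"
    using min_len_attained[OF config] by blast
  moreover have "\<forall>w\<in>S (Suc n) (c n). len w \<le> \<sigma> n" using step'[of n] by blast
  ultimately show ?thesis using delta(3)[of "Suc n" "c n"] by auto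
qed

lemma sigma_antimono: "m \<le> n \<Longrightarrow> \<sigma> n \<le> \<sigma> m"
  using lift_Suc_antimono_le[of \<sigma>] sigma_less(2) delta_Suc_le by (meson less_imp_le order_trans)

lemma delta_le_1: "\<delta> n \<le> 1"
  using delta(2)[of n] by (smt (verit) divide_le_eq_1 of_nat_0_le_iff)

text \<open>Until coordinate \<open>i\<close> is refined again its cells are those of stage
  \<open>n\<close>, so the bound given by that refinement can be stated with
  \<open>kappa (S n i)\<close>.\<close>

lemma next_update: "\<exists>k\<ge>n. c k = i \<and> S k i = S n i"
proof -
  define k where "k = (LEAST k. n \<le> k \<and> c k = i)"
  have k: "n \<le> k" "c k = i" using LeastI_ex[of "\<lambda>k. n \<le> k \<and> c k = i"] recur k_def by auto
  have "S j i = S n i" if "n \<le> j" "j \<le> k" for j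
    using that
  proof (induction j rule: dec_induct)
    case (step j)
    then have "c j \<noteq> i" using not_less_Least[of j "\<lambda>k. n \<le> k \<and> c k = i"] unfolding k_def by auto
    then show ?case using unchanged step by auto
  qed simp
  from this[OF k(1) order_refl] k show ?thesis by blast
qed

text \<open>The next refinement of \<open>i\<close>, at some \<open>k \<ge> n\<close>, has
  \<open>\<sigma> k \<le> \<sigma> n \<le> r\<close>, and its bound persists. How late it comes is
  left open, hence the eventuality in \<open>N\<close>.\<close>

lemma hit_ratio_eventually_le:
  assumes r: "\<sigma> n \<le> r"
  shows "\<forall>\<^sub>F N in sequentially. \<forall>x. hit_ratio (S N i) (cball x r) \<le> r / kappa (S n i)"
proof -
  obtain k where k: "k \<ge> n" "c k = i" "S k i = S n i" using next_update by blast
  have "\<sigma> k \<le> r" using sigma_antimono[OF k(1)] r by simp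
  then have "hit_ratio (S (Suc k) i) (cball x r) \<le> r / kappa (S n i)" for x
    using step'[of k] k by auto
  then have "\<forall>x. hit_ratio (S N i) (cball x r) \<le> r / kappa (S n i)" if "Suc k \<le> N" for N
    using hit_ratio_antimono[OF that] order_trans by blast
  then show ?thesis by (rule eventually_sequentiallyI)
qed

text \<open>The choice of \<open>\<delta> m\<close> pays for the constant:
  \<open>r powr \<epsilon> \<le> kappa (S m i)\<close>. Two indices are used because a coordinate
  other than \<open>c n\<close> has the same cells at stages \<open>n\<close> and
  \<open>Suc n\<close>; its good range then extends from \<open>\<delta> n\<close> down to
  \<open>\<sigma> (Suc n)\<close>, across the bad range of \<open>c n\<close>.\<close>

lemma hit_ratio_good_scale:
  assumes r: "\<sigma> n \<le> r" "r \<le> \<delta> m" and same: "S n i = S m i"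
  shows "\<forall>\<^sub>F N in sequentially. \<forall>x. hit_ratio (S N i) (cball x r) \<le> r powr (1 - \<epsilon>)"
proof -
  have r0: "0 < r" using sigma_less r by (meson less_le_trans)
  have "r powr \<epsilon> \<le> \<delta> m powr \<epsilon>" using r r0 exponents by (intro powr_mono2) auto
  then have "r / kappa (S n i) \<le> r / r powr \<epsilon>"
    unfolding same using r0 delta(4)[of m i] kappa_pos[OF config] by (intro divide_left_mono mult_pos_pos) auto
  also have "\<dots> = r powr (1 - \<epsilon>)" using r0 by (simp add: powr_diff)
  finally have le: "r / kappa (S n i) \<le> r powr (1 - \<epsilon>)" .
  show ?thesis using hit_ratio_eventually_le[OF r(1), of i] by eventually_elim (use le order_trans in blast)
qed

text \<open>If \<open>r\<close> is at least the minimal length of the new cells, the ball is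
  enlarged to radius \<open>\<sigma> n\<close>; its mass is at most the \<open>t\<close>-th power of
  that length, hence at most \<open>r powr t\<close>. If \<open>r\<close> is smaller, then
  \<open>kappa \<ge> r powr (1 - t)\<close> for the new cells, and the next refinement of the
  coordinate gives \<open>r / kappa \<le> r powr t\<close>.\<close>

lemma hit_ratio_bad_scale:
  assumes r: "\<delta> (Suc n) \<le> r" "r \<le> \<sigma> n"
  shows "\<forall>\<^sub>F N in sequentially. \<forall>x. hit_ratio (S N (c n)) (cball x r) \<le> r powr t"
proof (cases "min_len (S (Suc n) (c n)) \<le> r")
  case True
  have ml: "0 < min_len (S (Suc n) (c n))" using min_len_pos[OF config] .
  have "hit_ratio (S N (c n)) (cball x r) \<le> r powr t" if N: "Suc n \<le> N" for N x
  proof -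
    have "hit_ratio (S N (c n)) (cball x r) \<le> hit_ratio (S (Suc n) (c n)) (cball x r)"
      using hit_ratio_antimono N by blast
    also have "\<dots> \<le> hit_ratio (S (Suc n) (c n)) (cball x (\<sigma> n))"
      using r by (intro hit_ratio_mono config) auto
    also have "\<dots> \<le> \<sigma> n / kappa (S n (c n))" using step'[of n] by blast
    also have "\<dots> \<le> min_len (S (Suc n) (c n)) powr t" using step'[of n] by blast
    also have "\<dots> \<le> r powr t" using True exponents ml by (intro powr_mono2) auto
    finally show ?thesis .
  qed
  then show ?thesis by (intro eventually_sequentiallyI) blast
next
  case False
  define S' where "S' = S (Suc n) (c n)"
  have r0: "0 < r" using delta(1) r by (meson less_le_trans)
  have ml: "r < min_len S'" "min_len S' \<le> kappa S' * min_len S' powr t" "0 < kappa S'"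
    using False step'[of n] kappa_pos[OF config] unfolding S'_def by auto
  have "min_len S' powr (1 - t) \<le> kappa S'"
    using ml r0 by (simp add: powr_diff divide_le_eq)
  moreover have "r powr (1 - t) \<le> min_len S' powr (1 - t)"
    using ml r0 exponents by (intro powr_mono2) auto
  ultimately have "r / kappa S' \<le> r / r powr (1 - t)"
    using ml r0 by (intro divide_left_mono mult_pos_pos) auto
  also have "\<dots> = r powr t" using r0 by (simp add: powr_diff)
  finally have le: "r / kappa S' \<le> r powr t" .
  have "\<sigma> (Suc n) \<le> r" using sigma_less(2)[of "Suc n"] r by simp
  from hit_ratio_eventually_le[OF this, of "c n"] show ?thesis
    by eventually_elim (use le order_trans S'_def in blast)
qed

text \<open>The exceptional coordinate is \<open>c n\<close> for the \<open>n\<close> with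
  \<open>\<delta> (Suc n) < r \<le> \<delta> n\<close>. If even \<open>r > \<sigma> n\<close>, it is
  good as well, and \<open>t \<le> 1 - \<epsilon>\<close> weakens its bound to the one
  claimed.\<close>

lemma hit_ratio_scale:
  assumes r: "0 < r" "r \<le> \<delta> 0"
  shows "\<exists>j. (\<forall>\<^sub>F N in sequentially. \<forall>x. hit_ratio (S N j) (cball x r) \<le> r powr t) \<and>
    (\<forall>i. i \<noteq> j \<longrightarrow> (\<forall>\<^sub>F N in sequentially. \<forall>x. hit_ratio (S N i) (cball x r) \<le> r powr (1 - \<epsilon>)))"
proof -
  have "(\<lambda>n. 1 / (real n + 1)) \<longlonglongrightarrow> 0" by real_asymp
  then have "\<forall>\<^sub>F n in sequentially. 1 / (real n + 1) < r" using r by (intro order_tendstoD) auto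
  then obtain n1 where "1 / (real n1 + 1) < r" unfolding eventually_sequentially by blast
  then have "\<delta> n1 < r" using delta(2)[of n1] by simp
  then have ex: "\<exists>n. \<delta> n < r" ..
  define n0 where "n0 = (LEAST n. \<delta> n < r)"
  have n0: "\<delta> n0 < r" unfolding n0_def using LeastI_ex[OF ex] .
  then obtain n where n: "n0 = Suc n" using r by (cases n0) auto
  then have rn: "\<delta> (Suc n) < r" "r \<le> \<delta> n"
    using n0 not_less_Least[of n "\<lambda>n. \<delta> n < r"] n0_def by auto
  show ?thesis
  proof (intro exI[of _ "c n"] conjI allI impI)
    show "\<forall>\<^sub>F N in sequentially. \<forall>x. hit_ratio (S N (c n)) (cball x r) \<le> r powr t"
    proof (cases "r \<le> \<sigma> n")
      case True
      then show ?thesis using hit_ratio_bad_scale rn by simp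
    next
      case False
      have "r powr (1 - \<epsilon>) \<le> r powr t" using r exponents delta_le_1[of 0] by (intro powr_mono') auto
      moreover have "\<forall>\<^sub>F N in sequentially. \<forall>x. hit_ratio (S N (c n)) (cball x r) \<le> r powr (1 - \<epsilon>)"
        using hit_ratio_good_scale[of n r n] rn False by simp
      ultimately show ?thesis by (auto elim!: eventually_mono intro: order_trans)
    qed
    show "\<forall>\<^sub>F N in sequentially. \<forall>x. hit_ratio (S N i) (cball x r) \<le> r powr (1 - \<epsilon>)" if "i \<noteq> c n" for i
      using hit_ratio_good_scale[of "Suc n" r n i] rn sigma_less(2)[of "Suc n"] unchanged[OF that] by simp
  qed
qed

lemma prod_hit_ratio_scale:
  assumes r: "0 < r" "r \<le> \<delta> 0"
  shows "\<forall>\<^sub>F N in sequentially. \<forall>x::real^'m. (\<Prod>i\<in>UNIV. hit_ratio (S N i) (cball (x $ i) r))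
     \<le> r powr ((real CARD('m) - 1) * (1 - \<epsilon>) + t)"
proof -
  obtain j where j: "\<forall>\<^sub>F N in sequentially. \<forall>x. hit_ratio (S N j) (cball x r) \<le> r powr t"
    "\<And>i. i \<noteq> j \<Longrightarrow> \<forall>\<^sub>F N in sequentially. \<forall>x. hit_ratio (S N i) (cball x r) \<le> r powr (1 - \<epsilon>)"
    using hit_ratio_scale[OF r] by blast
  define e where "e i = (if i = j then t else 1 - \<epsilon>)" for i
  have "\<forall>\<^sub>F N in sequentially. \<forall>i. \<forall>x. hit_ratio (S N i) (cball x r) \<le> r powr e i"
    using j by (intro eventually_all_finite) (auto simp: e_def)
  then show ?thesis
  proof eventually_elim
    case (elim N)
    show ?case
    proof
      fix x :: "real^'m"
      have "(\<Prod>i\<in>UNIV. hit_ratio (S N i) (cball (x $ i) r)) \<le> (\<Prod>i\<in>UNIV. r powr e i)"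
        using elim by (intro prod_mono) (auto simp: hit_ratio_nonneg)
      also have "(\<Prod>i\<in>UNIV. r powr e i) = r powr (\<Sum>i\<in>UNIV. e i)" using r by (simp add: powr_sum)
      also have "(\<Sum>i\<in>UNIV. e i) = t + (\<Sum>i\<in>UNIV - {j}. 1 - \<epsilon>)"
        by (subst sum.remove[of _ j]) (auto simp: e_def)
      also have "\<dots> = (real CARD('m) - 1) * (1 - \<epsilon>) + t"
        by (simp add: card_Diff_singleton of_nat_diff Suc_leI)
      finally show "(\<Prod>i\<in>UNIV. hit_ratio (S N i) (cball (x $ i) r))
        \<le> r powr ((real CARD('m) - 1) * (1 - \<epsilon>) + t)" .
    qed
  qed
qed

text \<open>\<open>\<delta> n\<close> lies in the good range of every coordinate; the packing
  dimension is computed from these scales.\<close>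

lemma prod_hit_ratio_delta:
  "\<forall>\<^sub>F N in sequentially. \<forall>x::real^'m. (\<Prod>i\<in>UNIV. hit_ratio (S N i) (cball (x $ i) (\<delta> n)))
     \<le> \<delta> n powr (real CARD('m) * (1 - \<epsilon>))"
proof -
  have "\<forall>\<^sub>F N in sequentially. \<forall>i. \<forall>x. hit_ratio (S N i) (cball x (\<delta> n)) \<le> \<delta> n powr (1 - \<epsilon>)"
    using hit_ratio_good_scale[of n "\<delta> n" n] sigma_less(2)[of n] by (intro eventually_all_finite) auto
  then show ?thesis
  proof eventually_elim
    case (elim N)
    show ?case
    proof
      fix x :: "real^'m"
      have "(\<Prod>i\<in>UNIV. hit_ratio (S N i) (cball (x $ i) (\<delta> n))) \<le> (\<Prod>i\<in>(UNIV::'m set). \<delta> n powr (1 - \<epsilon>))"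
        using elim by (intro prod_mono) (auto simp: hit_ratio_nonneg)
      also have "(\<Prod>i\<in>(UNIV::'m set). \<delta> n powr (1 - \<epsilon>)) = \<delta> n powr (real CARD('m) * (1 - \<epsilon>))"
        using delta(1)[of n] by (simp add: powr_power mult.commute)
      finally show "(\<Prod>i\<in>UNIV. hit_ratio (S N i) (cball (x $ i) (\<delta> n)))
        \<le> \<delta> n powr (real CARD('m) * (1 - \<epsilon>))" .
    qed
  qed
qed

section \<open>Covers of the limit set, and exactness of its points\<close>

definition limit_set :: "(real^'m) set" where
  "limit_set = {x. \<forall>i n. x $ i \<in> region n i}"

text \<open>A mass distribution principle without a limit measure. By compactness some stage already
  lies inside the cover, and finitely many balls suffice for it; only then is a stage
  \<open>N\<close> chosen beyond the finitely many thresholds in \<open>scale\<close>, and its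
  product cells are counted. This order of choices is why \<open>scale\<close> may hold eventually,
  separately for each radius.\<close>

lemma finite_subcover:
  fixes \<F> :: "((real^'m) \<times> real) set"
  assumes cover: "limit_set \<subseteq> (\<Union>(x, r)\<in>\<F>. ball x r)"
    and scale: "\<And>x r. (x, r) \<in> \<F> \<Longrightarrow> \<forall>\<^sub>F N in sequentially. \<forall>x::real^'m.
       (\<Prod>i\<in>UNIV. hit_ratio (S N i) (cball (x $ i) r)) \<le> r powr s"
  obtains \<F>' where "finite \<F>'" "\<F>' \<subseteq> \<F>" "1 \<le> (\<Sum>(x, r)\<in>\<F>'. r powr s)"
proof -
  define E where "E n = {x::real^'m. \<forall>i. x $ i \<in> region n i}" for n
  have finS: "finite (S n i)" for n i using config unfolding config_def by blast
  have Eanti: "E n \<subseteq> E m" if "m \<le> n" for m n using region_antimono[OF that] unfolding E_def by blast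
  have reg: "compact (region n i)" for n i
    unfolding region_def interval_def using finS by (intro compact_UN) auto
  have Ecl: "closed (E n)" for n
  proof -
    have "E n = (\<Inter>i. (\<lambda>x. x $ i) -` region n i)" unfolding E_def by auto
    moreover have "closed ((\<lambda>x::real^'m. x $ i) -` region n i)" for i
      using compact_imp_closed[OF reg] by (intro closed_vimage continuous_intros)
    ultimately show ?thesis by (simp add: closed_INT)
  qed
  have E0: "E n \<subseteq> cbox 0 1" for n
  proof -
    have "region n i \<subseteq> {0..1}" for i
    proof -
      have "region 0 i \<subseteq> {0..<1}" unfolding region_def using start by blast
      then show ?thesis using region_antimono[of 0 n i] by fastforce
    qed
    then have reg: "0 \<le> x \<and> x \<le> 1" if "x \<in> region n i" for x i using that by fastforce
    show ?thesis
    proof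
      fix x assume "x \<in> E n"
      then have "0 \<le> x $ i \<and> x $ i \<le> 1" for i using reg[of "x $ i" i] unfolding E_def by blast
      then show "x \<in> cbox 0 1" by (simp add: mem_box_cart)
    qed
  qed
  have Ecomp: "compact (E n)" for n
    using compact_Int_closed[OF compact_cbox Ecl, of 0 1 n] E0[of n] by (simp add: Int_absorb1)
  define U where "U = (\<Union>(x, r)\<in>\<F>. ball x r)"
  have opU: "open U" unfolding U_def by (intro open_UN) (auto split: prod.splits)
  have "\<exists>n. E n \<subseteq> U"
  proof (rule ccontr)
    assume no: "\<nexists>n. E n \<subseteq> U"
    have "\<Inter>(range (\<lambda>n. E n - U)) \<noteq> {}"
    proof (rule compact_nest)
      show "compact (E n - U)" for n using Ecomp opU by (simp add: compact_diff)
      show "E n - U \<noteq> {}" for n using no by blast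
      show "E n - U \<subseteq> E m - U" if "m \<le> n" for m n using Eanti[OF that] by blast
    qed
    then obtain x where "\<And>n. x \<in> E n" "x \<notin> U" by blast
    then show False using cover unfolding U_def limit_set_def E_def by blast
  qed
  then obtain n1 where n1: "E n1 \<subseteq> U" ..
  obtain \<F>' where F': "\<F>' \<subseteq> \<F>" "finite \<F>'" "E n1 \<subseteq> (\<Union>(x, r)\<in>\<F>'. ball x r)"
  proof (rule compactE_image[OF Ecomp, of \<F> "\<lambda>(x, r). ball x r" n1])
    show "E n1 \<subseteq> (\<Union>(x, r)\<in>\<F>. ball x r)" using n1 unfolding U_def .
  qed auto
  have "\<forall>\<^sub>F N in sequentially. \<forall>b\<in>\<F>'. \<forall>x::real^'m.
       (\<Prod>i\<in>UNIV. hit_ratio (S N i) (cball (x $ i) (snd b))) \<le> snd b powr s"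
    using scale F' by (intro eventually_ball_finite) auto
  then have "\<forall>\<^sub>F N in sequentially. n1 \<le> N \<and> (\<forall>b\<in>\<F>'. \<forall>x::real^'m.
       (\<Prod>i\<in>UNIV. hit_ratio (S N i) (cball (x $ i) (snd b))) \<le> snd b powr s)"
    by (intro eventually_conj eventually_ge_at_top)
  then obtain N where N: "n1 \<le> N" and hit: "\<And>x r y. (x, r) \<in> \<F>' \<Longrightarrow>
       (\<Prod>i\<in>UNIV. hit_ratio (S N i) (cball ((y::real^'m) $ i) r)) \<le> r powr s"
    unfolding eventually_sequentially by fastforce
  \<comment> \<open>\<open>W b\<close> collects the product cells that meet the cube around the
    ball. Each product cell is tested at its corner of left end points, which lies in
    \<open>E N\<close>.\<close>
  define W where "W b = (\<Pi>\<^sub>E i\<in>UNIV. hits (S N i) (cball (fst b $ i) (snd b)))" for b :: "(real^'m) \<times> real"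
  have "(\<Pi>\<^sub>E i\<in>UNIV. S N i) \<subseteq> (\<Union>b\<in>\<F>'. W b)"
  proof
    fix g assume g: "g \<in> (\<Pi>\<^sub>E i\<in>UNIV. S N i)"
    define y where "y = (\<chi> i. left (g i))"
    have gi: "g i \<in> S N i" for i using g by auto
    have "left (g i) \<in> region N i" for i
      using gi[of i] left_in_interval[OF config gi] unfolding region_def by blast
    then have "y \<in> E N" unfolding E_def y_def by simp
    then obtain x r where b: "(x, r) \<in> \<F>'" "dist x y < r" using Eanti[OF N] F'(3) by fastforce
    have "g i \<in> hits (S N i) (cball (x $ i) r)" for i
    proof -
      have "dist (x $ i) (y $ i) \<le> r" using b dist_vec_nth_le[of x i y] by simp
      then have "left (g i) \<in> cball (x $ i) r" unfolding y_def by simp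
      then show ?thesis using gi left_in_interval[OF config] unfolding hits_def by blast
    qed
    then have "g \<in> W (x, r)" unfolding W_def by auto
    then show "g \<in> (\<Union>b\<in>\<F>'. W b)" using b by blast
  qed
  moreover have "finite (W b)" for b
    unfolding W_def hits_def using finS by (intro finite_PiE) auto
  ultimately have "card (\<Pi>\<^sub>E i\<in>UNIV. S N i) \<le> (\<Sum>b\<in>\<F>'. card (W b))"
    using card_UN_le[OF F'(2), of W] F'(2) by (meson card_mono finite_UN_I order_trans)
  then have "(\<Prod>i\<in>UNIV. card (S N i)) \<le> (\<Sum>b\<in>\<F>'. \<Prod>i\<in>UNIV. card (hits (S N i) (cball (fst b $ i) (snd b))))"
    unfolding W_def by (simp add: card_PiE)
  then have le: "(\<Prod>i\<in>UNIV. real (card (S N i))) \<le>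
     (\<Sum>b\<in>\<F>'. \<Prod>i\<in>UNIV. real (card (hits (S N i) (cball (fst b $ i) (snd b)))))"
    by (simp flip: of_nat_prod of_nat_sum)
  define P where "P = (\<Prod>i\<in>UNIV. real (card (S N i)))"
  have P: "0 < P" unfolding P_def using card_config_pos[OF config] by (intro prod_pos) auto
  have "1 \<le> (\<Sum>b\<in>\<F>'. \<Prod>i\<in>UNIV. real (card (hits (S N i) (cball (fst b $ i) (snd b))))) / P"
    using le P unfolding P_def by simp
  also have "\<dots> = (\<Sum>b\<in>\<F>'. \<Prod>i\<in>UNIV. hit_ratio (S N i) (cball (fst b $ i) (snd b)))"
    unfolding hit_ratio_def P_def by (simp add: sum_divide_distrib prod_dividef)
  also have "\<dots> \<le> (\<Sum>(x, r)\<in>\<F>'. r powr s)"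
    using hit by (intro sum_mono) auto
  finally show thesis using that F' by blast
qed

text \<open>Every refinement of \<open>i\<close> supplies an approximation with denominator above
  \<open>1 / \<delta> n\<close>, so there are infinitely many. For \<open>b < 1\<close>, the
  thresholds of the nested cells around \<open>x\<close> cut the large denominators into ranges,
  each settled by one refinement whose factor \<open>1 - 1 / (real n + 2)\<close> exceeds
  \<open>b\<close> from some stage on.\<close>

lemma region_exact:
  assumes x: "\<And>n. x \<in> region n i"
  shows "x \<in> exact_set (\<psi> i)"
proof -
  interpret approx_fun "\<psi> i" "\<beta> i" by (rule approx)
  have "\<forall>n. \<exists>w\<in>S n i. x \<in> interval w" using x unfolding region_def by blast
  then obtain w where w: "\<And>n. w n \<in> S n i" "\<And>n. x \<in> interval (w n)" by metis
  have uniq: "v = w n" if "v \<in> S n i" "x \<in> interval v" for v n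
    using config[of n i] that w[of n] unfolding config_def by blast
  have sub: "interval (w (Suc n)) \<subseteq> interval (w n)" for n
    using refine_interval[OF w(1)[of "Suc n"]] w(2)[of "Suc n"] uniq by blast
  have x01: "x \<in> {0..<1}" using start[of "w 0" i] w[of 0] by blast
  have upd: "1 / \<delta> n \<le> thr (w (Suc n))" "\<exists>(p::int) (q::nat). 1 / \<delta> n < q \<and> \<bar>x - p / q\<bar> < \<psi> i q"
    "\<And>p q. thr (w n) \<le> real q \<Longrightarrow> real q < thr (w (Suc n)) \<Longrightarrow>
       (1 - 1 / (real n + 2)) * \<psi> i q \<le> \<bar>x - real_of_int p / q\<bar>" if c: "c n = i" for n
    using step'[of n] w sub unfolding c by blast+
  have inv_delta: "real n + 1 \<le> 1 / \<delta> n" for n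
    using delta(1,2)[of n] by (simp add: field_simps)
  have "infinite {(p :: int, q :: nat). q \<ge> 1 \<and> \<bar>x - of_int p / of_nat q\<bar> < \<psi> i q}" (is "infinite ?A")
  proof
    assume "finite ?A"
    then have "finite (snd ` ?A)" by simp
    then have "\<exists>M. \<forall>q\<in>snd ` ?A. q \<le> M" by (simp only: finite_nat_set_iff_bounded_le)
    then obtain M where M: "\<And>q. q \<in> snd ` ?A \<Longrightarrow> q \<le> M" by blast
    obtain n where n: "n \<ge> M" "c n = i" using recur by blast
    obtain p :: int and q :: nat where pq: "1 / \<delta> n < q" "\<bar>x - p / q\<bar> < \<psi> i q" using upd(2)[OF n(2)] by blast
    have "M < q" using pq inv_delta[of n] n(1) by linarith
    then have "(p, q) \<in> ?A" using pq by auto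
    then show False using M[of q] \<open>M < q\<close> by force
  qed
  then have in_approx: "x \<in> approx_set (\<psi> i)" using x01 unfolding approx_set_def by simp
  have "x \<notin> approx_set (\<lambda>q. b * \<psi> i q)" if b: "0 < b" "b < 1" for b
  proof
    assume "x \<in> approx_set (\<lambda>q. b * \<psi> i q)"
    then have inf: "infinite {(p :: int, q :: nat). q \<ge> 1 \<and> \<bar>x - of_int p / of_nat q\<bar> < b * \<psi> i q}" (is "infinite ?A")
      unfolding approx_set_def by simp
    have "(\<lambda>n. 1 / (real n + 2)) \<longlonglongrightarrow> 0" by real_asymp
    then have "\<forall>\<^sub>F n in sequentially. 1 / (real n + 2) < 1 - b" using b by (intro order_tendstoD) auto
    then obtain n0 where n0: "\<And>n. n \<ge> n0 \<Longrightarrow> 1 / (real n + 2) < 1 - b" unfolding eventually_sequentially by blast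
    have lt: "real q < thr (w n0)" if "(p, q) \<in> ?A" for p q
    proof (rule ccontr)
      assume "\<not> real q < thr (w n0)"
      then have start: "thr (w n0) \<le> real q" by simp
      obtain k where k: "k \<ge> max n0 q" "c k = i" using recur by blast
      have "real q < thr (w (Suc k))" using upd(1)[OF k(2)] inv_delta[of k] k(1) by linarith
      moreover have "n0 \<le> Suc k" using k by simp
      \<comment> \<open>The thresholds start at or below \<open>q\<close> and later exceed it, so
        some single step crosses \<open>q\<close>.\<close>
      ultimately have "\<exists>n\<ge>n0. thr (w n) \<le> real q \<and> real q < thr (w (Suc n))"
      proof (rule_tac ccontr)
        assume no: "\<not> (\<exists>n\<ge>n0. thr (w n) \<le> real q \<and> real q < thr (w (Suc n)))"
        have "thr (w j) \<le> real q" if "n0 \<le> j" for j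
          using that by (induction j rule: dec_induct) (use start no in force)+
        then show False using \<open>n0 \<le> Suc k\<close> \<open>real q < thr (w (Suc k))\<close> by force
      qed
      then obtain n where n: "n \<ge> n0" "thr (w n) \<le> real q" "real q < thr (w (Suc n))" by blast
      \<comment> \<open>Thresholds in coordinate \<open>i\<close> change only when \<open>i\<close>
        is refined.\<close>
      have "c n = i"
      proof (rule ccontr)
        assume "c n \<noteq> i"
        then have "w (Suc n) = w n" using uniq[of "w (Suc n)" n] w[of "Suc n"] unchanged[of i n] by auto
        then show False using n by simp
      qed
      then have "(1 - 1 / (real n + 2)) * \<psi> i q \<le> \<bar>x - real_of_int p / q\<bar>" using upd(3) n by blast
      moreover have q: "1 \<le> q" "\<bar>x - real_of_int p / q\<bar> < b * \<psi> i q" using that by auto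
      moreover have "b * \<psi> i q \<le> (1 - 1 / (real n + 2)) * \<psi> i q"
        using n0[OF n(1)] pos[OF q(1)] by (intro mult_right_mono) auto
      ultimately show False by linarith
    qed
    have bq: "q \<le> nat \<lceil>thr (w n0)\<rceil>" if "(p, q) \<in> ?A" for p q
    proof -
      have "real q \<le> real (nat \<lceil>thr (w n0)\<rceil>)"
        using lt[OF that] real_nat_ceiling_ge[of "thr (w n0)"] by linarith
      then show ?thesis by simp
    qed
    define M where "M = nat \<lceil>thr (w n0)\<rceil>"
    \<comment> \<open>Numerators are bounded too, since \<open>x\<close> lies in
      \<open>{0..<1}\<close> and \<open>b * \<psi> i q \<le> \<psi> i 1\<close>; hence only finitely
      many pairs remain.\<close>
    define R where "R = \<lceil>real M * (1 + \<psi> i 1)\<rceil>"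
    have "\<bar>p\<bar> \<le> R" if "(p, q) \<in> ?A" for p q
    proof -
      have q: "1 \<le> q" "q \<le> M" "\<bar>x - real_of_int p / q\<bar> < b * \<psi> i q" using that bq M_def by auto
      have "b * \<psi> i q \<le> 1 * \<psi> i 1" using anti[of 1 q] pos[OF q(1)] b q by (intro mult_mono) auto
      then have "\<bar>real_of_int p / q\<bar> \<le> 1 + \<psi> i 1" using q(3) x01 by auto
      then have "\<bar>real_of_int p\<bar> \<le> q * (1 + \<psi> i 1)" using q(1) by (simp add: abs_divide field_simps)
      also have "\<dots> \<le> real M * (1 + \<psi> i 1)" using q pos[of 1] by (intro mult_right_mono) auto
      finally show ?thesis unfolding R_def by linarith
    qed
    then have "?A \<subseteq> {-R..R} \<times> {..M}" using bq unfolding M_def by (fastforce simp: abs_le_iff)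
    then show False using inf finite_subset by blast
  qed
  then show ?thesis using in_approx unfolding exact_set_def by auto
qed

lemma limit_set_subset: "limit_set \<subseteq> exact_prod \<psi>"
  using region_exact unfolding limit_set_def exact_prod_def by blast

end

section \<open>Existence of the construction\<close>

lemma recurrent_enumeration: "\<exists>c :: nat \<Rightarrow> 'm::finite. \<forall>n i. \<exists>k\<ge>n. c k = i"
proof -
  obtain h where h: "bij_betw h {0..<CARD('m)} (UNIV :: 'm set)"
    using ex_bij_betw_nat_finite[of "UNIV :: 'm set"] by auto
  have "\<exists>k\<ge>n. h (k mod CARD('m)) = i" for n i
  proof -
    obtain j where j: "j < CARD('m)" "h j = i"
      using h unfolding bij_betw_def by (metis UNIV_I atLeastLessThan_iff imageE)
    then show ?thesis by (intro exI[of _ "n * CARD('m) + j"]) (auto intro: trans_le_add1)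
  qed
  then show ?thesis by (intro exI[of _ "\<lambda>k. h (k mod CARD('m))"]) blast
qed

lemma cantor_product_exists:
  fixes \<psi> :: "'m::finite \<Rightarrow> nat \<Rightarrow> real"
  assumes approx: "\<And>i. approx_fun (\<psi> i) (\<beta> i)" and eps: "0 < \<epsilon>" "0 \<le> t" "t \<le> 1 - \<epsilon>"
    and freq: "\<And>i B. \<exists>\<^sub>F Q in sequentially. B \<le> (real Q)\<^sup>2 * \<psi> i Q powr t"
  shows "\<exists>c S \<sigma> \<delta>. cantor_product \<psi> \<beta> c S \<sigma> \<delta> \<epsilon> t"
proof -
  obtain c :: "nat \<Rightarrow> 'm" where c: "\<And>n i. \<exists>k\<ge>n. c k = i" using recurrent_enumeration by metis
  have "\<exists>T0. \<forall>T\<ge>T0. approx_fun.safe (\<psi> i) T" for i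
    using approx_fun.eventually_safe[OF approx] by (simp add: eventually_at_top_linorder)
  then obtain T0 where T0: "\<And>i T. T0 i \<le> T \<Longrightarrow> approx_fun.safe (\<psi> i) T" by metis
  \<comment> \<open>This becomes \<open>\<delta> n\<close>. It depends on the cells reached so far
    and bounds \<open>\<sigma> n\<close> in the next refinement, which separates the exceptional
    ranges; the power \<open>1 / \<epsilon>\<close> yields
    \<open>\<delta> n powr \<epsilon> \<le> kappa (S n i)\<close>.\<close>
  define scale where "scale n S = Min (insert (1 / (real n + 1))
     (range (\<lambda>i. min (min_len (S i)) (kappa (S i) powr (1 / \<epsilon>)))))" for n and S :: "'m \<Rightarrow> cell set"
  have scale: "0 < scale n S" "scale n S \<le> 1 / (real n + 1)" "scale n S \<le> min_len (S i)"
      "scale n S powr \<epsilon> \<le> kappa (S i)" if S: "\<And>i. config (S i)" for n S i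
  proof -
    show pos: "0 < scale n S"
      unfolding scale_def using min_len_pos[OF S] kappa_pos[OF S, THEN less_imp_neq] by auto
    show "scale n S \<le> 1 / (real n + 1)" unfolding scale_def by (intro Min_le) auto
    have le: "scale n S \<le> min (min_len (S i)) (kappa (S i) powr (1 / \<epsilon>))"
      unfolding scale_def by (intro Min_le) auto
    then show "scale n S \<le> min_len (S i)" by simp
    have "scale n S powr \<epsilon> \<le> (kappa (S i) powr (1 / \<epsilon>)) powr \<epsilon>"
      using le pos eps by (intro powr_mono2) auto
    also have "\<dots> = kappa (S i)" using eps kappa_pos[OF S, of i] by (simp add: powr_powr)
    finally show "scale n S powr \<epsilon> \<le> kappa (S i)" .
  qed
  \<comment> \<open>A closed interval of length \<open>1/2\<close> stays inside
    \<open>{0..<1}\<close>, and a threshold of at least 3 gives \<open>9 / 2 \<ge> 4\<close> for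
    \<open>admissible\<close>.\<close>
  define init where "init i = {Cell 0 (1/2) (max (T0 i) 3)}" for i
  have init: "admissible (T0 i) (init i)" for i
  proof -
    have "3\<^sup>2 \<le> (max (T0 i) 3)\<^sup>2" by (intro power_mono) auto
    then show ?thesis unfolding init_def admissible_def config_def by auto
  qed
  \<comment> \<open>Dependent choice retains only the invariant, so \<open>P\<close> also records
    that stage 0 is \<open>init\<close>.\<close>
  define P where "P n S \<longleftrightarrow> (\<forall>i. admissible (T0 i) (S i)) \<and> (n = 0 \<longrightarrow> S = init)" for n :: nat and S
  define R where "R n S S' \<longleftrightarrow> (\<exists>\<sigma>. approx_fun.refinement (\<psi> (c n)) (1 / (real n + 2)) (scale n S) t (S (c n)) (S' (c n)) \<sigma>)
     \<and> (\<forall>i. i \<noteq> c n \<longrightarrow> S' i = S i)" for n S S'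
  have "\<exists>S. \<forall>n. P n (S n) \<and> R n (S n) (S (Suc n))"
  proof (rule dependent_nat_choice)
    show "\<exists>S. P 0 S" using init by (auto simp: P_def)
    show "\<exists>S'. P (Suc n) S' \<and> R n S S'" if "P n S" for S n
    proof -
      interpret approx_fun "\<psi> (c n)" "\<beta> (c n)" by (rule approx)
      have adm: "admissible (T0 i) (S i)" for i using that by (auto simp: P_def)
      have "0 < scale n S" using scale adm by (auto simp: admissible_def)
      then obtain S1 \<sigma> where S1: "admissible (T0 (c n)) S1"
        "refinement (1 / (real n + 2)) (scale n S) t (S (c n)) S1 \<sigma>"
        using refinement_step[of "T0 (c n)" "S (c n)" "1 / (real n + 2)" "scale n S" t] T0 adm freq eps by auto
      then show ?thesis using adm
        by (intro exI[of _ "S(c n := S1)"]) (auto simp: P_def R_def)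
    qed
  qed
  then obtain S where S: "\<And>n. P n (S n)" "\<And>n. R n (S n) (S (Suc n))" by blast
  then obtain \<sigma> where \<sigma>: "\<And>n. approx_fun.refinement (\<psi> (c n)) (1 / (real n + 2)) (scale n (S n)) t (S n (c n)) (S (Suc n) (c n)) (\<sigma> n)"
    unfolding R_def by metis
  have cfg: "config (S n i)" for n i using S(1) unfolding P_def admissible_def by blast
  have "cantor_product \<psi> \<beta> c S \<sigma> (\<lambda>n. scale n (S n)) \<epsilon> t"
  proof (rule cantor_product.intro)
    show "interval w \<subseteq> {0..<1}" if "w \<in> S 0 i" for i w
      using that S(1)[of 0] unfolding P_def init_def interval_def by auto
    show "S (Suc n) i = S n i" if "i \<noteq> c n" for n i using S(2)[of n] that unfolding R_def by blast
  qed (fact approx c eps cfg \<sigma> scale[of "S n" for n, OF cfg])+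
  then show ?thesis by blast
qed

section \<open>Lower bounds from finite subcovers\<close>

lemma sum_half_powers_le: "finite I \<Longrightarrow> (\<Sum>n\<in>I. (1/2) ^ Suc n) \<le> (1::real)"
  using sum_le_suminf[OF sums_summable[OF power_half_series], of I] sums_unique[OF power_half_series] by auto

text \<open>A cover with small \<open>s\<close>-sum is replaced by balls of radius about twice the
  diameters; a finite subfamily would then have sum below 1. Since radii are at most 1,
  \<open>r powr e \<le> r powr s\<close>.\<close>

lemma hausdorff_measure_nonzero:
  fixes A :: "'a::metric_space set"
  assumes s: "0 \<le> s" "s \<le> e" and r0: "0 < r0" "r0 \<le> 1"
    and subcover: "\<And>\<F> :: ('a \<times> real) set. (\<And>x r. (x, r) \<in> \<F> \<Longrightarrow> 0 < r \<and> r \<le> r0) \<Longrightarrow>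
       A \<subseteq> (\<Union>(x, r)\<in>\<F>. ball x r) \<Longrightarrow> \<exists>\<F>'. finite \<F>' \<and> \<F>' \<subseteq> \<F> \<and> 1 \<le> (\<Sum>(x, r)\<in>\<F>'. r powr e)"
  shows "hausdorff_measure s A \<noteq> 0"
proof
  assume zero: "hausdorff_measure s A = 0"
  \<comment> \<open>\<open>(2 powr s + 1) * \<eta> \<le> 1/2\<close> gives the contradiction, and
    \<open>\<eta> \<le> r0 powr s\<close> keeps \<open>\<epsilon> n \<le> r0\<close>.\<close>
  define \<eta> where "\<eta> = min (1 / (2 * (2 powr s + 1))) (r0 powr s)"
  have eta: "0 < \<eta>" "\<eta> \<le> 1 / (2 * (2 powr s + 1))" "\<eta> \<le> r0 powr s"
    unfolding \<eta>_def using r0 by (auto intro!: divide_pos_pos add_pos_pos)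
  have "(INF U\<in>delta_covers (r0 / 2) A. (\<Sum>n. diam_pow s (U n))) \<le> hausdorff_measure s A"
    unfolding hausdorff_measure_def using r0 by (intro SUP_upper) auto
  then have "(INF U\<in>delta_covers (r0 / 2) A. (\<Sum>n. diam_pow s (U n))) < ennreal \<eta>"
    using zero eta by simp
  then obtain U where "U \<in> delta_covers (r0 / 2) A" and lt: "(\<Sum>n. diam_pow s (U n)) < ennreal \<eta>"
    unfolding INF_less_iff by blast
  then have U: "A \<subseteq> (\<Union>n. U n)" "\<And>n. bounded (U n)" "\<And>n. diameter (U n) \<le> r0 / 2"
    unfolding delta_covers_def by auto
  show False
  proof (cases "s = 0")
    case True
    \<comment> \<open>For \<open>s = 0\<close> each nonempty set costs 1, so a sum this small leaves
      no nonempty set, and the empty family contradicts \<open>subcover\<close>.\<close>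
    have "U n = {}" for n
    proof (rule ccontr)
      assume "U n \<noteq> {}"
      then have "1 = diam_pow s (U n)" unfolding diam_pow_def True by simp
      also have "\<dots> \<le> (\<Sum>n. diam_pow s (U n))"
        using sum_le_suminf[OF summableI, of "{n}" "\<lambda>n. diam_pow s (U n)"] by simp
      finally have "1 < ennreal \<eta>" using lt by (rule order_le_less_trans)
      moreover have "\<eta> \<le> 1" using eta(2) by (simp add: True)
      then have "ennreal \<eta> \<le> 1" using ennreal_leI[of \<eta> 1] by simp
      ultimately show False by simp
    qed
    then have "A = {}" using U by auto
    then obtain \<F>' :: "('a \<times> real) set" where "\<F>' \<subseteq> {}" "1 \<le> (\<Sum>(x, r)\<in>\<F>'. r powr e)"
      using subcover[of "{}"] by blast
    then show False by simp
  next
    case False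
    then have s0: "0 < s" using s by simp
    \<comment> \<open>Sets of diameter 0 need balls of positive radius; these minimal radii cost at
      most \<open>\<eta>\<close> in total.\<close>
    define \<epsilon> where "\<epsilon> n = (\<eta> * (1/2) ^ Suc n) powr (1 / s)" for n
    have eps: "0 < \<epsilon> n" "\<epsilon> n powr s = \<eta> * (1/2) ^ Suc n" "\<epsilon> n \<le> r0" for n
    proof -
      show "0 < \<epsilon> n" unfolding \<epsilon>_def using eta by simp
      show eq: "\<epsilon> n powr s = \<eta> * (1/2) ^ Suc n" unfolding \<epsilon>_def using eta s0 by (simp add: powr_powr)
      have "\<eta> * (1/2) ^ Suc n \<le> \<eta> * 1" using eta by (intro mult_left_mono power_le_one) auto
      then have "\<epsilon> n powr s \<le> r0 powr s" unfolding eq using eta(3) by linarith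
      then show "\<epsilon> n \<le> r0" using s0 r0 powr_less_mono2[of s r0 "\<epsilon> n"] by force
    qed
    define r where "r n = max (2 * diameter (U n)) (\<epsilon> n)" for n
    have r: "0 < r n" "r n \<le> r0" for n unfolding r_def using eps(1,3)[of n] U(3)[of n] by auto
    define I where "I = {n. U n \<noteq> {}}"
    define x where "x n = (SOME y. y \<in> U n)" for n
    have x: "x n \<in> U n" if "n \<in> I" for n using that unfolding I_def x_def by (simp add: some_in_eq)
    have "A \<subseteq> (\<Union>(x, r)\<in>(\<lambda>n. (x n, r n)) ` I. ball x r)"
    proof
      fix y assume "y \<in> A"
      then obtain n where n: "y \<in> U n" using U by blast
      then have nI: "n \<in> I" unfolding I_def by blast
      have "dist (x n) y \<le> diameter (U n)" using diameter_bounded_bound[OF U(2) x[OF nI] n] .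
      also have "\<dots> < r n" using eps(1)[of n] diameter_ge_0[OF U(2)[of n]] unfolding r_def by linarith
      finally have "y \<in> ball (x n) (r n)" by simp
      then show "y \<in> (\<Union>(x, r)\<in>(\<lambda>n. (x n, r n)) ` I. ball x r)" using nI by blast
    qed
    with subcover[of "(\<lambda>n. (x n, r n)) ` I"] r obtain \<F>' where
      F: "finite \<F>'" "\<F>' \<subseteq> (\<lambda>n. (x n, r n)) ` I" "1 \<le> (\<Sum>(x, r)\<in>\<F>'. r powr e)" by (smt (verit) imageE prod.inject)
    obtain J where J: "J \<subseteq> I" "finite J" "\<F>' = (\<lambda>n. (x n, r n)) ` J" using finite_subset_image[OF F(1,2)] by blast
    have "1 \<le> (\<Sum>b\<in>(\<lambda>n. (x n, r n)) ` J. snd b powr e)" using F(3) unfolding J(3) by (simp add: case_prod_beta')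
    also have "\<dots> \<le> (\<Sum>n\<in>J. r n powr e)"
      using sum_image_le[OF J(2), of "\<lambda>b. snd b powr e" "\<lambda>n. (x n, r n)"] by simp
    also have "\<dots> \<le> (\<Sum>n\<in>J. 2 powr s * diameter (U n) powr s + \<epsilon> n powr s)"
    proof (intro sum_mono)
      fix n
      have "r n powr e \<le> r n powr s" using r[of n] r0 s by (intro powr_mono') auto
      also have "\<dots> \<le> (2 * diameter (U n)) powr s + \<epsilon> n powr s" unfolding r_def by (simp add: max_def)
      finally show "r n powr e \<le> 2 powr s * diameter (U n) powr s + \<epsilon> n powr s"
        using diameter_ge_0[OF U(2)[of n]] by (simp add: powr_mult)
    qed
    also have "\<dots> = 2 powr s * (\<Sum>n\<in>J. diameter (U n) powr s) + \<eta> * (\<Sum>n\<in>J. (1/2) ^ Suc n)"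
      unfolding eps(2) sum.distrib sum_distrib_left ..
    also have "\<dots> \<le> 2 powr s * \<eta> + \<eta> * 1"
    proof (intro add_mono mult_left_mono sum_half_powers_le J)
      have "ennreal (\<Sum>n\<in>J. diameter (U n) powr s) = (\<Sum>n\<in>J. ennreal (diameter (U n) powr s))"
        by (subst sum_ennreal) auto
      also have "\<dots> = (\<Sum>n\<in>J. diam_pow s (U n))"
        using J(1) False unfolding I_def diam_pow_def by (intro sum.cong) auto
      also have "\<dots> \<le> (\<Sum>n. diam_pow s (U n))" using J by (intro sum_le_suminf summableI) auto
      finally show "(\<Sum>n\<in>J. diameter (U n) powr s) \<le> \<eta>"
        using lt eta by (metis ennreal_le_iff less_imp_le order_le_less_trans)
    qed (use eta in auto)
    also have "\<dots> = (2 powr s + 1) * \<eta>" by (simp add: algebra_simps)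
    also have "\<dots> \<le> (2 powr s + 1) * (1 / (2 * (2 powr s + 1)))" using eta by (intro mult_left_mono) auto
    also have "\<dots> = 1/2" by (simp add: field_simps add_nonneg_eq_0_iff)
    finally show False by simp
  qed
qed

text \<open>The packing sums bound the number of disjoint balls of radius \<open>r\<close>, so a
  packing with the most balls exists, and a point at distance at least \<open>3 * r\<close> from all
  its centres could be added. With 3 in place of 2 the covering balls can be open although the
  packing balls are closed.\<close>

lemma maximal_separated_set:
  fixes B :: "'a::metric_space set"
  assumes r: "0 < r" "r \<le> \<delta>" and s: "0 \<le> s"
    and bound: "(SUP F\<in>delta_packings \<delta> B. (\<Sum>\<^sub>\<infinity>(x, r)\<in>F. ennreal ((2 * r) powr s))) < C" "C < \<infinity>"
  obtains X where "finite X" "B \<subseteq> (\<Union>x\<in>X. ball x (3 * r))" "ennreal (real (card X) * (2 * r) powr s) \<le> C"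
proof -
  define pack where "pack X \<longleftrightarrow> finite X \<and> X \<subseteq> B \<and> disjoint_family_on (\<lambda>x. cball x r) X" for X
  have card_le: "ennreal (real (card X) * (2 * r) powr s) \<le> C" if X: "pack X" for X
  proof -
    have inj: "inj_on (\<lambda>x. (x, r)) X" by (auto intro: inj_onI)
    have "(\<lambda>x. (x, r)) ` X \<in> delta_packings \<delta> B"
      using X r unfolding pack_def delta_packings_def disjoint_family_on_def by auto
    then have "(\<Sum>\<^sub>\<infinity>(x, r)\<in>(\<lambda>x. (x, r)) ` X. ennreal ((2 * r) powr s)) \<le> C"
      using bound(1) by (meson SUP_upper less_imp_le order_trans)
    also have "(\<Sum>\<^sub>\<infinity>(x, r)\<in>(\<lambda>x. (x, r)) ` X. ennreal ((2 * r) powr s)) = (\<Sum>x\<in>X. ennreal ((2 * r) powr s))"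
      using X inj unfolding pack_def by (simp add: sum.reindex)
    also have "\<dots> = ennreal (real (card X) * (2 * r) powr s)"
      by (simp add: ennreal_mult ennreal_of_nat_eq_real_of_nat)
    finally show ?thesis .
  qed
  have p: "0 < (2 * r) powr s" using r by simp
  obtain K where K: "C = ennreal K" "0 \<le> K" using bound(2) by (cases C) auto
  have cardb: "card X \<le> nat \<lceil>K / (2 * r) powr s\<rceil>" if "pack X" for X
  proof -
    have "real (card X) * (2 * r) powr s \<le> K" using card_le[OF that] K by simp
    then have "real (card X) \<le> K / (2 * r) powr s" using p by (simp add: le_divide_eq)
    then show ?thesis by linarith
  qed
  have "pack {}" unfolding pack_def disjoint_family_on_def by simp
  then obtain X where X: "pack X" and max: "\<And>Y. pack Y \<Longrightarrow> card Y \<le> card X"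
    using ex_has_greatest_nat[of pack "{}" card "nat \<lceil>K / (2 * r) powr s\<rceil> + 1"] cardb by fastforce
  have "B \<subseteq> (\<Union>x\<in>X. ball x (3 * r))"
  proof (rule ccontr)
    assume "\<not> B \<subseteq> (\<Union>x\<in>X. ball x (3 * r))"
    then obtain y where y: "y \<in> B" "\<And>x. x \<in> X \<Longrightarrow> 3 * r \<le> dist x y" by fastforce
    have far: "cball y r \<inter> cball x r = {}" if "x \<in> X" for x
    proof (rule ccontr)
      assume "cball y r \<inter> cball x r \<noteq> {}"
      then obtain z where "dist y z \<le> r" "dist x z \<le> r" by auto
      then have "dist x y \<le> 2 * r" using dist_triangle3[of x y z] by (simp add: dist_commute)
      then show False using y(2)[OF that] r by simp
    qed
    have "y \<notin> X" using y(2)[of y] r by auto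
    moreover have "pack (insert y X)"
      using X y(1) far unfolding pack_def disjoint_family_on_def by (auto simp: Int_commute)
    ultimately show False using max[of "insert y X"] X unfolding pack_def by simp
  qed
  then show thesis using that card_le[OF X] X unfolding pack_def by blast
qed

text \<open>Each piece \<open>B n\<close> is covered by balls of one common radius, which may be any
  small number and is therefore taken from \<open>G\<close>. So estimates along a sequence of scales
  suffice, whereas the Hausdorff bound asks for all small scales.\<close>

lemma packing_measure_nonzero:
  fixes A :: "'a::metric_space set"
  assumes s: "0 \<le> s" "s \<le> e"
    and G: "\<And>g. g \<in> G \<Longrightarrow> 0 < g \<and> g \<le> 1" "\<And>\<delta>. 0 < \<delta> \<Longrightarrow> \<exists>g\<in>G. g < \<delta>"
    and subcover: "\<And>\<F> :: ('a \<times> real) set. (\<And>x r. (x, r) \<in> \<F> \<Longrightarrow> r \<in> G) \<Longrightarrow>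
       A \<subseteq> (\<Union>(x, r)\<in>\<F>. ball x r) \<Longrightarrow> \<exists>\<F>'. finite \<F>' \<and> \<F>' \<subseteq> \<F> \<and> 1 \<le> (\<Sum>(x, r)\<in>\<F>'. r powr e)"
  shows "packing_measure s A \<noteq> 0"
proof
  assume zero: "packing_measure s A = 0"
  \<comment> \<open>The final bound is \<open>(3/2) powr s * (2 * \<eta>) = 1/2\<close>, where
    \<open>3/2\<close> compares the covering radius \<open>g\<close> with the packing diameter
    \<open>2/3 * g\<close>.\<close>
  define \<eta> where "\<eta> = 1 / (4 * (3/2) powr s)"
  have eta: "0 < \<eta>" unfolding \<eta>_def by simp
  have "packing_measure s A < ennreal \<eta>" using zero eta by simp
  then obtain B where B: "A \<subseteq> (\<Union>n. B n)" "(\<Sum>n. packing_premeasure s (B n)) < ennreal \<eta>"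
    unfolding packing_measure_def INF_less_iff by blast
  \<comment> \<open>The summable excess makes \<open>C n\<close> strictly larger than the
    premeasure, so some \<open>\<delta>\<close> already has packing sums below
    \<open>C n\<close>.\<close>
  define C where "C n = packing_premeasure s (B n) + ennreal (\<eta> * (1/2) ^ Suc n)" for n
  have prefin: "packing_premeasure s (B n) < \<infinity>" for n
  proof -
    have "packing_premeasure s (B n) \<le> (\<Sum>n. packing_premeasure s (B n))"
      using sum_le_suminf[OF summableI, of "{n}" "\<lambda>n. packing_premeasure s (B n)"] by simp
    then show ?thesis using B(2) by (metis ennreal_less_top infinity_ennreal_def order.strict_trans order_le_less_trans)
  qed
  have "\<exists>X g. g \<in> G \<and> finite X \<and> B n \<subseteq> (\<Union>x\<in>X. ball x g) \<and> ennreal (real (card X) * (2/3 * g) powr s) \<le> C n" for n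
  proof -
    have "packing_premeasure s (B n) < C n"
      unfolding C_def using prefin[of n] eta by (simp add: ennreal_add_left_cancel_less[of _ 0, simplified])
    then obtain \<delta> where d: "0 < \<delta>" "(SUP F\<in>delta_packings \<delta> (B n). (\<Sum>\<^sub>\<infinity>(x, r)\<in>F. ennreal ((2 * r) powr s))) < C n"
      unfolding packing_premeasure_def INF_less_iff by auto
    obtain g where g: "g \<in> G" "g < \<delta>" using G(2)[OF d(1)] by blast
    have "C n < \<infinity>" unfolding C_def using prefin[of n] by simp
    moreover have "0 < g / 3" "g / 3 \<le> \<delta>" using G(1)[OF g(1)] g by auto
    ultimately obtain X where "finite X" "B n \<subseteq> (\<Union>x\<in>X. ball x (3 * (g/3)))" "ennreal (real (card X) * (2 * (g/3)) powr s) \<le> C n"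
      using maximal_separated_set[of "g/3" \<delta> s "B n" "C n"] d(2) s by metis
    then show ?thesis using g by (intro exI[of _ X] exI[of _ g]) (auto simp: mult.commute)
  qed
  then obtain X g where X: "\<And>n. g n \<in> G" "\<And>n. finite (X n)" "\<And>n. B n \<subseteq> (\<Union>x\<in>X n. ball x (g n))"
    "\<And>n. ennreal (real (card (X n)) * (2/3 * g n) powr s) \<le> C n" by metis
  have "A \<subseteq> (\<Union>(x, r)\<in>(\<Union>n. X n \<times> {g n}). ball x r)"
  proof
    fix y assume "y \<in> A"
    then obtain n x where "x \<in> X n" "y \<in> ball x (g n)" using B(1) X(3) by blast
    then show "y \<in> (\<Union>(x, r)\<in>(\<Union>n. X n \<times> {g n}). ball x r)" by (intro UN_I[of "(x, g n)"]) auto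
  qed
  then obtain \<F>' where F: "finite \<F>'" "\<F>' \<subseteq> (\<Union>n. X n \<times> {g n})" "1 \<le> (\<Sum>(x, r)\<in>\<F>'. r powr e)"
    using subcover[of "\<Union>n. X n \<times> {g n}"] X(1) by blast
  obtain J where J: "finite J" "\<F>' \<subseteq> (\<Union>n\<in>J. X n \<times> {g n})"
  proof -
    have "\<forall>b\<in>\<F>'. \<exists>n. b \<in> X n \<times> {g n}" using F(2) by blast
    then obtain m where "\<forall>b\<in>\<F>'. b \<in> X (m b) \<times> {g (m b)}" by metis
    then show thesis using F(1) by (intro that[of "m ` \<F>'"]) auto
  qed
  have "1 \<le> (\<Sum>b\<in>\<F>'. snd b powr e)" using F(3) by (simp add: case_prod_beta')
  also have "\<dots> \<le> (\<Sum>b\<in>(\<Union>n\<in>J. X n \<times> {g n}). snd b powr e)"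
    using J X(2) by (intro sum_mono2) auto
  also have "(\<Union>n\<in>J. X n \<times> {g n}) = (\<lambda>(n, x). (x, g n)) ` Sigma J X" by (force simp: image_iff)
  \<comment> \<open>The same ball may come from several \<open>n\<close>, hence only an
    inequality.\<close>
  also have "(\<Sum>b\<in>(\<lambda>(n, x). (x, g n)) ` Sigma J X. snd b powr e) \<le> (\<Sum>(n, x)\<in>Sigma J X. g n powr e)"
    using sum_image_le[of "Sigma J X" "\<lambda>b. snd b powr e" "\<lambda>(n, x). (x, g n)"] J(1) X(2)
    by (simp add: case_prod_beta' o_def)
  also have "\<dots> = (\<Sum>n\<in>J. real (card (X n)) * g n powr e)"
    using J(1) X(2) by (simp add: sum.Sigma[symmetric])
  also have "\<dots> \<le> (\<Sum>n\<in>J. (3/2) powr s * (real (card (X n)) * (2/3 * g n) powr s))"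
  proof (intro sum_mono)
    fix n
    have g: "0 < g n" "g n \<le> 1" using G(1) X(1) by auto
    have "g n powr e \<le> g n powr s" using g s by (intro powr_mono') auto
    also have "g n powr s = (3/2 * (2/3 * g n)) powr s" by simp
    also have "\<dots> = (3/2) powr s * (2/3 * g n) powr s" using g by (subst powr_mult) auto
    finally have "real (card (X n)) * g n powr e \<le> real (card (X n)) * ((3/2) powr s * (2/3 * g n) powr s)"
      by (intro mult_left_mono) auto
    then show "real (card (X n)) * g n powr e \<le> (3/2) powr s * (real (card (X n)) * (2/3 * g n) powr s)"
      by (simp add: mult_ac)
  qed
  also have "\<dots> = (3/2) powr s * (\<Sum>n\<in>J. real (card (X n)) * (2/3 * g n) powr s)" by (simp add: sum_distrib_left)
  also have "\<dots> \<le> (3/2) powr s * (2 * \<eta>)"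
  proof (intro mult_left_mono)
    have "ennreal (\<Sum>n\<in>J. real (card (X n)) * (2/3 * g n) powr s) = (\<Sum>n\<in>J. ennreal (real (card (X n)) * (2/3 * g n) powr s))"
      by (subst sum_ennreal) auto
    also have "\<dots> \<le> (\<Sum>n\<in>J. C n)" using X(4) by (intro sum_mono)
    also have "\<dots> = (\<Sum>n\<in>J. packing_premeasure s (B n)) + ennreal (\<eta> * (\<Sum>n\<in>J. (1/2) ^ Suc n))"
      unfolding C_def sum.distrib sum_distrib_left using eta by (subst sum_ennreal) auto
    also have "\<dots> \<le> ennreal \<eta> + ennreal (\<eta> * 1)"
    proof (intro add_mono ennreal_leI mult_left_mono sum_half_powers_le J)
      have "(\<Sum>n\<in>J. packing_premeasure s (B n)) \<le> (\<Sum>n. packing_premeasure s (B n))"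
        using J by (intro sum_le_suminf summableI) auto
      then show "(\<Sum>n\<in>J. packing_premeasure s (B n)) \<le> ennreal \<eta>" using B(2) by simp
    qed (use eta in auto)
    also have "\<dots> = ennreal (2 * \<eta>)" using eta by (simp flip: ennreal_plus)
    finally show "(\<Sum>n\<in>J. real (card (X n)) * (2/3 * g n) powr s) \<le> 2 * \<eta>" using eta by simp
  qed auto
  also have "\<dots> = 1/2" unfolding \<eta>_def by simp
  finally show False by simp
qed

section \<open>Upper bounds\<close>

text \<open>The Hausdorff-Cantelli lemma: for each \<open>N\<close> the families with
  \<open>q \<ge> N\<close> together cover \<open>A\<close>, at a total cost bounded by a tail of the
  convergent series \<open>b\<close>.\<close>

lemma hausdorff_measure_limsup_zero:
  fixes A :: "'a::metric_space set" and \<U> :: "nat \<Rightarrow> 'a set set"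
  assumes s: "0 < s"
    and fam: "\<forall>\<^sub>F q in sequentially. finite (\<U> q) \<and> (\<forall>U\<in>\<U> q. bounded U \<and> diameter U \<le> d q) \<and>
        real (card (\<U> q)) * d q powr s \<le> b q"
    and d: "d \<longlonglongrightarrow> 0" and b: "summable b"
    and A: "\<And>x. x \<in> A \<Longrightarrow> \<exists>\<^sub>F q in sequentially. x \<in> \<Union>(\<U> q)"
  shows "hausdorff_measure s A = 0"
proof -
  have le: "(INF U\<in>delta_covers \<delta> A. (\<Sum>n. diam_pow s (U n))) \<le> ennreal \<eta>" if "0 < \<delta>" "0 < \<eta>" for \<delta> \<eta>
  proof -
    have "\<forall>\<^sub>F q in sequentially. d q < \<delta>" using d \<open>0 < \<delta>\<close> by (rule order_tendstoD)
    with fam have "\<forall>\<^sub>F q in sequentially. finite (\<U> q) \<and> (\<forall>U\<in>\<U> q. bounded U \<and> diameter U \<le> d q) \<and>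
        real (card (\<U> q)) * d q powr s \<le> b q \<and> d q < \<delta>" by eventually_elim blast
    then obtain N1 where N1: "\<And>q. q \<ge> N1 \<Longrightarrow> finite (\<U> q) \<and> (\<forall>U\<in>\<U> q. bounded U \<and> diameter U \<le> d q) \<and>
        real (card (\<U> q)) * d q powr s \<le> b q \<and> d q < \<delta>" unfolding eventually_sequentially by blast
    obtain N2 where N2: "\<And>n. n \<ge> N2 \<Longrightarrow> norm (\<Sum>i. b (i + n)) < \<eta>"
      using suminf_exist_split[OF \<open>0 < \<eta>\<close> b] by blast
    define N where "N = max N1 N2"
    have fin: "finite (\<U> (k + N))" and bd: "\<And>U. U \<in> \<U> (k + N) \<Longrightarrow> bounded U"
      and dm: "\<And>U. U \<in> \<U> (k + N) \<Longrightarrow> diameter U \<le> d (k + N)"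
      and card: "real (card (\<U> (k + N))) * d (k + N) powr s \<le> b (k + N)" and dl: "d (k + N) < \<delta>" for k
      using N1[of "k + N"] unfolding N_def by auto
    have "\<exists>e. bij_betw e {0..<card (\<U> (k + N))} (\<U> (k + N))" for k
      using ex_bij_betw_nat_finite[OF fin] by blast
    then obtain e where e: "\<And>k. bij_betw (e k) {0..<card (\<U> (k + N))} (\<U> (k + N))" by metis
    \<comment> \<open>The tail families become one sequence indexed by pairs \<open>(k, i)\<close>,
      padded with empty sets, which cost nothing.\<close>
    define V where "V = (\<lambda>(k, i). if i < card (\<U> (k + N)) then e k i else {})"
    have eU: "e k i \<in> \<U> (k + N)" if "i < card (\<U> (k + N))" for k i
      using e[of k] that unfolding bij_betw_def by auto
    have "(\<lambda>n. V (prod_decode n)) \<in> delta_covers \<delta> A"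
    proof -
      have "x \<in> (\<Union>n. V (prod_decode n))" if x: "x \<in> A" for x
      proof -
        obtain q where q: "q \<ge> N" "x \<in> \<Union>(\<U> q)"
          using A[OF x, unfolded frequently_sequentially, rule_format, of N] by (elim exE conjE)
        then obtain U where U: "U \<in> \<U> (q - N + N)" "x \<in> U" by auto
        have "e (q - N) ` {0..<card (\<U> (q - N + N))} = \<U> (q - N + N)"
          using e by (rule bij_betw_imp_surj_on)
        then have "U \<in> e (q - N) ` {0..<card (\<U> (q - N + N))}" using U(1) by simp
        then obtain i where "i < card (\<U> (q - N + N))" "x \<in> e (q - N) i"
          using U(2) by (elim imageE) simp
        then have "x \<in> V (prod_decode (prod_encode (q - N, i)))" unfolding V_def by simp
        then show ?thesis by (rule UN_I[OF UNIV_I])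
      qed
      moreover have "bounded (V p) \<and> diameter (V p) \<le> \<delta>" for p
      proof -
        obtain k i where p: "p = (k, i)" by (cases p)
        show ?thesis
        proof (cases "i < card (\<U> (k + N))")
          case True
          then show ?thesis using bd[OF eU] dm[OF eU] dl[of k] unfolding V_def p by fastforce
        qed (use \<open>0 < \<delta>\<close> in \<open>simp add: V_def p\<close>)
      qed
      ultimately show ?thesis unfolding delta_covers_def by blast
    qed
    then have "(INF U\<in>delta_covers \<delta> A. (\<Sum>n. diam_pow s (U n))) \<le> (\<Sum>n. diam_pow s (V (prod_decode n)))"
      by (intro INF_lower)
    also have "\<dots> = (\<Sum>k. \<Sum>i. diam_pow s (V (k, i)))"
      by (rule suminf_ennreal_2dimen[of _ "\<lambda>p. diam_pow s (V p)"]) simp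
    also have "\<dots> \<le> (\<Sum>k. ennreal (b (k + N)))"
    proof (intro suminf_le summableI)
      fix k
      have "(\<Sum>i. diam_pow s (V (k, i))) = (\<Sum>i<card (\<U> (k + N)). diam_pow s (V (k, i)))"
        by (rule suminf_finite) (auto simp: V_def diam_pow_def)
      also have "\<dots> \<le> (\<Sum>i<card (\<U> (k + N)). ennreal (d (k + N) powr s))"
      proof (rule sum_mono)
        fix i assume "i \<in> {..<card (\<U> (k + N))}"
        then have V: "V (k, i) \<in> \<U> (k + N)" using eU unfolding V_def by simp
        then have "diameter (V (k, i)) powr s \<le> d (k + N) powr s"
          using dm[OF V] s diameter_ge_0[OF bd[OF V]] by (intro powr_mono2) auto
        then show "diam_pow s (V (k, i)) \<le> ennreal (d (k + N) powr s)"
          using s unfolding diam_pow_def by (simp add: ennreal_leI)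
      qed
      also have "\<dots> = ennreal (real (card (\<U> (k + N))) * d (k + N) powr s)"
        by (simp add: ennreal_mult ennreal_of_nat_eq_real_of_nat)
      also have "\<dots> \<le> ennreal (b (k + N))" using card by (rule ennreal_leI)
      finally show "(\<Sum>i. diam_pow s (V (k, i))) \<le> ennreal (b (k + N))" .
    qed
    also have "\<dots> = ennreal (\<Sum>k. b (k + N))"
    proof (rule suminf_ennreal2)
      show "0 \<le> b (k + N)" for k using card[of k] by (meson mult_nonneg_nonneg of_nat_0_le_iff order_trans powr_ge_zero)
      show "summable (\<lambda>k. b (k + N))" using b by (simp add: summable_iff_shift)
    qed
    also have "\<dots> \<le> ennreal \<eta>" using N2[of N] unfolding N_def by (intro ennreal_leI) auto
    finally show ?thesis .
  qed
  have "hausdorff_measure s A \<le> 0"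
    unfolding hausdorff_measure_def
  proof (rule SUP_least)
    fix \<delta> :: real assume "\<delta> \<in> {0<..}"
    then have "0 < \<delta>" by simp
    show "(INF U\<in>delta_covers \<delta> A. (\<Sum>n. diam_pow s (U n))) \<le> 0"
      by (rule ennreal_le_epsilon) (use le[OF \<open>0 < \<delta>\<close>] in simp)
  qed
  then show ?thesis by simp
qed

text \<open>The cover exploits approximability in coordinate \<open>j\<close> alone. At most
  \<open>4 * q * (2 / \<psi> j q) ^ (m - 1)\<close> boxes of diameter at most
  \<open>2 * m * \<psi> j q\<close> are used for \<open>q\<close>, so with exponent
  \<open>m - 1 + u\<close> their cost is a constant times
  \<open>q * \<psi> j q powr u\<close>.\<close>

lemma hausdorff_measure_exact_prod_zero:
  fixes \<psi> :: "'m::finite \<Rightarrow> nat \<Rightarrow> real"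
  assumes pos: "\<And>q. 1 \<le> q \<Longrightarrow> 0 < \<psi> j q" and lim: "\<psi> j \<longlonglongrightarrow> 0"
    and u: "0 < u" "summable (\<lambda>q. real q * \<psi> j q powr u)"
  shows "hausdorff_measure (real CARD('m) - 1 + u) (exact_prod \<psi>) = 0"
proof -
  define m where "m = CARD('m)"
  have m: "1 \<le> m" unfolding m_def by (simp add: Suc_leI)
  define s where "s = real m - 1 + u"
  define M where "M q = nat \<lceil>1 / \<psi> j q\<rceil>" for q
  define box where "box q p k = {x::real^'m. \<bar>x $ j - real_of_int p / q\<bar> \<le> \<psi> j q \<and>
     (\<forall>i. i \<noteq> j \<longrightarrow> real (k i) \<le> M q * x $ i \<and> M q * x $ i \<le> real (k i) + 1)}" for q :: nat and p :: int and k :: "'m \<Rightarrow> nat"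
  \<comment> \<open>Numerators between \<open>- q\<close> and \<open>2 * q\<close> suffice because
    the coordinate lies in \<open>{0..<1}\<close> and \<open>\<psi> j q < 1\<close>
    eventually.\<close>
  define Idx where "Idx q = {- int q..2 * int q} \<times> (\<Pi>\<^sub>E i\<in>UNIV - {j}. {..<M q})" for q
  define \<U> where "\<U> q = (\<lambda>(p, k). box q p k) ` Idx q" for q
  define C where "C = 4 * 2 ^ (m - 1) * (2 * real m) powr s"
  have small: "\<forall>\<^sub>F q in sequentially. \<psi> j q < 1 \<and> 1 \<le> q"
    using lim by (intro eventually_conj order_tendstoD(2)[OF lim] eventually_ge_at_top) auto
  have "hausdorff_measure s (exact_prod \<psi>) = 0"
  proof (rule hausdorff_measure_limsup_zero[where \<U> = \<U> and d = "\<lambda>q. 2 * real m * \<psi> j q"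
        and b = "\<lambda>q. C * (real q * \<psi> j q powr u)"])
    show "0 < s" using m u unfolding s_def by simp
    show "(\<lambda>q. 2 * real m * \<psi> j q) \<longlonglongrightarrow> 0" using tendsto_mult_right_zero[OF lim] by simp
    show "summable (\<lambda>q. C * (real q * \<psi> j q powr u))" using u(2) by (intro summable_mult)
    show "\<forall>\<^sub>F q in sequentially. finite (\<U> q) \<and> (\<forall>U\<in>\<U> q. bounded U \<and> diameter U \<le> 2 * real m * \<psi> j q) \<and>
        real (card (\<U> q)) * (2 * real m * \<psi> j q) powr s \<le> C * (real q * \<psi> j q powr u)"
      using small
    proof eventually_elim
      case (elim q)
      have p: "0 < \<psi> j q" using pos elim by blast
      have finI: "finite (Idx q)" unfolding Idx_def by (intro finite_cartesian_product finite_PiE) auto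
      have fin: "finite (\<U> q)" unfolding \<U>_def using finI by simp
      have M1: "1 / \<psi> j q \<le> M q" unfolding M_def by (rule real_nat_ceiling_ge)
      have M0: "0 < real (M q)" using M1 p by (meson divide_pos_pos less_le_trans zero_less_one)
      have M2: "real (M q) \<le> 2 / \<psi> j q"
      proof -
        have "real (M q) \<le> 1 / \<psi> j q + 1" unfolding M_def using p by (simp add: of_nat_nat)
        also have "\<dots> \<le> 2 / \<psi> j q" using elim p by (simp add: field_simps)
        finally show ?thesis .
      qed
      have iM: "1 / real (M q) \<le> \<psi> j q" using M1 M0 p by (simp add: field_simps)
      have dist: "norm (x - y) \<le> 2 * real m * \<psi> j q" if xy: "x \<in> box q r k" "y \<in> box q r k" for x y r k
      proof -
        have "\<bar>(x - y) $ i\<bar> \<le> 2 * \<psi> j q" for i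
        proof (cases "i = j")
          case True
          then show ?thesis using xy unfolding box_def by auto
        next
          case False
          then have "real (k i) \<le> M q * x $ i" "M q * x $ i \<le> real (k i) + 1"
             "real (k i) \<le> M q * y $ i" "M q * y $ i \<le> real (k i) + 1" using xy unfolding box_def by auto
          then have "\<bar>M q * (x - y) $ i\<bar> \<le> 1" by (simp add: algebra_simps)
          then have "real (M q) * \<bar>(x - y) $ i\<bar> \<le> 1" using M0 by (simp only: abs_mult abs_of_nat)
          then have "\<bar>(x - y) $ i\<bar> \<le> 1 / M q" using M0 by (simp add: le_divide_eq mult.commute)
          then show ?thesis using iM p by linarith
        qed
        then have "(\<Sum>i\<in>UNIV. \<bar>(x - y) $ i\<bar>) \<le> (\<Sum>i\<in>(UNIV::'m set). 2 * \<psi> j q)" by (intro sum_mono)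
        then show ?thesis using norm_le_l1_cart[of "x - y"] unfolding m_def by simp
      qed
      have bd: "bounded U \<and> diameter U \<le> 2 * real m * \<psi> j q" if U: "U \<in> \<U> q" for U
      proof -
        obtain r k where Ueq: "U = box q r k" using U unfolding \<U>_def by auto
        have "bounded U"
        proof (cases "U = {}")
          case False
          then obtain x where "x \<in> U" by blast
          then have "\<forall>y\<in>U. dist x y \<le> 2 * real m * \<psi> j q" using dist Ueq by (simp add: dist_norm)
          then show ?thesis unfolding bounded_def by blast
        qed simp
        then show ?thesis using dist Ueq p by (auto intro!: diameter_le)
      qed
      have "card (\<U> q) \<le> card (Idx q)" unfolding \<U>_def using finI by (rule card_image_le)
      also have "\<dots> = nat (3 * int q + 1) * M q ^ (m - 1)"
        unfolding Idx_def m_def by (simp add: card_cartesian_product card_PiE algebra_simps)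
      finally have "real (card (\<U> q)) \<le> real (nat (3 * int q + 1) * M q ^ (m - 1))" by (rule of_nat_mono)
      also have "\<dots> = real (nat (3 * int q + 1)) * real (M q) ^ (m - 1)" by simp
      also have "\<dots> \<le> (4 * real q) * (2 / \<psi> j q) ^ (m - 1)"
        using elim M2 p by (intro mult_mono power_mono) auto
      finally have "real (card (\<U> q)) * (2 * real m * \<psi> j q) powr s
        \<le> (4 * real q) * (2 / \<psi> j q) ^ (m - 1) * (2 * real m * \<psi> j q) powr s" by (intro mult_right_mono) auto
      also have "\<dots> = C * (real q * (\<psi> j q powr s / \<psi> j q ^ (m - 1)))"
        unfolding C_def using p by (simp add: powr_mult power_divide)
      also have "\<psi> j q powr s / \<psi> j q ^ (m - 1) = \<psi> j q powr u"
        using p m by (simp add: s_def powr_realpow[symmetric] powr_diff[symmetric] of_nat_diff)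
      finally show ?case using fin bd by blast
    qed
    fix x assume x: "x \<in> exact_prod \<psi>"
    then have xi: "x $ i \<in> {0..<1}" for i unfolding exact_prod_def exact_set_def approx_set_def by auto
    have inf: "infinite {(p :: int, q :: nat). q \<ge> 1 \<and> \<bar>x $ j - of_int p / of_nat q\<bar> < \<psi> j q}" (is "infinite ?A")
      using x unfolding exact_prod_def exact_set_def approx_set_def by blast
    show "\<exists>\<^sub>F q in sequentially. x \<in> \<Union>(\<U> q)"
      unfolding frequently_sequentially
    proof
      fix N
      obtain N1 where N1: "\<And>q. q \<ge> N1 \<Longrightarrow> \<psi> j q < 1 \<and> 1 \<le> q" using small unfolding eventually_sequentially by blast
      \<comment> \<open>Each \<open>q\<close> admits finitely many \<open>p\<close>, so infinitely
        many pairs force unbounded denominators.\<close>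
      have "\<exists>p q. (p, q) \<in> ?A \<and> max N N1 \<le> q"
      proof (rule ccontr)
        assume no: "\<not> (\<exists>p q. (p, q) \<in> ?A \<and> max N N1 \<le> q)"
        define D where "D q = {p::int. \<bar>x $ j - p / real q\<bar> < \<psi> j q}" for q
        have fD: "finite (D q)" if "1 \<le> q" for q
        proof -
          have "D q \<subseteq> {\<lfloor>q * (x $ j - \<psi> j q)\<rfloor>..\<lceil>q * (x $ j + \<psi> j q)\<rceil>}"
          proof
            fix p assume "p \<in> D q"
            then have "x $ j - \<psi> j q < p / real q" "p / real q < x $ j + \<psi> j q" unfolding D_def by auto
            then have "q * (x $ j - \<psi> j q) < p" "p < q * (x $ j + \<psi> j q)"
              using that by (auto simp: field_simps)
            then show "p \<in> {\<lfloor>q * (x $ j - \<psi> j q)\<rfloor>..\<lceil>q * (x $ j + \<psi> j q)\<rceil>}" by (auto simp: floor_le_iff le_ceiling_iff)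
          qed
          then show ?thesis by (rule finite_subset) simp
        qed
        have "?A \<subseteq> (\<Union>q\<in>{1..max N N1}. D q \<times> {q})"
        proof
          fix a assume a: "a \<in> ?A"
          obtain p q where pq: "a = (p, q)" by (cases a)
          have "q < max N N1" using no a pq by (meson not_le)
          then show "a \<in> (\<Union>q\<in>{1..max N N1}. D q \<times> {q})" using a pq unfolding D_def by auto
        qed
        then show False using inf fD by (meson atLeastAtMost_iff finite_SigmaI finite_UN_I finite_atLeastAtMost
          finite_cartesian_product finite.emptyI finite_insert finite_subset)
      qed
      then obtain p q where pq: "(p, q) \<in> ?A" "max N N1 \<le> q" by blast
      have q: "\<psi> j q < 1" "1 \<le> q" "\<bar>x $ j - p / real q\<bar> < \<psi> j q" using N1[of q] pq by auto
      have p0: "0 < \<psi> j q" using pos q by blast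
      have "\<bar>p / real q - x $ j\<bar> < 1" using q by linarith
      then have "-1 < p / real q" "p / real q < 2" using xi[of j] by auto
      then have "- real q < p" "p < 2 * real q" using q(2) by (auto simp: field_simps)
      then have "- int q \<le> p" "p \<le> 2 * int q" by linarith+
      moreover have M0: "0 < M q" unfolding M_def using p0 by simp
      define k where "k = (\<lambda>i\<in>UNIV - {j}. nat \<lfloor>M q * x $ i\<rfloor>)"
      have "k \<in> (\<Pi>\<^sub>E i\<in>UNIV - {j}. {..<M q})"
      proof -
        have "nat \<lfloor>M q * x $ i\<rfloor> < M q" for i
        proof -
          have "real (M q) * x $ i < real (M q) * 1" using xi[of i] M0 by (intro mult_strict_left_mono) auto
          then show ?thesis using xi[of i] by (simp add: nat_less_iff floor_less_iff)
        qed
        then show ?thesis unfolding k_def by auto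
      qed
      ultimately have "(p, k) \<in> Idx q" unfolding Idx_def by auto
      moreover have "x \<in> box q p k"
        using q(3) xi unfolding box_def k_def by (auto simp: of_nat_nat)
      ultimately have "x \<in> \<Union>(\<U> q)" unfolding \<U>_def by force
      then show "\<exists>n\<ge>N. x \<in> \<Union>(\<U> n)" using pq by auto
    qed
  qed
  then show ?thesis unfolding s_def m_def .
qed

section \<open>Packing measure of bounded sets\<close>

lemma packing_premeasure_empty: "packing_premeasure s {} = 0"
proof -
  have "packing_premeasure s ({}::'a set) \<le> (SUP F\<in>delta_packings 1 ({}::'a set). (\<Sum>\<^sub>\<infinity>(x, r)\<in>F. ennreal ((2 * r) powr s)))"
    unfolding packing_premeasure_def by (intro INF_lower) auto
  also have "\<dots> \<le> 0" by (intro SUP_least) (auto simp: delta_packings_def)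
  finally show ?thesis by simp
qed

text \<open>Disjoint balls with centres in \<open>A\<close> and radii at most 1 fit into one large
  ball, so volumes bound the sum of \<open>r ^ n\<close>; the remaining factor
  \<open>(2 * \<delta>) powr (s - n)\<close> tends to 0. The premeasure already vanishes, so
  \<open>A\<close> itself serves as its cover.\<close>

lemma packing_measure_zero:
  fixes A :: "'a::euclidean_space set"
  assumes A: "bounded A" and s: "real DIM('a) < s"
  shows "packing_measure s A = 0"
proof -
  define n where "n = DIM('a)"
  obtain R where R: "0 < R" "\<And>x. x \<in> A \<Longrightarrow> norm x \<le> R" using A unfolding bounded_pos by blast
  define K where "K = 2 ^ n * (R + 1) ^ n"
  have K: "0 \<le> K" unfolding K_def using R by simp
  have bound: "packing_premeasure s A \<le> ennreal (K * (2 * \<delta>) powr (s - n))" if d: "0 < \<delta>" "\<delta> \<le> 1" for \<delta>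
  proof -
    have "(\<Sum>\<^sub>\<infinity>(x, r)\<in>F. ennreal ((2 * r) powr s)) \<le> ennreal (K * (2 * \<delta>) powr (s - n))"
      if F: "F \<in> delta_packings \<delta> A" for F
    proof -
      have FA: "F \<subseteq> A \<times> {0<..\<delta>}" "disjoint_family_on (\<lambda>(x, r). cball x r) F"
        using F unfolding delta_packings_def by auto
      have fin: "(\<Sum>(x, r)\<in>F'. ennreal ((2 * r) powr s)) \<le> ennreal (K * (2 * \<delta>) powr (s - n))"
        if F': "finite F'" "F' \<subseteq> F" for F'
      proof -
        have r: "0 < r" "r \<le> \<delta>" "x \<in> A" if "(x, r) \<in> F'" for x r using that F'(2) FA(1) by auto
        define v where "v = unit_ball_vol (real n)"
        have v: "0 < v" unfolding v_def by simp
        have ballvol: "emeasure lborel (cball x r) = ennreal (v * r ^ n)" if "0 \<le> r" for x :: 'a and r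
          using emeasure_cball[OF that, of x] unfolding v_def n_def by simp
        have "ennreal (\<Sum>(x, r)\<in>F'. v * r ^ n) = (\<Sum>(x, r)\<in>F'. emeasure lborel (cball x r))"
          using r v by (subst sum_ennreal[symmetric]) (auto intro!: sum.cong simp: ballvol less_imp_le)
        also have "\<dots> = (\<Sum>b\<in>F'. emeasure lborel (case b of (x, r) \<Rightarrow> cball x r))"
          by (simp add: case_prod_beta')
        also have "\<dots> = emeasure lborel (\<Union>b\<in>F'. case b of (x, r) \<Rightarrow> cball x r)"
          using F' FA(2) by (intro sum_emeasure disjoint_family_on_mono[OF F'(2)]) (auto split: prod.splits)
        also have "\<dots> \<le> emeasure lborel (cball (0::'a) (R + 1))"
        proof (rule emeasure_mono)
          show "(\<Union>b\<in>F'. case b of (x, r) \<Rightarrow> cball x r) \<subseteq> cball (0::'a) (R + 1)"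
          proof safe
            fix x r y assume xr: "(x, r) \<in> F'" and y: "y \<in> cball x r"
            have "norm y \<le> norm x + dist x y" using norm_triangle_sub[of y x] by (simp add: dist_norm norm_minus_commute)
            also have "\<dots> \<le> R + 1" using r[OF xr] R(2)[of x] y d by simp
            finally show "y \<in> cball 0 (R + 1)" by simp
          qed
        qed simp
        also have "\<dots> = ennreal (v * (R + 1) ^ n)" using ballvol[of "R+1" 0] R by simp
        finally have "(\<Sum>(x, r)\<in>F'. v * r ^ n) \<le> v * (R + 1) ^ n" using v R by simp
        then have "v * (\<Sum>(x, r)\<in>F'. r ^ n) \<le> v * (R + 1) ^ n" by (simp add: sum_distrib_left case_prod_beta')
        then have vol: "(\<Sum>(x, r)\<in>F'. r ^ n) \<le> (R + 1) ^ n" using v by simp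
        have "(\<Sum>(x, r)\<in>F'. (2 * r) powr s) \<le> (\<Sum>(x, r)\<in>F'. 2 ^ n * (2 * \<delta>) powr (s - n) * r ^ n)"
        proof (intro sum_mono, clarify)
          fix x r assume xr: "(x, r) \<in> F'"
          have "(2 * r) powr s = (2 * r) powr real n * (2 * r) powr (s - n)" by (simp flip: powr_add)
          also have "\<dots> \<le> (2 * r) powr real n * (2 * \<delta>) powr (s - n)"
            using r[OF xr] s unfolding n_def by (intro mult_left_mono powr_mono2) auto
          also have "\<dots> = 2 ^ n * (2 * \<delta>) powr (s - n) * r ^ n"
            using r[OF xr] by (simp add: powr_realpow power_mult_distrib)
          finally show "(2 * r) powr s \<le> 2 ^ n * (2 * \<delta>) powr (s - n) * r ^ n" .
        qed
        also have "\<dots> = 2 ^ n * (2 * \<delta>) powr (s - n) * (\<Sum>(x, r)\<in>F'. r ^ n)"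
          by (simp add: sum_distrib_left case_prod_beta')
        also have "\<dots> \<le> 2 ^ n * (2 * \<delta>) powr (s - n) * (R + 1) ^ n" using vol by (intro mult_left_mono) auto
        also have "\<dots> = K * (2 * \<delta>) powr (s - n)" unfolding K_def by simp
        finally show ?thesis
          by (simp add: case_prod_beta' sum_ennreal ennreal_leI)
      qed
      have "(\<Sum>\<^sub>\<infinity>(x, r)\<in>F. ennreal ((2 * r) powr s)) = (SUP F'\<in>{F'. finite F' \<and> F' \<subseteq> F}. \<Sum>(x, r)\<in>F'. ennreal ((2 * r) powr s))"
        by (rule nonneg_infsum_complete) auto
      also have "\<dots> \<le> ennreal (K * (2 * \<delta>) powr (s - n))" using fin by (intro SUP_least) auto
      finally show ?thesis .
    qed
    then have "(SUP F\<in>delta_packings \<delta> A. (\<Sum>\<^sub>\<infinity>(x, r)\<in>F. ennreal ((2 * r) powr s))) \<le> ennreal (K * (2 * \<delta>) powr (s - n))"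
      by (intro SUP_least)
    then show ?thesis unfolding packing_premeasure_def using d by (intro INF_lower2[of \<delta>]) auto
  qed
  have "((\<lambda>\<delta>. K * (2 * \<delta>) powr (s - n)) \<longlongrightarrow> K * (2 * 0) powr (s - n)) (at_right 0)"
    using s unfolding n_def by (intro tendsto_intros tendsto_powr') (auto simp: eventually_at_right_less less_imp_le eventually_at_filter)
  then have "((\<lambda>\<delta>. ennreal (K * (2 * \<delta>) powr (s - n))) \<longlongrightarrow> ennreal 0) (at_right 0)"
    by (intro tendsto_ennrealI) simp
  moreover have "\<forall>\<^sub>F \<delta> in at_right (0::real). packing_premeasure s A \<le> ennreal (K * (2 * \<delta>) powr (s - n))"
    using eventually_at_right_real[of 0 1] by (rule eventually_mono) (auto intro: bound)
  ultimately have "packing_premeasure s A \<le> ennreal 0"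
    by (intro tendsto_lowerbound[of _ _ "at_right 0"]) auto
  then have pre: "packing_premeasure s A = 0" by simp
  define B where "B n = (if n = 0 then A else {})" for n :: nat
  have B0: "packing_premeasure s (B n) = 0" for n unfolding B_def using pre packing_premeasure_empty by auto
  have "packing_measure s A \<le> (\<Sum>n. packing_premeasure s (B n))"
    unfolding packing_measure_def B_def by (intro INF_lower) (auto intro!: exI[of _ 0])
  also have "\<dots> = 0" unfolding B0 by simp
  finally show ?thesis by simp
qed

section \<open>The dimension formulas\<close>

lemma decay_of_lower_order:
  assumes pos: "\<And>q. 1 \<le> q \<Longrightarrow> 0 < \<psi> q" and b: "ereal b < lower_order \<psi>"
  shows "\<forall>\<^sub>F q in sequentially. \<psi> q \<le> real q powr - b"
proof -
  have "\<forall>\<^sub>F q in sequentially. ereal b < ereal (- ln (\<psi> q) / ln (real q))"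
    using b unfolding lower_order_def by (rule less_LiminfD)
  with eventually_ge_at_top[of 2] show ?thesis
  proof eventually_elim
    case (elim q)
    have "0 < ln (real q)" using elim by simp
    moreover have "b < - ln (\<psi> q) / ln (real q)" using elim(2) by simp
    ultimately have "b * ln (real q) < - ln (\<psi> q)" by (simp only: pos_less_divide_eq)
    then have "ln (\<psi> q) < - b * ln (real q)" by simp
    then have "exp (ln (\<psi> q)) \<le> exp (- b * ln (real q))" by (intro exp_le_cancel_iff[THEN iffD2]) simp
    then show ?case using pos[of q] elim(1) by (simp add: powr_def)
  qed
qed

lemma powr_two_minus_mult:
  fixes x :: real
  assumes "0 < x" shows "x powr (2 - t * a) = x\<^sup>2 * (x powr - a) powr t"
proof -
  have "x powr (2 - t * a) = x powr 2 * x powr (- (t * a))" by (simp flip: powr_add)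
  also have "x powr (- (t * a)) = (x powr - a) powr t" by (simp add: powr_powr mult.commute)
  finally show ?thesis using assms by simp
qed

lemma frequently_large_of_lower_order:
  assumes pos: "\<And>q. 1 \<le> q \<Longrightarrow> 0 < \<psi> q" and a: "lower_order \<psi> < ereal a"
  shows "\<exists>\<^sub>F q in sequentially. real q powr - a \<le> \<psi> q"
proof (rule ccontr)
  assume "\<not> ?thesis"
  then have "\<forall>\<^sub>F q in sequentially. \<psi> q < real q powr - a" by (simp add: frequently_def not_le)
  with eventually_ge_at_top[of 2] have "\<forall>\<^sub>F q in sequentially. ereal a \<le> ereal (- ln (\<psi> q) / ln (real q))"
  proof eventually_elim
    case (elim q)
    have "ln (\<psi> q) < ln (real q powr - a)" using elim pos[of q] by (intro ln_less_cancel_iff[THEN iffD2]) auto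
    then have "a * ln (real q) \<le> - ln (\<psi> q)" using elim by (simp add: ln_powr)
    moreover have "0 < ln (real q)" using elim by simp
    ultimately have "a \<le> - ln (\<psi> q) / ln (real q)" by (simp only: pos_le_divide_eq)
    then show ?case by simp
  qed
  then have "ereal a \<le> lower_order \<psi>" unfolding lower_order_def by (rule Liminf_bounded)
  then show False using a by simp
qed

lemma approx_fun_of_lower_order:
  assumes pos: "\<And>q. 1 \<le> q \<Longrightarrow> 0 < \<psi> q" and anti: "antimono_on {1..} \<psi>" and lo: "2 < lower_order \<psi>"
  shows "\<exists>\<beta>. approx_fun \<psi> \<beta>"
proof -
  have "ereal 2 < lower_order \<psi>" using lo by simp
  then obtain \<beta> where "ereal 2 < ereal \<beta>" "ereal \<beta> < lower_order \<psi>" using ereal_dense2 by blast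
  moreover have "\<psi> q' \<le> \<psi> q" if "1 \<le> q" "q \<le> q'" for q q'
    using monotone_onD[OF anti, of q q'] that by auto
  ultimately show ?thesis using pos decay_of_lower_order[OF pos] by (intro exI[of _ \<beta>]) (unfold_locales; simp)
qed

text \<open>Finite and infinite orders are packaged together. The two quantified conjuncts provide
  the room for \<open>t\<close> below and \<open>u\<close> above \<open>2 / L\<close>; for infinite
  \<open>L\<close> the first is vacuous as \<open>D = 0\<close>.\<close>

lemma two_div_lower_order:
  assumes "2 < L" shows "\<exists>D. 2 / L = ereal D \<and> 0 \<le> D \<and> D < 1 \<and>
    (\<forall>t>0. t < D \<longrightarrow> (\<exists>a. L < ereal a \<and> t * a < 2)) \<and> (\<forall>u>D. \<exists>b. ereal b < L \<and> 2 < b * u)"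
proof (cases L)
  case (real l)
  then have l: "2 < l" using assms by simp
  have 1: "\<exists>a. L < ereal a \<and> t * a < 2" if "0 < t" "t < 2 / l" for t
  proof -
    have "l < 2 / t" using that l by (simp add: field_simps)
    then obtain a where "l < a" "a < 2 / t" using dense by blast
    then show ?thesis using that real by (intro exI[of _ a]) (simp add: field_simps)
  qed
  have 2: "\<exists>b. ereal b < L \<and> 2 < b * u" if "2 / l < u" for u
  proof -
    have u: "0 < u" using that l by (smt (verit) divide_pos_pos)
    then have "2 / u < l" using that l by (simp add: field_simps)
    then obtain b where "2 / u < b" "b < l" using dense by blast
    then show ?thesis using u real by (intro exI[of _ b]) (simp add: field_simps)
  qed
  have "2 / L = ereal (2 / l)" unfolding real using l by (metis ereal_divide less_irrefl less_trans numeral_eq_ereal zero_less_numeral)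
  then show ?thesis using l 1 2 by (intro exI[of _ "2 / l"]) auto
next
  case PInf
  have "\<exists>b. 2 < b * u" if "0 < u" for u :: real
    using that by (intro exI[of _ "3 / u"]) simp
  then show ?thesis unfolding PInf by (intro exI[of _ 0]) (auto simp: zero_ereal_def[symmetric])
next
  case MInf
  then show ?thesis using assms by simp
qed

text \<open>For \<open>t > 0\<close>, \<open>\<psi> Q \<ge> Q powr - a\<close> holds infinitely
  often and leaves the positive power \<open>Q powr (2 - t * a)\<close>. For \<open>t = 0\<close>
  the factor \<open>Q\<^sup>2\<close> alone suffices.\<close>

lemma frequently_quadratic_large:
  assumes pos: "\<And>q. 1 \<le> q \<Longrightarrow> 0 < \<psi> q" and t: "t = 0 \<or> (0 < t \<and> (\<exists>a. lower_order \<psi> < ereal a \<and> t * a < 2))"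
  shows "\<exists>\<^sub>F Q in sequentially. B \<le> (real Q)\<^sup>2 * \<psi> Q powr t"
  using t
proof
  assume "t = 0"
  have "filterlim (\<lambda>Q. (real Q)\<^sup>2) at_top sequentially" by real_asymp
  then have "\<forall>\<^sub>F Q in sequentially. B \<le> (real Q)\<^sup>2" by (simp add: filterlim_at_top)
  with eventually_ge_at_top[of 1] have "\<forall>\<^sub>F Q in sequentially. B \<le> (real Q)\<^sup>2 * \<psi> Q powr t"
  proof eventually_elim
    case (elim Q)
    then show ?case using pos[of Q] \<open>t = 0\<close> by simp
  qed
  then show ?thesis by (rule eventually_frequently[OF sequentially_bot])
next
  assume "0 < t \<and> (\<exists>a. lower_order \<psi> < ereal a \<and> t * a < 2)"
  then obtain a where a: "0 < t" "lower_order \<psi> < ereal a" "t * a < 2" by blast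
  have "filterlim (\<lambda>Q. real Q powr (2 - t * a)) at_top sequentially" using a by real_asymp
  then have "\<forall>\<^sub>F Q in sequentially. B \<le> real Q powr (2 - t * a)" by (simp add: filterlim_at_top)
  then have "\<exists>\<^sub>F Q in sequentially. real Q powr - a \<le> \<psi> Q \<and> (B \<le> real Q powr (2 - t * a) \<and> 1 \<le> Q)"
    by (intro frequently_eventually_frequently frequently_large_of_lower_order pos a eventually_conj eventually_ge_at_top)
  then show ?thesis
  proof (rule frequently_elim1)
    fix Q assume Q: "real Q powr - a \<le> \<psi> Q \<and> (B \<le> real Q powr (2 - t * a) \<and> 1 \<le> Q)"
    have "real Q powr (2 - t * a) = (real Q)\<^sup>2 * (real Q powr - a) powr t"
      using Q by (intro powr_two_minus_mult) simp
    also have "\<dots> \<le> (real Q)\<^sup>2 * \<psi> Q powr t" using Q a by (intro mult_left_mono powr_mono2) auto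
    finally show "B \<le> (real Q)\<^sup>2 * \<psi> Q powr t" using Q by simp
  qed
qed

lemma exact_prod_bounded: "bounded (exact_prod \<psi>)"
proof (rule bounded_subset[OF bounded_cbox])
  show "exact_prod \<psi> \<subseteq> cbox 0 1"
  proof
    fix x assume "x \<in> exact_prod \<psi>"
    then have "x $ i \<in> {0..<1}" for i unfolding exact_prod_def exact_set_def approx_set_def by blast
    then show "x \<in> cbox 0 1" by (simp add: mem_box_cart less_imp_le)
  qed
qed

locale approx_family =
  fixes \<psi> :: "'m::finite \<Rightarrow> nat \<Rightarrow> real"
  assumes pos: "\<And>i q. 1 \<le> q \<Longrightarrow> 0 < \<psi> i q" and anti: "\<And>i. antimono_on {1..} (\<psi> i)"
    and order: "\<And>i. 2 < lower_order (\<psi> i)"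
begin

definition two_over_order :: "'m \<Rightarrow> real" where
  "two_over_order i = real_of_ereal (2 / lower_order (\<psi> i))"

lemma two_over_order: "2 / lower_order (\<psi> i) = ereal (two_over_order i)" "0 \<le> two_over_order i" "two_over_order i < 1"
    "\<And>t. 0 < t \<Longrightarrow> t < two_over_order i \<Longrightarrow> \<exists>a. lower_order (\<psi> i) < ereal a \<and> t * a < 2"
    "\<And>u. two_over_order i < u \<Longrightarrow> \<exists>b. ereal b < lower_order (\<psi> i) \<and> 2 < b * u"
  using two_div_lower_order[OF order[of i]] unfolding two_over_order_def by (metis real_of_ereal.simps(1))+

lemma construction_exists:
  assumes "0 < \<epsilon>" "0 \<le> t" "t \<le> 1 - \<epsilon>" and t: "t = 0 \<or> (\<forall>i. t < two_over_order i)"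
  shows "\<exists>\<beta> c S \<sigma> \<delta>. cantor_product \<psi> \<beta> c S \<sigma> \<delta> \<epsilon> t"
proof -
  have "\<exists>\<beta>. approx_fun (\<psi> i) \<beta>" for i by (rule approx_fun_of_lower_order[OF pos anti order])
  then obtain \<beta> where "\<And>i. approx_fun (\<psi> i) (\<beta> i)" by metis
  moreover have "\<exists>\<^sub>F Q in sequentially. B \<le> (real Q)\<^sup>2 * \<psi> i Q powr t" for i B
  proof (rule frequently_quadratic_large[OF pos])
    show "t = 0 \<or> 0 < t \<and> (\<exists>a. lower_order (\<psi> i) < ereal a \<and> t * a < 2)"
    proof (cases "t = 0")
      case False
      then show ?thesis using t assms(2) two_over_order(4)[of t i] by simp
    qed simp
  qed
  ultimately show ?thesis using cantor_product_exists[of \<psi> \<beta> \<epsilon> t] assms by blast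
qed

lemma hausdorff_measure_nonzero_below:
  assumes s: "0 \<le> s" "s < real CARD('m) - 1 + Min (range two_over_order)"
  shows "hausdorff_measure s (exact_prod \<psi>) \<noteq> 0"
proof -
  define m where "m = real CARD('m)"
  have m: "1 \<le> m" unfolding m_def by (simp add: Suc_leI)
  define D where "D = Min (range two_over_order)"
  have D: "0 \<le> D" "D < 1" "\<And>i. D \<le> two_over_order i"
    unfolding D_def using two_over_order(2,3) by (auto simp: Min_less_iff)
  \<comment> \<open>The deficit \<open>\<gamma>\<close> is split: one half lowers \<open>D\<close>
    to \<open>t\<close>, the other bounds \<open>(m - 1) * \<epsilon>\<close>. The maximum with 0 in
    \<open>t\<close> covers small \<open>D\<close>, in particular infinite order.\<close>
  define \<gamma> where "\<gamma> = m - 1 + D - s"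
  have \<gamma>: "0 < \<gamma>" using s unfolding \<gamma>_def m_def D_def by simp
  define t where "t = max 0 (D - \<gamma> / 2)"
  have t: "0 \<le> t" "t < 1" "D - \<gamma> / 2 \<le> t" "t = 0 \<or> t < D" unfolding t_def using D \<gamma> by auto
  define \<epsilon> where "\<epsilon> = min (1 - t) (\<gamma> / (2 * m))"
  have eps: "0 < \<epsilon>" "t \<le> 1 - \<epsilon>" "\<epsilon> \<le> \<gamma> / (2 * m)" unfolding \<epsilon>_def using t \<gamma> m by auto
  have "t = 0 \<or> (\<forall>i. t < two_over_order i)" using t(4) D(3) by (metis order_less_le_trans)
  then obtain \<beta> c S \<sigma> \<delta> where "cantor_product \<psi> \<beta> c S \<sigma> \<delta> \<epsilon> t" using construction_exists eps t by blast
  then interpret cantor_product \<psi> \<beta> c S \<sigma> \<delta> \<epsilon> t .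
  define e where "e = (m - 1) * (1 - \<epsilon>) + t"
  have "(m - 1) * \<epsilon> \<le> m * (\<gamma> / (2 * m))" using eps m by (intro mult_mono) auto
  then have "(m - 1) * \<epsilon> \<le> \<gamma> / 2" using m by simp
  moreover have "e = m - 1 - (m - 1) * \<epsilon> + t" unfolding e_def by (simp add: algebra_simps)
  ultimately have se: "s \<le> e" using t(3) \<gamma>_def by linarith
  show ?thesis
  proof (rule hausdorff_measure_nonzero[OF s(1) se delta(1)[of 0] delta_le_1[of 0]])
    fix \<F> :: "((real^'m) \<times> real) set"
    assume F: "\<And>x r. (x, r) \<in> \<F> \<Longrightarrow> 0 < r \<and> r \<le> \<delta> 0" "exact_prod \<psi> \<subseteq> (\<Union>(x, r)\<in>\<F>. ball x r)"
    obtain \<F>' where "finite \<F>'" "\<F>' \<subseteq> \<F>" "1 \<le> (\<Sum>(x, r)\<in>\<F>'. r powr e)"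
    proof (rule finite_subcover[of \<F> e])
      show "limit_set \<subseteq> (\<Union>(x, r)\<in>\<F>. ball x r)" using limit_set_subset F(2) by blast
      show "\<forall>\<^sub>F N in sequentially. \<forall>x::real^'m. (\<Prod>i\<in>UNIV. hit_ratio (S N i) (cball (x $ i) r)) \<le> r powr e"
        if "(x, r) \<in> \<F>" for x r
        unfolding e_def m_def using prod_hit_ratio_scale F(1)[OF that] by blast
    qed
    then show "\<exists>\<F>'. finite \<F>' \<and> \<F>' \<subseteq> \<F> \<and> 1 \<le> (\<Sum>(x, r)\<in>\<F>'. r powr e)" by blast
  qed
qed

lemma packing_measure_nonzero_below:
  assumes s: "0 \<le> s" "s < real CARD('m)"
  shows "packing_measure s (exact_prod \<psi>) \<noteq> 0"
proof -
  define m where "m = real CARD('m)"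
  have m: "0 < m" unfolding m_def by simp
  \<comment> \<open>Chosen so that \<open>m * (1 - \<epsilon>) = s\<close>. The construction is run
    with \<open>t = 0\<close>, as only the scales \<open>\<delta> n\<close> count here.\<close>
  define \<epsilon> where "\<epsilon> = 1 - s / m"
  have eps: "0 < \<epsilon>" "0 \<le> 1 - \<epsilon>" unfolding \<epsilon>_def using s m by (auto simp: m_def)
  then obtain \<beta> c S \<sigma> \<delta> where "cantor_product \<psi> \<beta> c S \<sigma> \<delta> \<epsilon> 0" using construction_exists by blast
  then interpret cantor_product \<psi> \<beta> c S \<sigma> \<delta> \<epsilon> 0 .
  have e: "m * (1 - \<epsilon>) = s" unfolding \<epsilon>_def using m by simp
  show ?thesis
  proof (rule packing_measure_nonzero[OF s(1) order_refl, of "range \<delta>"])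
    show "0 < g \<and> g \<le> 1" if "g \<in> range \<delta>" for g using that delta(1) delta_le_1 by auto
    show "\<exists>g\<in>range \<delta>. g < d" if "0 < d" for d
    proof -
      have "(\<lambda>n. 1 / (real n + 1)) \<longlonglongrightarrow> 0" by real_asymp
      then have "\<forall>\<^sub>F n in sequentially. 1 / (real n + 1) < d" using that by (intro order_tendstoD) auto
      then obtain n where "1 / (real n + 1) < d" unfolding eventually_sequentially by blast
      then show ?thesis using delta(2)[of n] by (intro bexI[of _ "\<delta> n"]) auto
    qed
    fix \<F> :: "((real^'m) \<times> real) set"
    assume F: "\<And>x r. (x, r) \<in> \<F> \<Longrightarrow> r \<in> range \<delta>" "exact_prod \<psi> \<subseteq> (\<Union>(x, r)\<in>\<F>. ball x r)"
    obtain \<F>' where "finite \<F>'" "\<F>' \<subseteq> \<F>" "1 \<le> (\<Sum>(x, r)\<in>\<F>'. r powr s)"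
    proof (rule finite_subcover[of \<F> s])
      show "limit_set \<subseteq> (\<Union>(x, r)\<in>\<F>. ball x r)" using limit_set_subset F(2) by blast
      show "\<forall>\<^sub>F N in sequentially. \<forall>x::real^'m. (\<Prod>i\<in>UNIV. hit_ratio (S N i) (cball (x $ i) r)) \<le> r powr s"
        if xr: "(x, r) \<in> \<F>" for x r
      proof -
        obtain n where "r = \<delta> n" using F(1)[OF xr] by blast
        then show ?thesis using prod_hit_ratio_delta[of n] e unfolding m_def by simp
      qed
    qed
    then show "\<exists>\<F>'. finite \<F>' \<and> \<F>' \<subseteq> \<F> \<and> 1 \<le> (\<Sum>(x, r)\<in>\<F>'. r powr s)" by blast
  qed
qed

lemma hausdorff_measure_zero_above:
  assumes u: "two_over_order j < u"
  shows "hausdorff_measure (real CARD('m) - 1 + u) (exact_prod \<psi>) = 0"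
proof -
  have u0: "0 < u" using u two_over_order(2)[of j] by linarith
  obtain b where b: "ereal b < lower_order (\<psi> j)" "2 < b * u" using two_over_order(5)[OF u] by blast
  have b0: "0 < b" using b(2) u0 by (smt (verit) mult_nonpos_nonneg)
  have dec: "\<forall>\<^sub>F q in sequentially. \<psi> j q \<le> real q powr - b" by (rule decay_of_lower_order[OF pos b(1)])
  show ?thesis
  proof (rule hausdorff_measure_exact_prod_zero[OF pos _ u0])
    show "\<psi> j \<longlonglongrightarrow> 0"
    proof (rule tendsto_sandwich[OF _ dec])
      show "\<forall>\<^sub>F q in sequentially. 0 \<le> \<psi> j q"
        using eventually_ge_at_top[of 1] by eventually_elim (simp add: pos less_imp_le)
      show "(\<lambda>q. real q powr - b) \<longlonglongrightarrow> 0" using b0 by real_asymp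
    qed simp
    show "summable (\<lambda>q. real q * \<psi> j q powr u)"
    proof (rule summable_comparison_test_ev)
      show "summable (\<lambda>q. real q powr (1 - b * u))" using b by (simp add: summable_real_powr_iff)
      show "\<forall>\<^sub>F q in sequentially. norm (real q * \<psi> j q powr u) \<le> real q powr (1 - b * u)"
        using dec eventually_ge_at_top[of 1]
      proof eventually_elim
        case (elim q)
        have "real q * \<psi> j q powr u \<le> real q * (real q powr - b) powr u"
          using elim pos[of q j] u0 by (intro mult_left_mono powr_mono2) auto
        also have "\<dots> = real q powr 1 * real q powr (- (b * u))" using elim by (simp add: powr_powr)
        also have "\<dots> = real q powr (1 - b * u)" unfolding powr_add[symmetric] by simp
        finally show ?case by simp
      qed
    qed
  qed
qed

lemma hausdorff_dim_exact_prod: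
  "hausdorff_dim (exact_prod \<psi>) = ereal (real CARD('m) - 1 + Min (range two_over_order))"
proof (rule antisym)
  have m: "1 \<le> real CARD('m)" by (simp add: Suc_leI)
  have "Min (range two_over_order) \<in> range two_over_order" by (intro Min_in) auto
  then obtain j where j: "Min (range two_over_order) = two_over_order j" by blast
  show "hausdorff_dim (exact_prod \<psi>) \<le> ereal (real CARD('m) - 1 + Min (range two_over_order))"
  proof (rule ereal_le_epsilon2)
    fix e :: real assume e: "0 < e"
    have "hausdorff_measure (real CARD('m) - 1 + (two_over_order j + e)) (exact_prod \<psi>) = 0"
      using e by (intro hausdorff_measure_zero_above[of j]) simp
    moreover have "0 \<le> real CARD('m) - 1 + (two_over_order j + e)" using m two_over_order(2)[of j] e by linarith
    ultimately have "hausdorff_dim (exact_prod \<psi>) \<le> ereal (real CARD('m) - 1 + (two_over_order j + e))"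
      unfolding hausdorff_dim_def by (intro Inf_lower) blast
    then show "hausdorff_dim (exact_prod \<psi>) \<le> ereal (real CARD('m) - 1 + Min (range two_over_order)) + ereal e"
      unfolding j by (simp add: add_ac)
  qed
  show "ereal (real CARD('m) - 1 + Min (range two_over_order)) \<le> hausdorff_dim (exact_prod \<psi>)"
    unfolding hausdorff_dim_def
  proof (rule Inf_greatest)
    fix x assume "x \<in> {ereal s |s. 0 \<le> s \<and> hausdorff_measure s (exact_prod \<psi>) = 0}"
    then obtain s where s: "x = ereal s" "0 \<le> s" "hausdorff_measure s (exact_prod \<psi>) = 0" by blast
    then show "ereal (real CARD('m) - 1 + Min (range two_over_order)) \<le> x"
      using hausdorff_measure_nonzero_below[of s] by force
  qed
qed

lemma packing_dim_exact_prod: "packing_dim (exact_prod \<psi>) = ereal (real CARD('m))"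
proof (rule antisym)
  show "packing_dim (exact_prod \<psi>) \<le> ereal (real CARD('m))"
  proof (rule ereal_le_epsilon2)
    fix e :: real assume e: "0 < e"
    then have "packing_measure (real CARD('m) + e) (exact_prod \<psi>) = 0"
      by (intro packing_measure_zero exact_prod_bounded) simp
    then show "packing_dim (exact_prod \<psi>) \<le> ereal (real CARD('m)) + ereal e"
      unfolding packing_dim_def plus_ereal.simps using e by (intro Inf_lower) auto
  qed
  show "ereal (real CARD('m)) \<le> packing_dim (exact_prod \<psi>)"
    unfolding packing_dim_def
  proof (rule Inf_greatest)
    fix x assume "x \<in> {ereal s |s. 0 \<le> s \<and> packing_measure s (exact_prod \<psi>) = 0}"
    then obtain s where s: "x = ereal s" "0 \<le> s" "packing_measure s (exact_prod \<psi>) = 0" by blast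
    then show "ereal (real CARD('m)) \<le> x" using packing_measure_nonzero_below[of s] by force
  qed
qed

end

lemma lower_order_powr: "lower_order (\<lambda>q. real q powr - l) = ereal l"
  unfolding lower_order_def
proof (intro lim_imp_Liminf tendsto_eventually)
  show "\<forall>\<^sub>F q in sequentially. ereal (- ln (real q powr - l) / ln (real q)) = ereal l"
    using eventually_ge_at_top[of 2] by eventually_elim (simp add: ln_powr)
qed simp

lemma Min_range_ereal: "Min (range (\<lambda>i::'m::finite. ereal (f i))) = ereal (Min (range f))"
proof -
  have "ereal (Min (range f)) = Min (ereal ` range f)" by (intro mono_Min_commute) (auto simp: mono_def)
  then show ?thesis by (simp add: image_image)
qed

theorem corollary1:
  shows "(\<forall>\<psi> :: 'm::finite \<Rightarrow> nat \<Rightarrow> real.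
            (\<forall>i. (\<forall>q\<ge>1. 0 < \<psi> i q) \<and> antimono_on {1..} (\<psi> i) \<and> 2 < lower_order (\<psi> i)) \<longrightarrow>
            hausdorff_dim (exact_prod \<psi>) =
              ereal (real CARD('m) - 1) + Min (range (\<lambda>i. 2 / lower_order (\<psi> i))) \<and>
            packing_dim (exact_prod \<psi>) = ereal (real CARD('m)))
       \<and> (\<forall>l :: 'm \<Rightarrow> real. (\<forall>i. 2 < l i) \<longrightarrow>
            hausdorff_dim (exact_prod (\<lambda>i q. real q powr - l i)) =
              ereal (real CARD('m) - 1 + Min (range (\<lambda>i. 2 / l i))) \<and>
            packing_dim (exact_prod (\<lambda>i q. real q powr - l i)) = ereal (real CARD('m)))"
proof -
  have general: "hausdorff_dim (exact_prod \<psi>) =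
        ereal (real CARD('m) - 1) + Min (range (\<lambda>i. 2 / lower_order (\<psi> i))) \<and>
      packing_dim (exact_prod \<psi>) = ereal (real CARD('m))"
    if "\<forall>i. (\<forall>q\<ge>1. 0 < \<psi> i q) \<and> antimono_on {1..} (\<psi> i) \<and> 2 < lower_order (\<psi> i)"
    for \<psi> :: "'m \<Rightarrow> nat \<Rightarrow> real"
  proof -
    interpret approx_family \<psi> using that by unfold_locales auto
    show ?thesis
      unfolding two_over_order(1) Min_range_ereal plus_ereal.simps
      using hausdorff_dim_exact_prod packing_dim_exact_prod by blast
  qed
  show ?thesis
  proof (intro conjI allI impI)
    fix l :: "'m \<Rightarrow> real" assume l: "\<forall>i. 2 < l i"
    let ?\<psi> = "\<lambda>i q. real q powr - l i"
    have "antimono_on {1..} (?\<psi> i)" for i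
    proof (rule monotone_onI)
      fix q q' :: nat assume "q \<in> {1..}" "q' \<in> {1..}" "q \<le> q'"
      then show "real q' powr - l i \<le> real q powr - l i"
        using l[rule_format, of i] by (intro powr_mono2') auto
    qed
    then have gen: "hausdorff_dim (exact_prod ?\<psi>) =
        ereal (real CARD('m) - 1) + Min (range (\<lambda>i. 2 / lower_order (?\<psi> i)))"
        "packing_dim (exact_prod ?\<psi>) = ereal (real CARD('m))"
      using general[of ?\<psi>] l by (auto simp: lower_order_powr)
    have "2 / ereal (l i) = ereal (2 / l i)" for i
      using l[rule_format, of i] by (metis ereal_divide less_irrefl less_trans numeral_eq_ereal zero_less_numeral)
    then show "hausdorff_dim (exact_prod ?\<psi>) = ereal (real CARD('m) - 1 + Min (range (\<lambda>i. 2 / l i)))"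
      using gen(1) unfolding lower_order_powr by (simp add: Min_range_ereal)
    show "packing_dim (exact_prod ?\<psi>) = ereal (real CARD('m))" by (rule gen(2))
  qed (use general in blast)+
qed

end
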